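(* The $\ell_2$ necklace alignment problem on two necklaces with $n$ beads each can be solved in $O(n\lg n)$ time on a real RAM.
   Context: Necklace alignment problem: given $p\in[1,\infty]$ and two sorted vectors $\vec x=\langle x_0,\dots,x_{n-1}\rangle$, $\vec y=\langle y_0,\dots,y_{n-1}\rangle$ of reals in $[0,1)$ (bead positions on the unit-circumference circle), find an offset $c\in[0,1)$ and a shift $s\in\{0,1,\dots,n-1\}$ minimizing $\sum_{i=0}^{n-1}\big(d^\circ((x_i+c)\bmod 1,\,y_{(i+s)\bmod n})\big)^p$ (for $p=\infty$: minimizing $\max_{i}d^\circ((x_i+c)\bmod 1,\,y_{(i+s)\bmod n})$), where $d^\circ(a,b)=\min\{|a-b|,1-|a-b|\}$; "solving" means computing the optimal value and an optimal pair $(c,s)$. The $\ell_p$ necklace alignment problem is this problem for the given $p$. The real RAM is the model with unit-cost arithmetic operations and comparisons on real numbers. *)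

theory Defs
  imports Complex_Main
begin

definition circ_dist :: "real \<Rightarrow> real \<Rightarrow> real" where
  "circ_dist a b = min \<bar>a - b\<bar> (1 - \<bar>a - b\<bar>)"

text \<open>Objective of the l_2 necklace alignment problem for offset c and shift s;
  (x_i + c) mod 1 is written frac (x_i + c).\<close>
definition neck_cost2 :: "nat \<Rightarrow> (nat \<Rightarrow> real) \<Rightarrow> (nat \<Rightarrow> real) \<Rightarrow> real \<Rightarrow> nat \<Rightarrow> real" where
  "neck_cost2 n x y c s = (\<Sum>i<n. (circ_dist (frac (x i + c)) (y ((i + s) mod n))) ^ 2)"

definition valid_necklace :: "nat \<Rightarrow> (nat \<Rightarrow> real) \<Rightarrow> bool" where
  "valid_necklace n x \<longleftrightarrow> (\<forall>i<n. 0 \<le> x i \<and> x i < 1) \<and> (\<forall>i j. i \<le> j \<and> j < n \<longrightarrow> x i \<le> x j)"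

text \<open>Memory is an infinite array of real registers. Instructions have unit cost:
  integer constants, the field operations, square root, indirect addressing
  (the address register must hold a natural number) and a conditional jump on
  comparison. Division by zero, square root of a negative number, a non-natural
  address or running off the program are faults.\<close>

datatype instr =
    Const nat int
  | Add nat nat nat
  | Sub nat nat nat
  | Mul nat nat nat
  | Div nat nat nat
  | Sqrt nat nat
  | Load nat nat
  | Store nat nat
  | JmpLe nat nat nat
  | Halt

type_synonym ram_state = "nat \<times> (nat \<Rightarrow> real)"

definition ram_step :: "instr list \<Rightarrow> ram_state \<Rightarrow> ram_state option" where
  "ram_step P st = (case st of (pc, m) \<Rightarrow>
     if length P \<le> pc then None else
     (case P ! pc of
        Const d k \<Rightarrow> Some (Suc pc, m(d := of_int k))
      | Add d a b \<Rightarrow> Some (Suc pc, m(d := m a + m b))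
      | Sub d a b \<Rightarrow> Some (Suc pc, m(d := m a - m b))
      | Mul d a b \<Rightarrow> Some (Suc pc, m(d := m a * m b))
      | Div d a b \<Rightarrow> (if m b = 0 then None else Some (Suc pc, m(d := m a / m b)))
      | Sqrt d a \<Rightarrow> (if m a < 0 then None else Some (Suc pc, m(d := sqrt (m a))))
      | Load d a \<Rightarrow> (if m a \<in> \<nat> then Some (Suc pc, m(d := m (nat \<lfloor>m a\<rfloor>))) else None)
      | Store a b \<Rightarrow> (if m a \<in> \<nat> then Some (Suc pc, m(nat \<lfloor>m a\<rfloor> := m b)) else None)
      | JmpLe a b t \<Rightarrow> Some (if m a \<le> m b then t else Suc pc, m)
      | Halt \<Rightarrow> Some (pc, m)))"

fun ram_run :: "instr list \<Rightarrow> nat \<Rightarrow> ram_state \<Rightarrow> ram_state option" where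
  "ram_run P 0 st = Some st"
| "ram_run P (Suc k) st = Option.bind (ram_run P k st) (ram_step P)"

definition ram_halted :: "instr list \<Rightarrow> ram_state \<Rightarrow> bool" where
  "ram_halted P st \<longleftrightarrow> fst st < length P \<and> P ! fst st = Halt"

definition ram_halts_within :: "instr list \<Rightarrow> (nat \<Rightarrow> real) \<Rightarrow> nat \<Rightarrow> (nat \<Rightarrow> real) \<Rightarrow> bool" where
  "ram_halts_within P m0 T m \<longleftrightarrow>
     (\<exists>k pc. k \<le> T \<and> ram_run P k (0, m0) = Some (pc, m) \<and> ram_halted P (pc, m))"

definition neck_input :: "nat \<Rightarrow> (nat \<Rightarrow> real) \<Rightarrow> (nat \<Rightarrow> real) \<Rightarrow> nat \<Rightarrow> real" where
  "neck_input n x y j =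
     (if j = 0 then real n
      else if j \<le> n then x (j - 1)
      else if j \<le> 2 * n then y (j - n - 1)
      else 0)"

definition solves_l2_necklace :: "nat \<Rightarrow> (nat \<Rightarrow> real) \<Rightarrow> (nat \<Rightarrow> real) \<Rightarrow> (nat \<Rightarrow> real) \<Rightarrow> bool" where
  "solves_l2_necklace n x y m \<longleftrightarrow>
     (\<exists>s::nat. m 2 = real s \<and> s < n \<and> 0 \<le> m 1 \<and> m 1 < 1 \<and>
        m 0 = neck_cost2 n x y (m 1) s \<and>
        (\<forall>c' s'. 0 \<le> c' \<and> c' < 1 \<and> s' < n \<longrightarrow> m 0 \<le> neck_cost2 n x y c' s'))"

end

theory Submission
  imports Defs "HOL-Computational_Algebra.Polynomial_Factorial"
    "HOL-Computational_Algebra.Field_as_Ring"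
begin

text \<open>
  Unroll \<open>y\<close> to the line by \<open>y (j + n) = y j + 1\<close>.  Choosing nearest representatives turns any pair
  \<open>(c, s)\<close> into a periodic matching of the beads on the line, and by linear programming duality such a
  matching costs at least as much as the order-preserving shift with the same mean displacement.
  Hence the optimum is the minimum over \<open>s < n\<close> of the quadratic functions
  \<open>\<Sum>i<n. (x i + c - y (i + s))^2\<close> of \<open>c\<close>, whose minima are explicit in terms of prefix sums and of the
  correlations \<open>\<Sum>i<n. x i * y (i + s)\<close>.

  The correlations are coefficients of a product of two polynomials, computed modulo \<open>t^N + 1\<close>
  (\<open>N \<ge> 3 n\<close> a power of two) by Bruun's real variant of the fast Fourier transform: as
  \<open>t^4h - a t^2h + 1 = (t^2h - r t^h + 1) (t^2h + r t^h + 1)\<close> with \<open>r = sqrt (2 + a)\<close>, the problem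
  splits recursively into two of half the size, and square roots are the only constants needed.

  Costs are counted in a structured while language over disjoint registers and heap; compiling it
  to the machine loses only the constant factor given by the code length.
\<close>

section \<open>Optimal matchings on the circle\<close>

text \<open>A termwise comparison fails because nearest representatives need not match the beads in
  order. Dual potentials settle this: being periodic up to a constant drift, their sum over a
  periodic matching depends only on the mean displacement, so it is the same for the
  order-preserving shift with that displacement. The machine has neither pi nor trigonometric
  functions. With \<open>a = 2 cos theta\<close>, \<open>r = sqrt (2 + a)\<close> is
  \<open>2 cos (theta / 2)\<close>, the half-angle formula; starting from \<open>a = 0\<close>, all
  parameters stay strictly between -2 and 2, so no root of a negative number and no division by zero
  arises. The backward pass needs no Bezout coefficients: it only has to produce an array that
  splits into the products one level deeper, and divisibility by coprime factors does the rest. The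
  input lies where registers would be, and there is neither floor nor logarithm. Hence the first
  cells are relocated, the power of two is found by doubling, and the offset is reduced modulo 1 by
  comparisons.\<close>

lemma circ_dist_le:
  assumes "0 \<le> b" "b < 1"
  shows "(circ_dist (frac a) b)\<^sup>2 \<le> (a - b - of_int k)\<^sup>2"
proof -
  define f where "f = frac a"
  have f: "0 \<le> f" "f < 1" "a = f + of_int \<lfloor>a\<rfloor>"
    using frac_lt_1[of a] by (simp_all add: f_def) (simp add: frac_def)
  define k' where "k' = k - \<lfloor>a\<rfloor>"
  have eq: "a - b - of_int k = f - b - of_int k'" using f(3) by (simp add: k'_def)
  have "\<bar>f - b\<bar> < 1" using f assms by auto
  then have "0 \<le> circ_dist f b" by (simp add: circ_dist_def)
  moreover have "circ_dist f b \<le> \<bar>f - b - of_int k'\<bar>"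
  proof (cases "k' = 0")
    \<comment> \<open>For \<open>k'\<close> nonzero, the triangle inequality gives a distance of at
      least \<open>1 - \<bar>f - b\<bar>\<close>.\<close>
    case False
    then have "1 \<le> \<bar>of_int k' :: real\<bar>" by linarith
    then show ?thesis by (simp add: circ_dist_def)
  qed (simp add: circ_dist_def)
  ultimately have "(circ_dist f b)\<^sup>2 \<le> \<bar>f - b - of_int k'\<bar>\<^sup>2" by (rule power_mono[rotated])
  then show ?thesis by (simp add: f_def[symmetric] eq)
qed

text \<open>The cases of the minimum and the absolute value pick the translate by the floor of
  \<open>a\<close>, by one more, or by one less. With \<open>circ_dist_le\<close>, the squared
  circular distance is thus the minimum over all integer translates.\<close>

lemma circ_dist_eq:
  assumes "0 \<le> b" "b < 1"
  shows "\<exists>k. (circ_dist (frac a) b)\<^sup>2 = (a - b - of_int k)\<^sup>2"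
proof -
  have f: "0 \<le> frac a" "frac a < 1" "frac a = a - of_int \<lfloor>a\<rfloor>"
    using frac_lt_1[of a] by simp_all (simp add: frac_def)
  consider "circ_dist (frac a) b = \<bar>frac a - b\<bar>" | "circ_dist (frac a) b = 1 - (frac a - b)"
    | "circ_dist (frac a) b = 1 + (frac a - b)"
    unfolding circ_dist_def min_def by argo
  then show ?thesis
  proof cases
    case 1
    moreover have "frac a - b = a - b - of_int \<lfloor>a\<rfloor>" using f(3) by simp
    ultimately have "(circ_dist (frac a) b)\<^sup>2 = (a - b - of_int \<lfloor>a\<rfloor>)\<^sup>2" by simp
    then show ?thesis by blast
  next
    case 2
    then have "circ_dist (frac a) b = - (a - b - of_int (\<lfloor>a\<rfloor> + 1))" using f(3) by simp
    then show ?thesis by (metis power2_minus)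
  next
    case 3
    then have "circ_dist (frac a) b = a - b - of_int (\<lfloor>a\<rfloor> - 1)" using f(3) by simp
    then show ?thesis by metis
  qed
qed

text \<open>At most one of the two ranges is nonempty, so the witness is the signed sum from 0 to
  \<open>i\<close>; it prescribes a function on all integers by its increments.\<close>

lemma int_primitive: "\<exists>a :: int \<Rightarrow> real. \<forall>i. a (i + 1) = a i + d i"
proof (intro exI allI)
  fix i :: int
  let ?a = "\<lambda>i. (\<Sum>l\<in>{0..<i}. d l) - (\<Sum>l\<in>{i..<0}. d l)"
  show "?a (i + 1) = ?a i + d i"
  proof (cases "0 \<le> i")
    case True
    then have "{0..<i + 1} = insert i {0..<i}" by auto
    then show ?thesis using True by simp
  next
    case False
    then have "{i..<0} = insert i {i + 1..<0}" by auto
    then show ?thesis using False by simp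
  qed
qed

lemma int_const:
  assumes "\<And>i :: int. f (i + 1) = f i"
  shows "f i = f 0"
proof (induction i rule: int_induct[where k = 0])
  case (step2 i)
  then show ?case using assms[of "i - 1"] by simp
qed (use assms in auto)

locale periodic_pair =
  fixes X Z :: "int \<Rightarrow> real" and n :: nat
  assumes X_mono: "i \<le> j \<Longrightarrow> X i \<le> X j" and Z_mono: "i \<le> j \<Longrightarrow> Z i \<le> Z j"
    and X_period: "X (i + int n) = X i + 1" and Z_period: "Z (i + int n) = Z i + 1"
begin

text \<open>Linear programming duality for transport on the circle: potentials \<open>u\<close>, \<open>v\<close> that are
  periodic up to a drift certify that matching \<open>i\<close> with \<open>i\<close> is optimal among the periodic
  matchings of the same mean shift.  They come from a discrete convex function \<open>a\<close> of \<open>X\<close> with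
  slopes \<open>Z\<close>.\<close>

lemma potentials:
  obtains u v :: "int \<Rightarrow> real" and l :: real
  where "\<And>i j. u i + v j \<le> (X i - Z j)\<^sup>2" "\<And>i. u i + v i = (X i - Z i)\<^sup>2"
    "\<And>j. v (j + int n) = v j + l"
proof -
  obtain a :: "int \<Rightarrow> real" where a: "\<And>i. a (i + 1) = a i + (X (i + 1) - X i) * Z i"
    using int_primitive[of "\<lambda>i. (X (i + 1) - X i) * Z i"] by auto
  \<comment> \<open>As a function of the points \<open>X i\<close>, \<open>a\<close> is piecewise
    linear with slope \<open>Z i\<close> between \<open>X i\<close> and \<open>X (i + 1)\<close>.
    The slopes increase, so it is convex and \<open>Z j\<close> is a subgradient at
    \<open>X j\<close>.\<close>
  have subgradient: "Z j * (X i - X j) \<le> a i - a j" for i j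
  proof (cases "j \<le> i")
    case True
    then show ?thesis
    proof (induction i rule: int_ge_induct)
      case (step i)
      have "Z j * (X (i + 1) - X i) \<le> Z i * (X (i + 1) - X i)"
        using step.hyps by (intro mult_right_mono) (auto simp: Z_mono X_mono)
      then show ?case using step.IH a[of i] by (simp add: algebra_simps)
    qed simp
  next
    case False
    then have "i \<le> j" by simp
    then show ?thesis
    proof (induction i rule: int_le_induct)
      case (step i)
      have "Z (i - 1) * (X i - X (i - 1)) \<le> Z j * (X i - X (i - 1))"
        using step.hyps by (intro mult_right_mono) (auto simp: Z_mono X_mono)
      then show ?case using step.IH a[of "i - 1"] by (simp add: algebra_simps)
    qed simp
  qed
  \<comment> \<open>Over one period every slope grows by 1, so \<open>a (i + int n) - a i\<close>
    grows exactly like \<open>X i\<close>. The remaining constant determines the drift of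
    \<open>v\<close>.\<close>
  define D where "D i = a (i + int n) - a i - X i" for i
  have "D (i + 1) = D i" for i
  proof -
    have "a (i + int n + 1) = a (i + int n) + (X (i + int n + 1) - X (i + int n)) * Z (i + int n)"
      by (rule a)
    moreover have "X (i + int n + 1) = X (i + 1) + 1" using X_period[of "i + 1"] by (simp add: add_ac)
    ultimately show ?thesis using a[of i] X_period[of i] Z_period[of i]
      by (simp add: D_def add_ac) (simp add: algebra_simps)
  qed
  then have D: "D i = D 0" for i by (rule int_const)
  \<comment> \<open>With this choice the slack \<open>(X i - Z j)^2 - u i - v j\<close> is twice the
    slack of the subgradient inequality.\<close>
  define u where "u i = (X i)\<^sup>2 - 2 * a i" for i
  define v where "v i = (X i - Z i)\<^sup>2 - u i" for i
  show thesis
  proof (rule that[of u v "2 * D 0 - 1"])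
    show "u i + v j \<le> (X i - Z j)\<^sup>2" for i j
      using subgradient[of j i] by (simp add: u_def v_def power2_eq_square algebra_simps)
    show "u i + v i = (X i - Z i)\<^sup>2" for i by (simp add: v_def)
    show "v (j + int n) = v j + (2 * D 0 - 1)" for j
    proof -
      have "a (j + int n) = a j + X j + D 0" using D[of j] by (simp add: D_def)
      then show ?thesis
        by (simp add: v_def u_def X_period Z_period power2_eq_square algebra_simps)
    qed
  qed
qed

end

lemma sum_mod_shift:
  assumes "n \<ge> 1"
  shows "(\<Sum>i<n. g (nat ((int i + t) mod int n))) = (\<Sum>i<n. g i)"
proof -
  let ?f = "\<lambda>i. nat ((int i + t) mod int n)"
  have inj: "inj_on ?f {..<n}"
  proof
    fix i j assume ij: "i \<in> {..<n}" "j \<in> {..<n}" "?f i = ?f j"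
    then have "(int i + t) mod int n = (int j + t) mod int n"
      using assms by (metis eq_nat_nat_iff of_nat_0_less_iff pos_mod_sign less_le_trans zero_less_one)
    then have "int i mod int n = int j mod int n"
      by (metis add_diff_cancel_right' mod_diff_left_eq)
    then show "i = j" using ij by simp
  qed
  moreover have "?f ` {..<n} \<subseteq> {..<n}" using assms by (auto simp: nat_less_iff)
  ultimately have "?f ` {..<n} = {..<n}" by (simp add: endo_inj_surj)
  then show ?thesis using sum.reindex[OF inj, of g] by simp
qed

text \<open>The remainders of \<open>int i + t\<close> permute \<open>0, ..., n - 1\<close>, so
  summing the division identity isolates the quotients. In the duality argument this measures the
  drift along the plain shift by \<open>t\<close>.\<close>

lemma sum_div_shift:
  assumes "n \<ge> 1"
  shows "(\<Sum>i<n. (int i + t) div int n) = t"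
proof -
  have "(\<Sum>i<n. (int i + t) mod int n) = (\<Sum>i<n. int (nat ((int i + t) mod int n)))"
    using assms by (intro sum.cong) auto
  also have "\<dots> = (\<Sum>i<n. int i)" using assms by (rule sum_mod_shift)
  finally have mod: "(\<Sum>i<n. (int i + t) mod int n) = (\<Sum>i<n. int i)" .
  have "(\<Sum>i<n. int i + t) = (\<Sum>i<n. int n * ((int i + t) div int n) + (int i + t) mod int n)"
    by (intro sum.cong) auto
  also have "\<dots> = int n * (\<Sum>i<n. (int i + t) div int n) + (\<Sum>i<n. int i)"
    by (simp only: sum.distrib mod sum_distrib_left)
  finally have "(\<Sum>i<n. int i + t) = int n * (\<Sum>i<n. (int i + t) div int n) + (\<Sum>i<n. int i)" .
  then have "int n * t = int n * (\<Sum>i<n. (int i + t) div int n)" by (simp add: sum.distrib)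
  then show ?thesis using assms by simp
qed

section \<open>Circular cost against order-preserving shifts on the line\<close>

definition unroll :: "nat \<Rightarrow> (nat \<Rightarrow> real) \<Rightarrow> int \<Rightarrow> real" where
  "unroll n x i = x (nat (i mod int n)) + of_int (i div int n)"

lemma unroll_period: "n \<ge> 1 \<Longrightarrow> unroll n x (i + int n * k) = unroll n x i + of_int k"
  by (simp add: unroll_def)

lemma unroll_mono:
  assumes "n \<ge> 1" "valid_necklace n x" "i \<le> j"
  shows "unroll n x i \<le> unroll n x j"
proof -
  have m: "nat (k mod int n) < n" for k using assms(1) by (simp add: nat_less_iff)
  have d: "i div int n \<le> j div int n" using assms(1,3) by (simp add: zdiv_mono1)
  show ?thesis
  proof (cases "i div int n = j div int n")
    case True
    then have "i mod int n \<le> j mod int n" using assms(3)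
      by (metis add_le_cancel_left mult_div_mod_eq)
    then have "x (nat (i mod int n)) \<le> x (nat (j mod int n))"
      using assms(2) m[of j] unfolding valid_necklace_def by (simp add: nat_mono)
    then show ?thesis by (simp add: unroll_def True)
  next
    case False
    with d have "of_int (i div int n) + 1 \<le> (of_int (j div int n) :: real)" by linarith
    moreover have "x (nat (i mod int n)) < 1" "0 \<le> x (nat (j mod int n))"
      using assms(2) m unfolding valid_necklace_def by blast+
    ultimately show ?thesis by (simp add: unroll_def)
  qed
qed

text \<open>Distances are taken on the line, and \<open>t\<close> may be any integer: multiples of
  \<open>n\<close> encode whole turns.\<close>

definition shift_cost :: "nat \<Rightarrow> (nat \<Rightarrow> real) \<Rightarrow> (nat \<Rightarrow> real) \<Rightarrow> real \<Rightarrow> int \<Rightarrow> real" where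
  "shift_cost n x y c t = (\<Sum>i<n. (x i + c - unroll n y (int i + t))\<^sup>2)"

text \<open>\<open>unroll\<close> picks one particular integer translate of each bead of
  \<open>y\<close>, which bounds the circular distance from above; passing to \<open>frac c\<close>
  changes nothing modulo 1.\<close>

lemma neck_cost2_le_shift_cost:
  assumes "n \<ge> 1" "valid_necklace n y"
  shows "neck_cost2 n x y (frac c) s \<le> shift_cost n x y c (int s)"
  unfolding neck_cost2_def shift_cost_def
proof (rule sum_mono)
  fix i assume "i \<in> {..<n}"
  have m: "0 \<le> y ((i + s) mod n)" "y ((i + s) mod n) < 1"
    using assms unfolding valid_necklace_def by auto
  have "frac (x i + frac c) = frac (x i + c)"
    using floor_diff_of_int[of "x i + c" "\<lfloor>c\<rfloor>"] by (simp add: frac_def add_diff_eq)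
  moreover have "unroll n y (int i + int s) = y ((i + s) mod n) + of_int ((int i + int s) div int n)"
    unfolding unroll_def by (simp add: nat_mod_distrib nat_add_distrib)
  ultimately show "(circ_dist (frac (x i + frac c)) (y ((i + s) mod n)))\<^sup>2
      \<le> (x i + c - unroll n y (int i + int s))\<^sup>2"
    using circ_dist_le[OF m, of "x i + c" "(int i + int s) div int n"] by (simp add: diff_diff_eq)
qed

text \<open>Weak duality. Bead \<open>i\<close> is matched with index
  \<open>(i + s) mod n + n * k i\<close> of the unrolled \<open>y\<close>. The residues form a
  permutation, so the mean displacement is the sum of the \<open>k i\<close>, and this is the
  competing shift \<open>t\<close>.\<close>

lemma neck_cost2_ge_shift_cost:
  assumes n: "n \<ge> 1" and x: "valid_necklace n x" and y: "valid_necklace n y"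
  shows "\<exists>t. shift_cost n x y c t \<le> neck_cost2 n x y c s"
proof -
  have "\<exists>k. (circ_dist (frac (x i + c)) (y ((i + s) mod n)))\<^sup>2 = (x i + c - y ((i + s) mod n) - of_int k)\<^sup>2" for i
    using y n unfolding valid_necklace_def by (intro circ_dist_eq) auto
  then obtain k :: "nat \<Rightarrow> int" where k: "\<And>i. (circ_dist (frac (x i + c)) (y ((i + s) mod n)))\<^sup>2
      = (x i + c - y ((i + s) mod n) - of_int (k i))\<^sup>2"
    by metis
  define t where "t = (\<Sum>i<n. k i)"
  define X where "X i = unroll n x i + c" for i
  \<comment> \<open>Indices of \<open>Z\<close> already include the shift \<open>t\<close>, so the
    order-preserving matching becomes the diagonal \<open>i\<close> against
    \<open>i\<close>.\<close>
  define Z where "Z j = unroll n y (j + t)" for j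
  interpret periodic_pair X Z n
    using unroll_mono[OF n x] unroll_mono[OF n y] unroll_period[OF n, of x _ 1]
      unroll_period[OF n, of y "_ + t" 1]
    by unfold_locales (auto simp: X_def Z_def add_ac)
  obtain u v l where uv: "\<And>i j. u i + v j \<le> (X i - Z j)\<^sup>2" "\<And>i. u i + v i = (X i - Z i)\<^sup>2"
    "\<And>j. v (j + int n) = v j + l" by (rule potentials) blast
  have v: "v (j + int n * q) = v j + l * of_int q" for j q
  proof (induction q rule: int_induct[where k = 0])
    case (step1 q)
    then show ?case using uv(3)[of "j + int n * q"] by (simp add: algebra_simps)
  next
    case (step2 q)
    then show ?case using uv(3)[of "j + int n * (q - 1)"] by (simp add: algebra_simps)
  qed simp
  have X: "X (int i) = x i + c" if "i < n" for i using that by (simp add: X_def unroll_def)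
  \<comment> \<open>Both matchings meet each residue class modulo \<open>n\<close> once. The drift
    terms add up to \<open>l * t\<close> in both: by definition of \<open>t\<close> for the given
    matching, by \<open>sum_div_shift\<close> for the diagonal.\<close>
  define w where "w r = v (int r - t)" for r
  have "(\<Sum>i<n. v (int ((i + s) mod n) + int n * k i - t)) = (\<Sum>i<n. w ((i + s) mod n) + l * of_int (k i))"
    using v[of "int ((_ + s) mod n) - t"] by (intro sum.cong) (auto simp: w_def diff_add_eq)
  also have "\<dots> = (\<Sum>i<n. w (nat ((int i + int s) mod int n))) + l * of_int t"
    by (simp add: sum.distrib t_def sum_distrib_left nat_mod_distrib nat_add_distrib)
  also have "\<dots> = (\<Sum>i<n. w i) + l * of_int (\<Sum>i<n. (int i + t) div int n)"
    by (simp only: sum_mod_shift[OF n] sum_div_shift[OF n])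
  also have "\<dots> = (\<Sum>i<n. w (nat ((int i + t) mod int n)) + l * of_int ((int i + t) div int n))"
    by (simp add: sum_mod_shift[OF n] sum.distrib sum_distrib_left)
  also have "\<dots> = (\<Sum>i<n. v (int i))"
  proof (rule sum.cong[OF refl])
    fix i
    have "int i = (int i + t) mod int n - t + int n * ((int i + t) div int n)"
      using mod_mult_div_eq[of "int i + t" "int n"] by linarith
    then have "v (int i) = v ((int i + t) mod int n - t) + l * of_int ((int i + t) div int n)"
      by (metis v)
    then show "w (nat ((int i + t) mod int n)) + l * of_int ((int i + t) div int n) = v (int i)"
      using n by (simp add: w_def)
  qed
  finally have v_sum: "(\<Sum>i<n. v (int ((i + s) mod n) + int n * k i - t)) = (\<Sum>i<n. v (int i))" .
  have "shift_cost n x y c t = (\<Sum>i<n. (X (int i) - Z (int i))\<^sup>2)"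
    unfolding shift_cost_def by (intro sum.cong) (auto simp: X Z_def)
  also have "\<dots> = (\<Sum>i<n. u (int i)) + (\<Sum>i<n. v (int i))"
    by (simp add: uv(2)[symmetric] sum.distrib)
  also have "\<dots> = (\<Sum>i<n. u (int i) + v (int ((i + s) mod n) + int n * k i - t))"
    by (simp add: v_sum sum.distrib)
  also have "\<dots> \<le> (\<Sum>i<n. (X (int i) - Z (int ((i + s) mod n) + int n * k i - t))\<^sup>2)"
    by (intro sum_mono uv(1))
  also have "\<dots> = neck_cost2 n x y c s"
    unfolding neck_cost2_def
  proof (rule sum.cong[OF refl])
    fix i assume "i \<in> {..<n}"
    have "Z (int ((i + s) mod n) + int n * k i - t) = y ((i + s) mod n) + of_int (k i)"
      using n by (simp add: Z_def unroll_def)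
    then show "(X (int i) - Z (int ((i + s) mod n) + int n * k i - t))\<^sup>2
        = (circ_dist (frac (x i + c)) (y ((i + s) mod n)))\<^sup>2"
      using \<open>i \<in> _\<close> by (simp add: k X diff_diff_eq)
  qed
  finally show ?thesis by blast
qed

section \<open>Optimal offset for a fixed shift\<close>

lemma sum_square_shift_ge:
  fixes d :: "nat \<Rightarrow> real"
  assumes "n \<ge> 1"
  shows "(\<Sum>i<n. (d i)\<^sup>2) - (\<Sum>i<n. d i)\<^sup>2 / real n \<le> (\<Sum>i<n. (d i + c)\<^sup>2)"
    and "(\<Sum>i<n. (d i - (\<Sum>i<n. d i) / real n)\<^sup>2) = (\<Sum>i<n. (d i)\<^sup>2) - (\<Sum>i<n. d i)\<^sup>2 / real n"
proof -
  define S where "S = (\<Sum>i<n. d i)"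
  have n: "real n > 0" using assms by simp
  \<comment> \<open>Completing the square: the excess \<open>(n * c + S)^2 / n\<close> vanishes at
    \<open>c = - S / n\<close>.\<close>
  have eq: "(\<Sum>i<n. (d i + c)\<^sup>2) = (\<Sum>i<n. (d i)\<^sup>2) - S\<^sup>2 / real n + (real n * c + S)\<^sup>2 / real n" for c
  proof -
    have "(\<Sum>i<n. (d i + c)\<^sup>2) = (\<Sum>i<n. (d i)\<^sup>2) + 2 * c * S + real n * c\<^sup>2"
      by (simp add: power2_sum sum.distrib S_def sum_distrib_left mult_ac)
    then show ?thesis using n by (simp add: field_simps power2_eq_square)
  qed
  show "(\<Sum>i<n. (d i)\<^sup>2) - (\<Sum>i<n. d i)\<^sup>2 / real n \<le> (\<Sum>i<n. (d i + c)\<^sup>2)"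
    using eq[of c] n by (simp add: S_def)
  show "(\<Sum>i<n. (d i - (\<Sum>i<n. d i) / real n)\<^sup>2) = (\<Sum>i<n. (d i)\<^sup>2) - (\<Sum>i<n. d i)\<^sup>2 / real n"
    using eq[of "- S / real n"] n by (simp add: S_def)
qed

text \<open>Two periods with natural indices: a shift \<open>s < n\<close> reads no further, and
  this finite table is what the program stores.\<close>

definition unroll2 :: "nat \<Rightarrow> (nat \<Rightarrow> real) \<Rightarrow> nat \<Rightarrow> real" where
  "unroll2 n y j = (if j < n then y j else y (j - n) + 1)"

text \<open>The minimum of \<open>shift_cost n x y c (int s)\<close> over real \<open>c\<close>,
  namely \<open>n\<close> times the variance of the displacements.\<close>

definition shift_opt :: "nat \<Rightarrow> (nat \<Rightarrow> real) \<Rightarrow> (nat \<Rightarrow> real) \<Rightarrow> nat \<Rightarrow> real" where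
  "shift_opt n x y s = (\<Sum>i<n. (x i - unroll2 n y (i + s))\<^sup>2)
     - (\<Sum>i<n. x i - unroll2 n y (i + s))\<^sup>2 / real n"

lemma unroll_eq_unroll2:
  assumes "i < n" "s < n"
  shows "unroll n y (int i + int s) = unroll2 n y (i + s)"
proof -
  have "unroll n y (int (i + s)) = y ((i + s) mod n) + real ((i + s) div n)"
    unfolding unroll_def by (simp only: zmod_int[symmetric] zdiv_int[symmetric] nat_int of_int_of_nat_eq)
  moreover have "(i + s) mod n = i + s - n" "(i + s) div n = 1" if "\<not> i + s < n"
    using that assms by (auto simp: le_mod_geq le_div_geq not_less)
  ultimately show ?thesis by (auto simp: unroll2_def)
qed

lemma shift_cost_eq:
  assumes "s < n"
  shows "shift_cost n x y c (int s) = (\<Sum>i<n. ((x i - unroll2 n y (i + s)) + c)\<^sup>2)"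
  unfolding shift_cost_def using assms
  by (intro sum.cong) (auto simp: unroll_eq_unroll2 algebra_simps)

lemma shift_opt_le_neck_cost2:
  assumes "n \<ge> 1" "valid_necklace n x" "valid_necklace n y"
  shows "\<exists>s'<n. shift_opt n x y s' \<le> neck_cost2 n x y c s"
proof -
  obtain t where t: "shift_cost n x y c t \<le> neck_cost2 n x y c s"
    using neck_cost2_ge_shift_cost[OF assms] by blast
  define s' where "s' = nat (t mod int n)"
  have s': "s' < n" "int s' = t mod int n" using assms(1) by (auto simp: s'_def nat_less_iff)
  \<comment> \<open>Whole turns in \<open>t\<close> are absorbed by \<open>c\<close>, which
    \<open>shift_cost\<close> does not confine to the unit interval; so \<open>t\<close> may be
    reduced modulo \<open>n\<close>.\<close>
  have "unroll n y (int i + t) = unroll n y (int i + int s') + of_int (t div int n)" for i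
    using unroll_period[OF assms(1), of y "int i + int s'" "t div int n"] s'(2) by (simp add: add.assoc)
  then have "shift_cost n x y c t = shift_cost n x y (c - of_int (t div int n)) (int s')"
    by (simp add: shift_cost_def algebra_simps)
  then have "shift_opt n x y s' \<le> shift_cost n x y c t"
    unfolding shift_opt_def using sum_square_shift_ge(1)[OF assms(1)] by (simp add: shift_cost_eq[OF s'(1)])
  with t s'(1) show ?thesis by (meson order_trans)
qed

text \<open>A sandwich: at the optimal offset the circular cost is at most the line cost, which
  equals \<open>shift_opt n x y s\<close>; by minimality of \<open>s\<close> this value bounds every
  circular cost from below.\<close>

lemma neck_cost2_minimum:
  assumes "n \<ge> 1" "valid_necklace n x" "valid_necklace n y" "s < n"
    and min: "\<And>s'. s' < n \<Longrightarrow> shift_opt n x y s \<le> shift_opt n x y s'"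
  shows "neck_cost2 n x y (frac (- (\<Sum>i<n. x i - unroll2 n y (i + s)) / real n)) s = shift_opt n x y s"
    and "shift_opt n x y s \<le> neck_cost2 n x y c' s'"
proof -
  show ge: "shift_opt n x y s \<le> neck_cost2 n x y c' s'" for c' s'
    using shift_opt_le_neck_cost2[OF assms(1-3)] min by (meson order_trans)
  show "neck_cost2 n x y (frac (- (\<Sum>i<n. x i - unroll2 n y (i + s)) / real n)) s = shift_opt n x y s"
  proof (rule antisym[OF _ ge])
    have "shift_cost n x y (- (\<Sum>i<n. x i - unroll2 n y (i + s)) / real n) (int s) = shift_opt n x y s"
      unfolding shift_opt_def using sum_square_shift_ge(2)[OF assms(1)] by (simp add: shift_cost_eq[OF assms(4)])
    with neck_cost2_le_shift_cost[OF assms(1,3)]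
    show "neck_cost2 n x y (frac (- (\<Sum>i<n. x i - unroll2 n y (i + s)) / real n)) s \<le> shift_opt n x y s"
      by metis
  qed
qed

section \<open>Polynomial multiplication with square roots\<close>

text \<open>An array \<open>f\<close> of length \<open>B * H\<close> stores \<open>B\<close> polynomials of degree below \<open>H\<close> in transposed order:
  the coefficients of the \<open>b\<close>-th one are the entries at indices congruent to \<open>b\<close> modulo \<open>B\<close>.
  With this layout one level of the reduction is a single loop whose index arithmetic does not
  depend on the level.\<close>

definition block :: "nat \<Rightarrow> nat \<Rightarrow> (nat \<Rightarrow> real) \<Rightarrow> nat \<Rightarrow> real poly" where
  "block B H f b = (\<Sum>i<H. monom (f (i * B + b)) i)"

text \<open>With \<open>a = 2 cos theta\<close> this is the real product of
  \<open>t^h - exp (i theta)\<close> and its conjugate.\<close>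

definition modulus :: "nat \<Rightarrow> real \<Rightarrow> real poly" where
  "modulus h a = monom 1 (2 * h) - monom a h + 1"

text \<open>Reduction of every block modulo both factors of
  \<open>t^4h - a t^2h + 1 = (t^2h - r t^h + 1) (t^2h + r t^h + 1)\<close>, where \<open>r^2 = 2 + a\<close>; here \<open>q\<close> is a
  quarter of the array length, and the residues modulo the two factors go to blocks \<open>2 b\<close> and
  \<open>2 b + 1\<close>.\<close>

definition split_step :: "nat \<Rightarrow> (nat \<Rightarrow> real) \<Rightarrow> (nat \<Rightarrow> real) \<Rightarrow> (nat \<Rightarrow> real) \<Rightarrow> bool" where
  "split_step q r f f' \<longleftrightarrow> (\<forall>j<q.
     f' (2 * j) = f j - f (j + 2 * q) - r j * f (j + 3 * q) \<and>
     f' (2 * j + 1) = f j - f (j + 2 * q) + r j * f (j + 3 * q) \<and>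
     f' (2 * j + 2 * q) = f (j + q) + r j * f (j + 2 * q) + ((r j)\<^sup>2 - 1) * f (j + 3 * q) \<and>
     f' (2 * j + 1 + 2 * q) = f (j + q) - r j * f (j + 2 * q) + ((r j)\<^sup>2 - 1) * f (j + 3 * q))"

text \<open>A difference of two squares, \<open>(t^2h + 1)^2 - (r t^h)^2\<close>.\<close>

lemma modulus_split:
  assumes "r\<^sup>2 = 2 + a"
  shows "modulus (2 * h) a = modulus h r * modulus h (- r)"
proof -
  have a: "a = r * r - 2" using assms by (simp add: power2_eq_square)
  have "monom (r * r - 2) (2 * h) = monom (r * r) (2 * h) - monom 1 (2 * h) - monom 1 (2 * h)"
    by (simp add: diff_monom)
  then show ?thesis
    by (simp add: modulus_def a algebra_simps mult_monom flip: mult_2 minus_monom)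
qed

text \<open>Half the sum of the two is \<open>t^2h + 1\<close> and their difference is
  \<open>2 r t^h\<close>; a multiple of the latter by \<open>t^h\<close> cancels the leading term
  and leaves 1.\<close>

lemma coprime_modulus:
  assumes "r \<noteq> 0"
  shows "coprime (modulus h r) (modulus h (- r))"
proof (rule coprimeI)
  fix d assume d: "d dvd modulus h r" "d dvd modulus h (- r)"
  let ?D = "modulus h (- r) - modulus h r" and ?S = "modulus h (- r) + modulus h r"
  have "?S = smult 2 (monom 1 (2 * h) + 1)" "?D = smult (2 * r) (monom 1 h)"
    by (simp_all add: modulus_def smult_monom smult_add_right numeral_poly flip: minus_monom add_monom mult_2)
  then have "smult (1/2) ?S - smult (1 / (2 * r)) (?D * monom 1 h) = 1"
    using assms by (simp add: mult_monom flip: mult_2)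
  moreover have "d dvd smult (1/2) ?S - smult (1 / (2 * r)) (?D * monom 1 h)"
    using d by (intro dvd_diff dvd_smult dvd_mult2 dvd_add) auto
  ultimately show "is_unit d" by simp
qed

lemma sum_lessThan_add:
  fixes g :: "nat \<Rightarrow> 'a :: comm_monoid_add"
  shows "(\<Sum>i<m + k. g i) = (\<Sum>i<m. g i) + (\<Sum>i<k. g (m + i))"
  by (induction k) (auto simp: add_ac)

text \<open>Entries of one block lie \<open>B\<close> apart, so skipping \<open>H\<close>
  coefficients means moving on by \<open>H * B\<close> cells.\<close>

lemma block_append:
  "block B (H + K) f b = block B H f b + monom 1 H * block B K (\<lambda>i. f (i + H * B)) b"
  by (simp add: block_def sum_lessThan_add sum_distrib_left mult_monom algebra_simps)

lemma block_add: "block B H (\<lambda>i. f i + g i) b = block B H f b + block B H g b"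
  by (simp add: block_def sum.distrib flip: add_monom)

lemma block_diff: "block B H (\<lambda>i. f i - g i) b = block B H f b - block B H g b"
  by (simp add: block_def sum_subtractf flip: diff_monom)

lemma block_smult: "block B H (\<lambda>i. c * f i) b = smult c (block B H f b)"
  by (induction H) (simp_all add: block_def smult_add_right smult_monom)

text \<open>Modulo the first factor, \<open>t^2h = a t^h - 1\<close> and
  \<open>t^3h = (a^2 - 1) t^h - a\<close>; substituting these into the four quarters of a block
  gives the formulas of \<open>split_step\<close>. The second factor is the case
  \<open>- a\<close>.\<close>

lemma split_step_dvd:
  assumes step: "split_step (h * B) r f f'" and b: "b < B" and r: "\<And>i. i < h \<Longrightarrow> r (i * B + b) = a"
  shows "modulus h a dvd block B (4 * h) f b - block (2 * B) (2 * h) f' (2 * b)"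
    and "modulus h (- a) dvd block B (4 * h) f b - block (2 * B) (2 * h) f' (2 * b + 1)"
proof -
  define q where "q = h * B"
  define p where "p k = block B h (\<lambda>i. f (i + k * q)) b" for k
  have less: "i * B + b < q" if "i < h" for i
  proof -
    have "i * B + b < Suc i * B" using b by simp
    also have "\<dots> \<le> q" unfolding q_def using that by (intro mult_right_mono) auto
    finally show ?thesis .
  qed
  have "block B (h + (h + (h + h))) f b
      = p 0 + monom 1 h * (p 1 + monom 1 h * (p 2 + monom 1 h * p 3))"
    unfolding block_append
    by (simp add: p_def numeral_2_eq_2 numeral_3_eq_3 add.assoc add.commute add.left_commute flip: q_def)
  then have p: "block B (4 * h) f b = p 0 + monom 1 h * (p 1 + monom 1 h * (p 2 + monom 1 h * p 3))"
    by (simp add: numeral_eq_Suc)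
  have step': "f' (i * (2 * B) + 2 * b) = f (i * B + b) - f (i * B + b + 2 * q) - a * f (i * B + b + 3 * q)"
    "f' (i * (2 * B) + (2 * b + 1)) = f (i * B + b) - f (i * B + b + 2 * q) + a * f (i * B + b + 3 * q)"
    "f' (i * (2 * B) + 2 * b + h * (2 * B)) = f (i * B + b + 1 * q) + a * f (i * B + b + 2 * q)
       + (a\<^sup>2 - 1) * f (i * B + b + 3 * q)"
    "f' (i * (2 * B) + (2 * b + 1) + h * (2 * B)) = f (i * B + b + 1 * q) - a * f (i * B + b + 2 * q)
       + (a\<^sup>2 - 1) * f (i * B + b + 3 * q)" if "i < h" for i
  proof -
    have eqs: "i * (2 * B) + 2 * b = 2 * (i * B + b)" "i * (2 * B) + (2 * b + 1) = 2 * (i * B + b) + 1"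
      "h * (2 * B) = 2 * q" by (simp_all add: q_def)
    from step[folded q_def, unfolded split_step_def, rule_format, OF less[OF that]]
    show "f' (i * (2 * B) + 2 * b) = f (i * B + b) - f (i * B + b + 2 * q) - a * f (i * B + b + 3 * q)"
      "f' (i * (2 * B) + (2 * b + 1)) = f (i * B + b) - f (i * B + b + 2 * q) + a * f (i * B + b + 3 * q)"
      "f' (i * (2 * B) + 2 * b + h * (2 * B)) = f (i * B + b + 1 * q) + a * f (i * B + b + 2 * q)
         + (a\<^sup>2 - 1) * f (i * B + b + 3 * q)"
      "f' (i * (2 * B) + (2 * b + 1) + h * (2 * B)) = f (i * B + b + 1 * q) - a * f (i * B + b + 2 * q)
         + (a\<^sup>2 - 1) * f (i * B + b + 3 * q)"
      unfolding r[OF that] eqs mult_1 by blast+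
  qed
  have lo: "block (2 * B) h f' (2 * b) = p 0 - p 2 - smult a (p 3)"
    "block (2 * B) h f' (2 * b + 1) = p 0 - p 2 + smult a (p 3)"
    unfolding p_def block_smult[symmetric] block_add[symmetric] block_diff[symmetric]
    unfolding block_def using step'(1,2) by (auto intro!: sum.cong)
  have hi: "block (2 * B) h (\<lambda>i. f' (i + h * (2 * B))) (2 * b) = p 1 + smult a (p 2) + smult (a\<^sup>2 - 1) (p 3)"
    "block (2 * B) h (\<lambda>i. f' (i + h * (2 * B))) (2 * b + 1) = p 1 - smult a (p 2) + smult (a\<^sup>2 - 1) (p 3)"
    unfolding p_def block_smult[symmetric] block_add[symmetric] block_diff[symmetric]
    unfolding block_def using step'(3,4) by (auto intro!: sum.cong)
  have split: "block (2 * B) (2 * h) f' c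
      = block (2 * B) h f' c + monom 1 h * block (2 * B) h (\<lambda>i. f' (i + h * (2 * B))) c" for c
    using block_append[of "2 * B" h h f' c] by (simp flip: mult_2)
  have modulus: "modulus h a = monom 1 h * monom 1 h - smult a (monom 1 h) + 1" for a
    by (simp add: modulus_def mult_monom smult_monom mult_2)
  \<comment> \<open>The quotient is exhibited explicitly, which turns divisibility into a polynomial
    identity.\<close>
  have "block B (4 * h) f b - block (2 * B) (2 * h) f' (2 * b)
      = modulus h a * (p 2 + smult a (p 3) + monom 1 h * p 3)"
    unfolding p split lo hi modulus
    by (simp add: algebra_simps smult_add_right smult_diff_left smult_diff_right power2_eq_square)
  then show "modulus h a dvd block B (4 * h) f b - block (2 * B) (2 * h) f' (2 * b)" by simp
  have "block B (4 * h) f b - block (2 * B) (2 * h) f' (2 * b + 1)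
      = modulus h (- a) * (p 2 - smult a (p 3) + monom 1 h * p 3)"
    unfolding p split lo hi modulus
    by (simp add: algebra_simps smult_add_right smult_diff_left smult_diff_right power2_eq_square)
  then show "modulus h (- a) dvd block B (4 * h) f b - block (2 * B) (2 * h) f' (2 * b + 1)" by simp
qed

text \<open>The parameter of block \<open>b\<close> is repeated at every index congruent to
  \<open>b\<close> modulo \<open>B\<close>, so a loop over \<open>j\<close> reads it without
  computing a remainder. The strict bound keeps \<open>2 + a\<close> positive.\<close>

definition params_ok :: "nat \<Rightarrow> nat \<Rightarrow> (nat \<Rightarrow> real) \<Rightarrow> bool" where
  "params_ok B k al \<longleftrightarrow> (\<forall>b<B. \<forall>i<k. \<bar>al (i * B + b)\<bar> < 2 \<and> al (i * B + b) = al b)"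

definition product_ok ::
    "nat \<Rightarrow> nat \<Rightarrow> (nat \<Rightarrow> real) \<Rightarrow> (nat \<Rightarrow> real) \<Rightarrow> (nat \<Rightarrow> real) \<Rightarrow> (nat \<Rightarrow> real) \<Rightarrow> bool" where
  "product_ok B k al f g e \<longleftrightarrow> (\<forall>b<B. modulus k (al b) dvd
     block B (2 * k) e b - block B (2 * k) f b * block B (2 * k) g b)"

definition params_step :: "nat \<Rightarrow> (nat \<Rightarrow> real) \<Rightarrow> (nat \<Rightarrow> real) \<Rightarrow> bool" where
  "params_step q al al' \<longleftrightarrow> (\<forall>j<q. al' (2 * j) = sqrt (2 + al j) \<and> al' (2 * j + 1) = - sqrt (2 + al j))"

lemma index_less: "i < h \<Longrightarrow> b < B \<Longrightarrow> i * B + b < h * (B::nat)"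
proof -
  assume "i < h" "b < B"
  then have "i * B + b < Suc i * B" by simp
  also have "\<dots> \<le> h * B" using \<open>i < h\<close> by (intro mult_right_mono) auto
  finally show ?thesis .
qed

lemma params_ok_bounds:
  assumes "params_ok B (2 * h) al" "j < 2 * (h * B)"
  shows "\<bar>al j\<bar> < 2"
proof -
  have "B > 0" using assms(2) by (cases B) auto
  moreover have "j div B < 2 * h" using assms(2) by (simp add: less_mult_imp_div_less mult.assoc)
  ultimately show ?thesis using assms(1) unfolding params_ok_def
    by (metis div_mult_mod_eq mod_less_divisor)
qed

text \<open>As \<open>2 * (i * B + b) = i * (2 * B) + 2 * b\<close>, interleaving the two roots
  preserves the repetition. The bound passes on because \<open>0 < 2 + a < 4\<close>.\<close>

lemma params_ok_step:
  assumes "params_ok B (2 * h) al" "params_step (h * B) al al'"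
  shows "params_ok (2 * B) h al'"
  unfolding params_ok_def
proof (intro allI impI)
  fix c i assume c: "c < 2 * B" and i: "i < h"
  define b where "b = c div 2"
  have b: "b < B" using c by (auto simp: b_def)
  then have lt: "i * B + b < h * B" "b < h * B" using i index_less[of i h b B] index_less[of 0 h b B] by auto
  have "\<bar>al (i * B + b)\<bar> < 2 \<and> al (i * B + b) = al b"
    using assms(1) b i unfolding params_ok_def by (metis less_le_trans mult_2 trans_le_add1 order_refl)
  then have al: "al (i * B + b) = al b" "\<bar>al b\<bar> < 2" by metis+
  have "sqrt (2 + al b) < sqrt (2\<^sup>2)" using al by (intro real_sqrt_less_mono) simp
  then have s: "0 < sqrt (2 + al b)" "sqrt (2 + al b) < 2" using al by auto
  have v: "al' (2 * (i * B + b)) = sqrt (2 + al b)" "al' (2 * b) = sqrt (2 + al b)"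
    "al' (2 * (i * B + b) + 1) = - sqrt (2 + al b)" "al' (2 * b + 1) = - sqrt (2 + al b)"
    using assms(2) lt al(1) unfolding params_step_def by metis+
  consider "c = 2 * b" | "c = 2 * b + 1" unfolding b_def by linarith
  then show "\<bar>al' (i * (2 * B) + c)\<bar> < 2 \<and> al' (i * (2 * B) + c) = al' c"
  proof cases
    case 1
    then have eq: "i * (2 * B) + c = 2 * (i * B + b)" by (simp add: algebra_simps)
    show ?thesis unfolding eq unfolding 1 v using s by simp
  next
    case 2
    then have eq: "i * (2 * B) + c = 2 * (i * B + b) + 1" by (simp add: algebra_simps)
    show ?thesis unfolding eq unfolding 2 v using s by simp
  qed
qed

text \<open>The congruences modulo the two factors combine by coprimality. Since \<open>e\<close>
  enters only through its split into \<open>e'\<close>, any inversion of the split may produce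
  it.\<close>

lemma product_ok_step:
  assumes h: "h > 0"
    and al: "params_ok B (2 * h) al" and al': "params_step (h * B) al al'"
    and f: "split_step (h * B) (\<lambda>j. sqrt (2 + al j)) f f'"
    and g: "split_step (h * B) (\<lambda>j. sqrt (2 + al j)) g g'"
    and e: "split_step (h * B) (\<lambda>j. sqrt (2 + al j)) e e'"
    and ok: "product_ok (2 * B) h al' f' g' e'"
  shows "product_ok B (2 * h) al f g e"
  unfolding product_ok_def
proof (intro allI impI)
  fix b assume b: "b < B"
  define a where "a = sqrt (2 + al b)"
  have lt: "b < h * B" using h b index_less[of 0 h b B] by simp
  have alb: "\<bar>al b\<bar> < 2" using al b h unfolding params_ok_def by (metis add_0 mult_0 mult_pos_pos zero_less_numeral)
  then have a: "a \<noteq> 0" "a\<^sup>2 = 2 + al b" by (auto simp: a_def)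
  have r: "sqrt (2 + al (i * B + b)) = a" if "i < h" for i
    using al b that unfolding params_ok_def a_def by simp
  have par: "al' (2 * b) = a" "al' (2 * b + 1) = - a" using al' lt unfolding params_step_def a_def by auto
  have *: "m dvd E - F * G" if "m dvd E - E'" "m dvd F - F'" "m dvd G - G'" "m dvd E' - F' * G'"
    for m E F G E' F' G' :: "real poly"
  proof -
    have "E - F * G = (E - E') + (E' - F' * G') - (F - F') * G - F' * (G - G')"
      by (simp add: algebra_simps)
    also have "m dvd \<dots>"
      using that by (intro dvd_diff dvd_add[OF that(1,4)] dvd_mult2[OF that(2)] dvd_mult[OF that(3)])
    finally show ?thesis .
  qed
  let ?X = "block B (4 * h) e b - block B (4 * h) f b * block B (4 * h) g b"
  have "modulus h a dvd ?X"
    using ok b par(1) unfolding product_ok_def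
    by (intro *[OF split_step_dvd(1)[OF e b r] split_step_dvd(1)[OF f b r] split_step_dvd(1)[OF g b r]]) auto
  moreover have "modulus h (- a) dvd ?X"
    using ok b par(2) unfolding product_ok_def
    by (intro *[OF split_step_dvd(2)[OF e b r] split_step_dvd(2)[OF f b r] split_step_dvd(2)[OF g b r]])
      (auto dest!: spec[of _ "2 * b + 1"])
  ultimately have "modulus h a * modulus h (- a) dvd ?X"
    using coprime_modulus[OF a(1)] by (intro divides_mult)
  then show "modulus (2 * h) (al b) dvd block B (2 * (2 * h)) e b - block B (2 * (2 * h)) f b * block B (2 * (2 * h)) g b"
    by (simp add: modulus_split[OF a(2)])
qed

text \<open>Schoolbook product of two linear polynomials, reduced by
  \<open>t^2 = a t - 1\<close>.\<close>

definition leaf_product ::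
    "nat \<Rightarrow> (nat \<Rightarrow> real) \<Rightarrow> (nat \<Rightarrow> real) \<Rightarrow> (nat \<Rightarrow> real) \<Rightarrow> (nat \<Rightarrow> real) \<Rightarrow> bool" where
  "leaf_product B al f g e \<longleftrightarrow> (\<forall>j<B. e j = f j * g j - f (j + B) * g (j + B) \<and>
     e (j + B) = f j * g (j + B) + f (j + B) * g j + al j * (f (j + B) * g (j + B)))"

lemma leaf_product_ok:
  assumes "leaf_product B al f g e"
  shows "product_ok B 1 al f g e"
  unfolding product_ok_def
proof (intro allI impI)
  fix b assume "b < B"
  with assms have e: "e b = f b * g b - f (b + B) * g (b + B)"
    "e (b + B) = f b * g (b + B) + f (b + B) * g b + al b * (f (b + B) * g (b + B))"
    unfolding leaf_product_def by blast+
  have "block B (2 * 1) f b = [:f b, f (b + B):]" for f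
    by (simp add: block_def numeral_2_eq_2 monom_altdef add_ac)
  moreover have "modulus 1 (al b) = [:1, - al b, 1:]"
    by (simp add: modulus_def numeral_2_eq_2 monom_Suc monom_0 one_pCons)
  moreover have "[:e b, e (b + B):] - [:f b, f (b + B):] * [:g b, g (b + B):]
      = [:1, - al b, 1:] * [:- (f (b + B) * g (b + B)):]"
    unfolding e by (simp add: algebra_simps)
  ultimately show "modulus 1 (al b) dvd block B (2 * 1) e b - block B (2 * 1) f b * block B (2 * 1) g b"
    by (metis dvd_triv_left)
qed

lemma coeff_block1: "coeff (block (Suc 0) N f 0) i = (if i < N then f i else 0)"
  by (simp add: block_def coeff_sum)

text \<open>At the root \<open>a = 0\<close>, so the congruence is modulo \<open>t^4q + 1\<close>.
  The support bounds keep the true product below degree \<open>4 q\<close>, and a multiple of the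
  modulus of smaller degree is zero.\<close>

lemma convolution_of_product_ok:
  assumes ok: "product_ok 1 (2 * q) al f g e" and al: "al 0 = 0" and q: "q > 0"
    and f: "\<And>i. a \<le> i \<Longrightarrow> i < 4 * q \<Longrightarrow> f i = 0"
    and g: "\<And>i. b \<le> i \<Longrightarrow> i < 4 * q \<Longrightarrow> g i = 0"
    and ab: "a + b \<le> 4 * q" and k: "k < 4 * q"
  shows "e k = (\<Sum>i\<le>k. f i * g (k - i))"
proof -
  define F where "F = block 1 (4 * q) f 0"
  define G where "G = block 1 (4 * q) g 0"
  define E where "E = block 1 (4 * q) e 0"
  have "modulus (2 * q) 0 dvd E - F * G"
    using ok al by (simp add: product_ok_def E_def F_def G_def)
  moreover have "degree (E - F * G) < 4 * q"
  proof (rule degree_lessI)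
    show "E - F * G \<noteq> 0 \<or> 4 * q > 0" using q by simp
    have "coeff (F * G) i = 0" if "4 * q \<le> i" for i
    proof -
      have "coeff F j * coeff G (i - j) = 0" for j
      proof (cases "a \<le> j")
        case False
        then have "b \<le> i - j" using ab that by linarith
        then show ?thesis using g by (simp add: G_def coeff_block1)
      qed (use f in \<open>simp add: F_def coeff_block1\<close>)
      then show ?thesis unfolding coeff_mult by (intro sum.neutral) blast
    qed
    then show "\<forall>k\<ge>4 * q. coeff (E - F * G) k = 0" by (simp add: E_def coeff_block1)
  qed
  moreover have "degree (modulus (2 * q) 0) = 4 * q"
  proof -
    have "modulus (2 * q) 0 = monom 1 (4 * q) + 1" by (simp add: modulus_def)
    then show ?thesis using q by (simp add: degree_add_eq_left degree_monom_eq)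
  qed
  ultimately have "E - F * G = 0" by (metis dvd_imp_degree_le not_le)
  then have "coeff E k = coeff (F * G) k" by simp
  moreover have "k - i < 4 * q" for i using k by simp
  ultimately show ?thesis using k by (simp add: E_def F_def G_def coeff_mult coeff_block1)
qed

text \<open>\<open>split_step\<close> solved for \<open>f\<close>: sums and differences of paired
  residues separate the terms without and with an odd power of \<open>r\<close>.\<close>

definition merge_step :: "nat \<Rightarrow> (nat \<Rightarrow> real) \<Rightarrow> (nat \<Rightarrow> real) \<Rightarrow> (nat \<Rightarrow> real) \<Rightarrow> bool" where
  "merge_step q r f' f \<longleftrightarrow> (\<forall>j<q.
     f (j + 3 * q) = (f' (2 * j + 1) - f' (2 * j)) / (2 * r j) \<and>
     f (j + 2 * q) = (f' (2 * j + 2 * q) - f' (2 * j + 1 + 2 * q)) / (2 * r j) \<and>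
     f j = (f' (2 * j) + f' (2 * j + 1)) / 2 + f (j + 2 * q) \<and>
     f (j + q) = (f' (2 * j + 2 * q) + f' (2 * j + 1 + 2 * q)) / 2 - ((r j)\<^sup>2 - 1) * f (j + 3 * q))"

lemma split_step_of_merge_step:
  assumes "merge_step q r f' f" "\<And>j. j < q \<Longrightarrow> r j \<noteq> 0"
  shows "split_step q r f f'"
  unfolding split_step_def
proof (intro allI impI)
  fix j assume j: "j < q"
  have m: "2 * (r j * f (j + 3 * q)) = f' (2 * j + 1) - f' (2 * j)"
     "2 * (r j * f (j + 2 * q)) = f' (2 * j + 2 * q) - f' (2 * j + 1 + 2 * q)"
     "f j = (f' (2 * j) + f' (2 * j + 1)) / 2 + f (j + 2 * q)"
     "f (j + q) = (f' (2 * j + 2 * q) + f' (2 * j + 1 + 2 * q)) / 2 - ((r j)\<^sup>2 - 1) * f (j + 3 * q)"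
    using assms j by (simp_all add: merge_step_def)
  from m(1,2) show "f' (2 * j) = f j - f (j + 2 * q) - r j * f (j + 3 * q) \<and>
     f' (2 * j + 1) = f j - f (j + 2 * q) + r j * f (j + 3 * q) \<and>
     f' (2 * j + 2 * q) = f (j + q) + r j * f (j + 2 * q) + ((r j)\<^sup>2 - 1) * f (j + 3 * q) \<and>
     f' (2 * j + 1 + 2 * q) = f (j + q) - r j * f (j + 2 * q) + ((r j)\<^sup>2 - 1) * f (j + 3 * q)"
    unfolding m(3,4) by argo
qed

section \<open>A while language for the real RAM\<close>

type_synonym mem = "nat \<Rightarrow> real"

fun effect :: "instr \<Rightarrow> mem \<Rightarrow> mem option" where
  "effect (Const d k) m = Some (m(d := of_int k))"
| "effect (Add d a b) m = Some (m(d := m a + m b))"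
| "effect (Sub d a b) m = Some (m(d := m a - m b))"
| "effect (Mul d a b) m = Some (m(d := m a * m b))"
| "effect (Div d a b) m = (if m b = 0 then None else Some (m(d := m a / m b)))"
| "effect (Sqrt d a) m = (if m a < 0 then None else Some (m(d := sqrt (m a))))"
| "effect (Load d a) m = (if m a \<in> \<nat> then Some (m(d := m (nat \<lfloor>m a\<rfloor>))) else None)"
| "effect (Store a b) m = (if m a \<in> \<nat> then Some (m(nat \<lfloor>m a\<rfloor> := m b)) else None)"
| "effect (JmpLe a b t) m = None"
| "effect Halt m = None"

fun effects :: "instr list \<Rightarrow> mem \<Rightarrow> mem option" where
  "effects [] m = Some m"
| "effects (i # is) m = Option.bind (effect i m) (effects is)"

lemma effects_append: "effects (xs @ ys) m = Option.bind (effects xs m) (effects ys)"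
  by (induction xs arbitrary: m) (auto split: bind_splits)

definition code_at :: "instr list \<Rightarrow> nat \<Rightarrow> instr list \<Rightarrow> bool" where
  "code_at P pc c \<longleftrightarrow> (\<exists>u v. P = u @ c @ v \<and> length u = pc)"

lemma code_at_append:
  "code_at P pc (xs @ ys) \<longleftrightarrow> code_at P pc xs \<and> code_at P (pc + length xs) ys"
proof
  assume "code_at P pc (xs @ ys)"
  then obtain u v where *: "P = u @ (xs @ ys) @ v" "length u = pc" unfolding code_at_def by blast
  from * have "P = u @ xs @ (ys @ v)" "P = (u @ xs) @ ys @ v" "length (u @ xs) = pc + length xs"
    by auto
  with *(2) show "code_at P pc xs \<and> code_at P (pc + length xs) ys" unfolding code_at_def by blast
next
  assume "code_at P pc xs \<and> code_at P (pc + length xs) ys"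
  then obtain u v u' v' where "P = u @ xs @ v" "length u = pc" "P = u' @ ys @ v'"
    "length u' = pc + length xs" unfolding code_at_def by blast
  then have "u @ xs = u'"
    by (metis append_assoc append_eq_append_conv length_append)
  with \<open>P = u' @ ys @ v'\<close> \<open>length u = pc\<close> show "code_at P pc (xs @ ys)"
    unfolding code_at_def by (intro exI[of _ u] exI[of _ v']) auto
qed

lemma code_at_Cons: "code_at P pc (i # ys) \<longleftrightarrow> code_at P pc [i] \<and> code_at P (Suc pc) ys"
  using code_at_append[of P pc "[i]" ys] by simp

lemma code_at_single: "code_at P pc [i] \<Longrightarrow> pc < length P \<and> P ! pc = i"
  unfolding code_at_def by (auto simp: nth_append)

lemma ram_run_add: "ram_run P (a + b) s = Option.bind (ram_run P a s) (ram_run P b)"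
proof (induction b)
  case 0
  then show ?case by (cases "ram_run P a s") auto
next
  case (Suc b)
  then show ?case by (cases "ram_run P a s") auto
qed

lemma ram_run_trans:
  "ram_run P a s = Some s' \<Longrightarrow> ram_run P b s' = Some s'' \<Longrightarrow> ram_run P (a + b) s = Some s''"
  by (simp add: ram_run_add)

lemma ram_run_1: "ram_run P (Suc 0) s = ram_step P s"
  by simp

lemma ram_step_effect:
  "code_at P pc [i] \<Longrightarrow> effect i m = Some m' \<Longrightarrow> ram_step P (pc, m) = Some (Suc pc, m')"
  by (drule code_at_single) (cases i; auto simp: ram_step_def split: if_splits)

lemma ram_run_effects:
  "code_at P pc c \<Longrightarrow> effects c m = Some m' \<Longrightarrow>
   ram_run P (length c) (pc, m) = Some (pc + length c, m')"
proof (induction c arbitrary: pc m)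
  case Nil
  then show ?case by simp
next
  case (Cons i c)
  from Cons.prems obtain m1 where m1: "effect i m = Some m1" "effects c m1 = Some m'"
    by (auto split: bind_splits)
  from Cons.prems have at: "code_at P pc [i]" "code_at P (Suc pc) c"
    by (auto simp: code_at_Cons[of P pc i c])
  have "ram_run P (Suc 0 + length c) (pc, m) = Some (Suc pc + length c, m')"
    by (rule ram_run_trans[OF _ Cons.IH[OF at(2) m1(2)]])
       (simp only: ram_run_1 ram_step_effect[OF at(1) m1(1)])
  then show ?case by simp
qed

lemma ram_step_jump:
  "code_at P pc [JmpLe a b t] \<Longrightarrow>
   ram_step P (pc, m) = Some (if m a \<le> m b then t else Suc pc, m)"
  by (drule code_at_single) (auto simp: ram_step_def)

section \<open>Syntax and cost semantics of the while language\<close>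

datatype nexp = NC nat | NV nat | NAdd nexp nexp (infixl "+\<^sub>n" 65)
  | NMul nexp nexp (infixl "*\<^sub>n" 70) | NSub nexp nexp (infixl "-\<^sub>n" 65)

datatype rexp = RC int | RV nat | RN nexp | Hp nexp | RAdd rexp rexp (infixl "+\<^sub>r" 65)
  | RSub rexp rexp (infixl "-\<^sub>r" 65) | RMul rexp rexp (infixl "*\<^sub>r" 70)
  | RDiv rexp rexp (infixl "'/\<^sub>r" 70) | RSqrt rexp

datatype assn = NAss nat nexp | RAss nat rexp | HAss nexp rexp

datatype com = Do "assn list" | Seq com com (infixr ";;" 60)
  | If rexp rexp com com | While nexp nexp com

type_synonym st = "(nat \<Rightarrow> nat) \<times> (nat \<Rightarrow> real) \<times> (nat \<Rightarrow> real)"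

fun nval :: "(nat \<Rightarrow> nat) \<Rightarrow> nexp \<Rightarrow> nat" where
  "nval iv (NC k) = k"
| "nval iv (NV v) = iv v"
| "nval iv (NAdd a b) = nval iv a + nval iv b"
| "nval iv (NMul a b) = nval iv a * nval iv b"
| "nval iv (NSub a b) = nval iv a - nval iv b"

text \<open>The machine subtracts reals while \<open>nval\<close> truncates at 0; excluding negative
  differences makes the two agree.\<close>

fun nok :: "(nat \<Rightarrow> nat) \<Rightarrow> nexp \<Rightarrow> bool" where
  "nok iv (NC k) = True"
| "nok iv (NV v) = True"
| "nok iv (NAdd a b) = (nok iv a \<and> nok iv b)"
| "nok iv (NMul a b) = (nok iv a \<and> nok iv b)"
| "nok iv (NSub a b) = (nok iv a \<and> nok iv b \<and> nval iv b \<le> nval iv a)"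

fun rval :: "st \<Rightarrow> rexp \<Rightarrow> real" where
  "rval s (RC k) = of_int k"
| "rval (iv, rv, h) (RV v) = rv v"
| "rval (iv, rv, h) (RN e) = real (nval iv e)"
| "rval (iv, rv, h) (Hp e) = h (nval iv e)"
| "rval s (RAdd a b) = rval s a + rval s b"
| "rval s (RSub a b) = rval s a - rval s b"
| "rval s (RMul a b) = rval s a * rval s b"
| "rval s (RDiv a b) = rval s a / rval s b"
| "rval s (RSqrt a) = sqrt (rval s a)"

text \<open>Heap addresses start at 64, so no heap access aliases a variable or a scratch cell; the
  conditions on division and roots exclude machine faults.\<close>

fun rok :: "st \<Rightarrow> rexp \<Rightarrow> bool" where
  "rok s (RC k) = True"
| "rok s (RV v) = True"
| "rok (iv, rv, h) (RN e) = nok iv e"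
| "rok (iv, rv, h) (Hp e) = (nok iv e \<and> 64 \<le> nval iv e)"
| "rok s (RAdd a b) = (rok s a \<and> rok s b)"
| "rok s (RSub a b) = (rok s a \<and> rok s b)"
| "rok s (RMul a b) = (rok s a \<and> rok s b)"
| "rok s (RDiv a b) = (rok s a \<and> rok s b \<and> rval s b \<noteq> 0)"
| "rok s (RSqrt a) = (rok s a \<and> 0 \<le> rval s a)"

fun assign :: "assn \<Rightarrow> st \<Rightarrow> st" where
  "assign (NAss v e) (iv, rv, h) = (iv(v := nval iv e), rv, h)"
| "assign (RAss v e) (iv, rv, h) = (iv, rv(v := rval (iv, rv, h) e), h)"
| "assign (HAss a e) (iv, rv, h) = (iv, rv, h(nval iv a := rval (iv, rv, h) e))"

fun assign_ok :: "assn \<Rightarrow> st \<Rightarrow> bool" where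
  "assign_ok (NAss v e) (iv, rv, h) = nok iv e"
| "assign_ok (RAss v e) s = rok s e"
| "assign_ok (HAss a e) (iv, rv, h) = (nok iv a \<and> 64 \<le> nval iv a \<and> rok (iv, rv, h) e)"

fun assigns :: "assn list \<Rightarrow> st \<Rightarrow> st" where
  "assigns [] s = s"
| "assigns (b # bs) s = assigns bs (assign b s)"

fun assigns_ok :: "assn list \<Rightarrow> st \<Rightarrow> bool" where
  "assigns_ok [] s = True"
| "assigns_ok (b # bs) s = (assign_ok b s \<and> assigns_ok bs (assign b s))"

text \<open>A whole assignment list and each evaluated test count 1, whatever their size; the size
  depends only on the program and reappears as the factor \<open>L\<close> in
  \<open>ccomp_correct\<close>.\<close>

inductive exec :: "com \<Rightarrow> st \<Rightarrow> nat \<Rightarrow> st \<Rightarrow> bool" where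
  Do: "assigns_ok bs s \<Longrightarrow> exec (Do bs) s 1 (assigns bs s)"
| Seq: "exec c1 s t1 s1 \<Longrightarrow> exec c2 s1 t2 s2 \<Longrightarrow> exec (c1 ;; c2) s (t1 + t2) s2"
| If_le: "rok s a \<Longrightarrow> rok s b \<Longrightarrow> rval s a \<le> rval s b \<Longrightarrow> exec c1 s t s' \<Longrightarrow>
    exec (If a b c1 c2) s (Suc t) s'"
| If_gt: "rok s a \<Longrightarrow> rok s b \<Longrightarrow> \<not> rval s a \<le> rval s b \<Longrightarrow> exec c2 s t s' \<Longrightarrow>
    exec (If a b c1 c2) s (Suc t) s'"
| While_end: "nok iv a \<Longrightarrow> nok iv b \<Longrightarrow> \<not> nval iv a \<le> nval iv b \<Longrightarrow>
    exec (While a b c) (iv, rv, h) 1 (iv, rv, h)"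
| While_step: "nok iv a \<Longrightarrow> nok iv b \<Longrightarrow> nval iv a \<le> nval iv b \<Longrightarrow>
    exec c (iv, rv, h) t1 s1 \<Longrightarrow> exec (While a b c) s1 t2 s2 \<Longrightarrow>
    exec (While a b c) (iv, rv, h) (Suc (t1 + t2)) s2"

text \<open>Memory layout of compiled programs: real variable \<open>v\<close> lives in cell \<open>v\<close>, natural variable
  \<open>v\<close> in cell \<open>16 + v\<close> (\<open>v < 16\<close>), cells 32 to 63 are scratch space for expression evaluation, and
  the heap is the memory from cell 64 on.\<close>

definition represents :: "st \<Rightarrow> mem \<Rightarrow> bool" where
  "represents s m \<longleftrightarrow> (case s of (iv, rv, h) \<Rightarrow>
     (\<forall>v<16. m v = rv v \<and> m (16 + v) = real (iv v)) \<and> (\<forall>a\<ge>64. m a = h a))"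

text \<open>There is no move instruction: copying is addition to a zeroed cell.\<close>

fun ncomp :: "nexp \<Rightarrow> nat \<Rightarrow> instr list" where
  "ncomp (NC k) d = [Const d (int k)]"
| "ncomp (NV v) d = [Const d 0, Add d d (16 + v)]"
| "ncomp (NAdd a b) d = ncomp a d @ ncomp b (Suc d) @ [Add d d (Suc d)]"
| "ncomp (NMul a b) d = ncomp a d @ ncomp b (Suc d) @ [Mul d d (Suc d)]"
| "ncomp (NSub a b) d = ncomp a d @ ncomp b (Suc d) @ [Sub d d (Suc d)]"

fun rcomp :: "rexp \<Rightarrow> nat \<Rightarrow> instr list" where
  "rcomp (RC k) d = [Const d k]"
| "rcomp (RV v) d = [Const d 0, Add d d v]"
| "rcomp (RN e) d = ncomp e d"
| "rcomp (Hp e) d = ncomp e d @ [Load d d]"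
| "rcomp (RAdd a b) d = rcomp a d @ rcomp b (Suc d) @ [Add d d (Suc d)]"
| "rcomp (RSub a b) d = rcomp a d @ rcomp b (Suc d) @ [Sub d d (Suc d)]"
| "rcomp (RMul a b) d = rcomp a d @ rcomp b (Suc d) @ [Mul d d (Suc d)]"
| "rcomp (RDiv a b) d = rcomp a d @ rcomp b (Suc d) @ [Div d d (Suc d)]"
| "rcomp (RSqrt a) d = rcomp a d @ [Sqrt d d]"

fun acomp :: "assn \<Rightarrow> instr list" where
  "acomp (NAss v e) = ncomp e 32 @ [Const 33 0, Add (16 + v) 32 33]"
| "acomp (RAss v e) = rcomp e 32 @ [Const 33 0, Add v 32 33]"
| "acomp (HAss a e) = ncomp a 32 @ rcomp e 33 @ [Store 32 33]"

fun clen :: "com \<Rightarrow> nat" where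
  "clen (Do bs) = length (concat (map acomp bs))"
| "clen (c1 ;; c2) = clen c1 + clen c2"
| "clen (If a b c1 c2) = length (rcomp a 32 @ rcomp b 33) + clen c1 + clen c2 + 2"
| "clen (While a b c) = length (ncomp a 32 @ ncomp b 33) + clen c + 3"

text \<open>\<open>JmpLe 32 32\<close> always jumps. The conditional jump is taken when the test
  holds, so the code of the else branch comes first. Targets use \<open>clen\<close>, which does not
  depend on addresses.\<close>

fun ccomp :: "com \<Rightarrow> nat \<Rightarrow> instr list" where
  "ccomp (Do bs) pc = concat (map acomp bs)"
| "ccomp (c1 ;; c2) pc = ccomp c1 pc @ ccomp c2 (pc + clen c1)"
| "ccomp (If a b c1 c2) pc =
    (let test = rcomp a 32 @ rcomp b 33; pc2 = pc + length test + 1; pc1 = pc2 + clen c2 + 1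
     in test @ [JmpLe 32 33 pc1] @ ccomp c2 pc2 @ [JmpLe 32 32 (pc1 + clen c1)] @ ccomp c1 pc1)"
| "ccomp (While a b c) pc =
    (let test = ncomp a 32 @ ncomp b 33; pc1 = pc + length test + 2
     in test @ [JmpLe 32 33 pc1, JmpLe 32 32 (pc1 + clen c + 1)] @ ccomp c pc1 @ [JmpLe 32 32 pc])"

lemma length_ccomp [simp]: "length (ccomp c pc) = clen c"
  by (induction c arbitrary: pc) (auto simp: Let_def)

text \<open>Temporaries form a stack: an expression compiled with target \<open>d\<close> uses the cells from \<open>d\<close> on,
  and well-formedness keeps them below the heap.\<close>

fun nwf :: "nexp \<Rightarrow> nat \<Rightarrow> bool" where
  "nwf (NC k) d = (d < 64)"
| "nwf (NV v) d = (d < 64 \<and> v < 16)"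
| "nwf (NAdd a b) d = (nwf a d \<and> nwf b (Suc d))"
| "nwf (NMul a b) d = (nwf a d \<and> nwf b (Suc d))"
| "nwf (NSub a b) d = (nwf a d \<and> nwf b (Suc d))"

fun rwf :: "rexp \<Rightarrow> nat \<Rightarrow> bool" where
  "rwf (RC k) d = (d < 64)"
| "rwf (RV v) d = (d < 64 \<and> v < 16)"
| "rwf (RN e) d = nwf e d"
| "rwf (Hp e) d = nwf e d"
| "rwf (RAdd a b) d = (rwf a d \<and> rwf b (Suc d))"
| "rwf (RSub a b) d = (rwf a d \<and> rwf b (Suc d))"
| "rwf (RMul a b) d = (rwf a d \<and> rwf b (Suc d))"
| "rwf (RDiv a b) d = (rwf a d \<and> rwf b (Suc d))"
| "rwf (RSqrt a) d = rwf a d"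

fun awf :: "assn \<Rightarrow> bool" where
  "awf (NAss v e) = (v < 16 \<and> nwf e 32)"
| "awf (RAss v e) = (v < 16 \<and> rwf e 32)"
| "awf (HAss a e) = (nwf a 32 \<and> rwf e 33)"

fun cwf :: "com \<Rightarrow> bool" where
  "cwf (Do bs) = list_all awf bs"
| "cwf (c1 ;; c2) = (cwf c1 \<and> cwf c2)"
| "cwf (If a b c1 c2) = (rwf a 32 \<and> rwf b 33 \<and> cwf c1 \<and> cwf c2)"
| "cwf (While a b c) = (nwf a 32 \<and> nwf b 33 \<and> cwf c)"

section \<open>Correctness of the compiler\<close>

definition scratch_eq :: "nat \<Rightarrow> mem \<Rightarrow> mem \<Rightarrow> bool" where
  "scratch_eq d m m' \<longleftrightarrow> (\<forall>a. a < d \<or> 64 \<le> a \<longrightarrow> m' a = m a)"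

lemma represents_scratch_eq: "represents s m \<Longrightarrow> scratch_eq d m m' \<Longrightarrow> 32 \<le> d \<Longrightarrow> represents s m'"
  by (auto simp: represents_def scratch_eq_def)

text \<open>Evaluating the second operand from \<open>Suc d\<close> on cannot disturb the first
  result in cell \<open>d\<close>.\<close>

lemma effects_binop:
  assumes "effects ca m = Some ma" "ma d = va" "scratch_eq d m ma"
    and "effects cb ma = Some mb" "mb (Suc d) = vb" "scratch_eq (Suc d) ma mb"
    and "d < 64" and "\<And>m. m d = va \<Longrightarrow> m (Suc d) = vb \<Longrightarrow> effect i m = Some (m(d := v))"
  shows "\<exists>m'. effects (ca @ cb @ [i]) m = Some m' \<and> m' d = v \<and> scratch_eq d m m'"
proof -
  have "mb d = va" using assms(2,6) by (simp add: scratch_eq_def)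
  then have "effect i mb = Some (mb(d := v))" using assms(5,8) by blast
  moreover have "scratch_eq d m (mb(d := v))"
    using assms(3,6,7) by (auto simp: scratch_eq_def)
  ultimately show ?thesis using assms(1,4) by (auto simp: effects_append)
qed

lemma nwf_less: "nwf e d \<Longrightarrow> d < 64"
  by (induction e arbitrary: d) auto

lemma rwf_less: "rwf e d \<Longrightarrow> d < 64"
  by (induction e arbitrary: d) (auto simp: nwf_less)

lemma ncomp_correct:
  assumes "represents (iv, rv, h) m" "nok iv e" "nwf e d" "32 \<le> d"
  shows "\<exists>m'. effects (ncomp e d) m = Some m' \<and> m' d = real (nval iv e) \<and> scratch_eq d m m'"
  using assms
proof (induction e arbitrary: d m)
  case (NC k)
  then show ?case by (auto simp: scratch_eq_def)
next
  case (NV v)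
  then show ?case by (auto simp: scratch_eq_def represents_def)
next
  case (NAdd a b)
  obtain ma where ma: "effects (ncomp a d) m = Some ma" "ma d = real (nval iv a)" "scratch_eq d m ma"
    using NAdd.IH(1)[OF NAdd.prems(1), of d] NAdd.prems by auto
  have r: "represents (iv, rv, h) ma" using represents_scratch_eq[OF NAdd.prems(1) ma(3) NAdd.prems(4)] .
  obtain mb where mb: "effects (ncomp b (Suc d)) ma = Some mb"
     "mb (Suc d) = real (nval iv b)" "scratch_eq (Suc d) ma mb"
    using NAdd.IH(2)[OF r, of "Suc d"] NAdd.prems by auto
  have "d < 64" using NAdd.prems(3) by (auto simp: nwf_less)
  then show ?case unfolding ncomp.simps
    by (rule effects_binop[OF ma mb]) (use NAdd.prems(2) in \<open>auto simp: of_nat_diff\<close>)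
next
  case (NMul a b)
  obtain ma where ma: "effects (ncomp a d) m = Some ma" "ma d = real (nval iv a)" "scratch_eq d m ma"
    using NMul.IH(1)[OF NMul.prems(1), of d] NMul.prems by auto
  have r: "represents (iv, rv, h) ma" using represents_scratch_eq[OF NMul.prems(1) ma(3) NMul.prems(4)] .
  obtain mb where mb: "effects (ncomp b (Suc d)) ma = Some mb"
     "mb (Suc d) = real (nval iv b)" "scratch_eq (Suc d) ma mb"
    using NMul.IH(2)[OF r, of "Suc d"] NMul.prems by auto
  have "d < 64" using NMul.prems(3) by (auto simp: nwf_less)
  then show ?case unfolding ncomp.simps
    by (rule effects_binop[OF ma mb]) (use NMul.prems(2) in \<open>auto simp: of_nat_diff\<close>)
next
  case (NSub a b)
  obtain ma where ma: "effects (ncomp a d) m = Some ma" "ma d = real (nval iv a)" "scratch_eq d m ma"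
    using NSub.IH(1)[OF NSub.prems(1), of d] NSub.prems by auto
  have r: "represents (iv, rv, h) ma" using represents_scratch_eq[OF NSub.prems(1) ma(3) NSub.prems(4)] .
  obtain mb where mb: "effects (ncomp b (Suc d)) ma = Some mb"
     "mb (Suc d) = real (nval iv b)" "scratch_eq (Suc d) ma mb"
    using NSub.IH(2)[OF r, of "Suc d"] NSub.prems by auto
  have "d < 64" using NSub.prems(3) by (auto simp: nwf_less)
  then show ?case unfolding ncomp.simps
    by (rule effects_binop[OF ma mb]) (use NSub.prems(2) in \<open>auto simp: of_nat_diff\<close>)
qed

lemma rcomp_correct:
  assumes "represents s m" "rok s e" "rwf e d" "32 \<le> d"
  shows "\<exists>m'. effects (rcomp e d) m = Some m' \<and> m' d = rval s e \<and> scratch_eq d m m'"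
  using assms
proof (induction e arbitrary: d m)
  case (RC k)
  then show ?case by (cases s) (auto simp: scratch_eq_def)
next
  case (RV v)
  then show ?case by (cases s) (auto simp: scratch_eq_def represents_def)
next
  case (RN e)
  then show ?case by (cases s) (auto intro: ncomp_correct)
next
  case (Hp e)
  obtain iv rv h where s: "s = (iv, rv, h)" by (cases s)
  with Hp obtain m' where m': "effects (ncomp e d) m = Some m'" "m' d = real (nval iv e)" "scratch_eq d m m'"
    using ncomp_correct[of iv rv h m e d] by auto
  moreover have "m' (nval iv e) = h (nval iv e)"
    using represents_scratch_eq[OF Hp.prems(1) m'(3) Hp.prems(4)] Hp.prems(2)
    by (auto simp: s represents_def)
  moreover have "d < 64" using Hp.prems(3) by (simp add: nwf_less)
  ultimately show ?case by (auto simp: effects_append s scratch_eq_def)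
next
  case (RSqrt a)
  obtain ma where ma: "effects (rcomp a d) m = Some ma" "ma d = rval s a" "scratch_eq d m ma"
    using RSqrt.IH(1)[OF RSqrt.prems(1), of d] RSqrt.prems by auto
  moreover have "d < 64" using RSqrt.prems(3) by (simp add: rwf_less)
  ultimately show ?case using RSqrt.prems by (auto simp: effects_append scratch_eq_def)
next
  case (RAdd a b)
  obtain ma where ma: "effects (rcomp a d) m = Some ma" "ma d = rval s a" "scratch_eq d m ma"
    using RAdd.IH(1)[OF RAdd.prems(1), of d] RAdd.prems by auto
  have r: "represents s ma" using represents_scratch_eq[OF RAdd.prems(1) ma(3) RAdd.prems(4)] .
  obtain mb where mb: "effects (rcomp b (Suc d)) ma = Some mb"
     "mb (Suc d) = rval s b" "scratch_eq (Suc d) ma mb"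
    using RAdd.IH(2)[OF r, of "Suc d"] RAdd.prems by auto
  have "d < 64" using RAdd.prems(3) by (auto simp: rwf_less)
  then show ?case unfolding rcomp.simps
    by (rule effects_binop[OF ma mb]) (use RAdd.prems(2) in \<open>auto simp: of_nat_diff\<close>)
next
  case (RSub a b)
  obtain ma where ma: "effects (rcomp a d) m = Some ma" "ma d = rval s a" "scratch_eq d m ma"
    using RSub.IH(1)[OF RSub.prems(1), of d] RSub.prems by auto
  have r: "represents s ma" using represents_scratch_eq[OF RSub.prems(1) ma(3) RSub.prems(4)] .
  obtain mb where mb: "effects (rcomp b (Suc d)) ma = Some mb"
     "mb (Suc d) = rval s b" "scratch_eq (Suc d) ma mb"
    using RSub.IH(2)[OF r, of "Suc d"] RSub.prems by auto
  have "d < 64" using RSub.prems(3) by (auto simp: rwf_less)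
  then show ?case unfolding rcomp.simps
    by (rule effects_binop[OF ma mb]) (use RSub.prems(2) in \<open>auto simp: of_nat_diff\<close>)
next
  case (RMul a b)
  obtain ma where ma: "effects (rcomp a d) m = Some ma" "ma d = rval s a" "scratch_eq d m ma"
    using RMul.IH(1)[OF RMul.prems(1), of d] RMul.prems by auto
  have r: "represents s ma" using represents_scratch_eq[OF RMul.prems(1) ma(3) RMul.prems(4)] .
  obtain mb where mb: "effects (rcomp b (Suc d)) ma = Some mb"
     "mb (Suc d) = rval s b" "scratch_eq (Suc d) ma mb"
    using RMul.IH(2)[OF r, of "Suc d"] RMul.prems by auto
  have "d < 64" using RMul.prems(3) by (auto simp: rwf_less)
  then show ?case unfolding rcomp.simps
    by (rule effects_binop[OF ma mb]) (use RMul.prems(2) in \<open>auto simp: of_nat_diff\<close>)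
next
  case (RDiv a b)
  obtain ma where ma: "effects (rcomp a d) m = Some ma" "ma d = rval s a" "scratch_eq d m ma"
    using RDiv.IH(1)[OF RDiv.prems(1), of d] RDiv.prems by auto
  have r: "represents s ma" using represents_scratch_eq[OF RDiv.prems(1) ma(3) RDiv.prems(4)] .
  obtain mb where mb: "effects (rcomp b (Suc d)) ma = Some mb"
     "mb (Suc d) = rval s b" "scratch_eq (Suc d) ma mb"
    using RDiv.IH(2)[OF r, of "Suc d"] RDiv.prems by auto
  have "d < 64" using RDiv.prems(3) by (auto simp: rwf_less)
  then show ?case unfolding rcomp.simps
    by (rule effects_binop[OF ma mb]) (use RDiv.prems(2) in \<open>auto simp: of_nat_diff\<close>)
qed

lemma acomp_correct:
  assumes "represents s m" "assign_ok b s" "awf b"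
  shows "\<exists>m'. effects (acomp b) m = Some m' \<and> represents (assign b s) m'"
proof -
  obtain iv rv h where s: "s = (iv, rv, h)" by (cases s)
  show ?thesis
  proof (cases b)
    case (NAss v e)
    with assms s obtain m' where m': "effects (ncomp e 32) m = Some m'" "m' 32 = real (nval iv e)"
        "scratch_eq 32 m m'" using ncomp_correct[of iv rv h m e 32] by auto
    have "represents s m'" using represents_scratch_eq[OF assms(1) m'(3)] by simp
    then show ?thesis using m' NAss assms(3) by (auto simp: s effects_append represents_def)
  next
    case (RAss v e)
    with assms s obtain m' where m': "effects (rcomp e 32) m = Some m'" "m' 32 = rval s e"
        "scratch_eq 32 m m'" using rcomp_correct[of s m e 32] by auto
    have "represents s m'" using represents_scratch_eq[OF assms(1) m'(3)] by simp
    then show ?thesis using m' RAss assms(3) by (auto simp: s effects_append represents_def)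
  next
    case (HAss a e)
    with assms s obtain m' where m': "effects (ncomp a 32) m = Some m'" "m' 32 = real (nval iv a)"
        "scratch_eq 32 m m'" using ncomp_correct[of iv rv h m a 32] by auto
    have r: "represents s m'" using represents_scratch_eq[OF assms(1) m'(3)] by simp
    with assms s HAss obtain m2 where m2: "effects (rcomp e 33) m' = Some m2" "m2 33 = rval s e"
        "scratch_eq 33 m' m2" using rcomp_correct[of s m' e 33] by auto
    have "represents s m2" using represents_scratch_eq[OF r m2(3)] by simp
    moreover have "m2 32 = real (nval iv a)" using m2(3) m'(2) by (simp add: scratch_eq_def)
    ultimately show ?thesis using m'(1) m2(1,2) HAss assms(2,3)
      by (auto simp: s effects_append represents_def)
  qed
qed

lemma acomps_correct:
  assumes "represents s m" "assigns_ok bs s" "list_all awf bs"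
  shows "\<exists>m'. effects (concat (map acomp bs)) m = Some m' \<and> represents (assigns bs s) m'"
  using assms
proof (induction bs arbitrary: s m)
  case (Cons b bs)
  then obtain m1 where "effects (acomp b) m = Some m1" "represents (assign b s) m1"
    using acomp_correct[of s m b] by auto
  with Cons show ?case by (auto simp: effects_append)
qed simp

lemma nat_test_correct:
  assumes "represents (iv, rv, h) m" "nok iv a" "nok iv b" "nwf a 32" "nwf b 33"
  shows "\<exists>m'. effects (ncomp a 32 @ ncomp b 33) m = Some m' \<and> represents (iv, rv, h) m' \<and>
           (m' 32 \<le> m' 33 \<longleftrightarrow> nval iv a \<le> nval iv b)"
proof -
  obtain m1 where m1: "effects (ncomp a 32) m = Some m1" "m1 32 = real (nval iv a)"
      "scratch_eq 32 m m1" using ncomp_correct[of iv rv h m a 32] assms by auto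
  have r: "represents (iv, rv, h) m1" using represents_scratch_eq[OF assms(1) m1(3)] by simp
  then obtain m2 where m2: "effects (ncomp b 33) m1 = Some m2" "m2 33 = real (nval iv b)"
      "scratch_eq 33 m1 m2" using ncomp_correct[of iv rv h m1 b 33] assms by auto
  have "represents (iv, rv, h) m2" using represents_scratch_eq[OF r m2(3)] by simp
  moreover have "m2 32 = real (nval iv a)" using m2(3) m1(2) by (simp add: scratch_eq_def)
  ultimately show ?thesis using m1(1) m2(1,2) by (auto simp: effects_append)
qed

lemma real_test_correct:
  assumes "represents s m" "rok s a" "rok s b" "rwf a 32" "rwf b 33"
  shows "\<exists>m'. effects (rcomp a 32 @ rcomp b 33) m = Some m' \<and> represents s m' \<and>
           (m' 32 \<le> m' 33 \<longleftrightarrow> rval s a \<le> rval s b)"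
proof -
  obtain m1 where m1: "effects (rcomp a 32) m = Some m1" "m1 32 = rval s a"
      "scratch_eq 32 m m1" using rcomp_correct[of s m a 32] assms by auto
  have r: "represents s m1" using represents_scratch_eq[OF assms(1) m1(3)] by simp
  then obtain m2 where m2: "effects (rcomp b 33) m1 = Some m2" "m2 33 = rval s b"
      "scratch_eq 33 m1 m2" using rcomp_correct[of s m1 b 33] assms by auto
  have "represents s m2" using represents_scratch_eq[OF r m2(3)] by simp
  moreover have "m2 32 = rval s a" using m2(3) m1(2) by (simp add: scratch_eq_def)
  ultimately show ?thesis using m1(1) m2(1,2) by (auto simp: effects_append)
qed

text \<open>Each unit of cost pays for one assignment list or for one test with at most two jumps,
  in either case at most \<open>L\<close> instructions. A fixed \<open>L\<close> instead of
  \<open>clen c\<close> lets all subcommands share the bound.\<close>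

lemma ccomp_correct:
  assumes "exec c s t s'" "cwf c" "represents s m" "code_at P pc (ccomp c pc)" "clen c \<le> L"
  shows "\<exists>k m'. k \<le> t * L \<and> ram_run P k (pc, m) = Some (pc + clen c, m') \<and> represents s' m'"
  using assms
proof (induction arbitrary: m pc rule: exec.induct)
  case (Do bs s)
  then obtain m' where "effects (concat (map acomp bs)) m = Some m'" "represents (assigns bs s) m'"
    using acomps_correct[of s m bs] by auto
  with Do show ?case
    using ram_run_effects[of P pc "concat (map acomp bs)" m m'] by (intro exI[of _ "clen (Do bs)"]) auto
next
  case (Seq c1 s t1 s1 c2 t2 s2)
  then obtain k1 m1 where 1: "k1 \<le> t1 * L" "ram_run P k1 (pc, m) = Some (pc + clen c1, m1)" "represents s1 m1"
    using Seq.IH(1)[of m pc] by (fastforce simp: code_at_append)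
  with Seq obtain k2 m2 where 2: "k2 \<le> t2 * L"
    "ram_run P k2 (pc + clen c1, m1) = Some (pc + clen c1 + clen c2, m2)" "represents s2 m2"
    using Seq.IH(2)[of m1 "pc + clen c1"] by (fastforce simp: code_at_append)
  show ?case using ram_run_trans[OF 1(2) 2(2)] 1 2
    by (intro exI[of _ "k1 + k2"] exI[of _ m2]) (auto simp: algebra_simps)
next
  case (If_le s a b c1 t s' c2)
  define test where "test = rcomp a 32 @ rcomp b 33"
  define pc1 where "pc1 = pc + length test + 1 + clen c2 + 1"
  from If_le obtain m1 where m1: "effects test m = Some m1" "represents s m1" "m1 32 \<le> m1 33"
    using real_test_correct[of s m a b] by (auto simp: test_def)
  have at: "code_at P pc test" "code_at P (pc + length test) [JmpLe 32 33 pc1]"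
     "code_at P pc1 (ccomp c1 pc1)"
    using If_le.prems(3) unfolding pc1_def test_def
    by (simp_all add: Let_def code_at_append code_at_Cons[of _ _ _ "_ @ _"]
        code_at_Cons[of _ _ _ "ccomp _ _"] add_ac)
  obtain k m' where k: "k \<le> t * L" "ram_run P k (pc1, m1) = Some (pc1 + clen c1, m')" "represents s' m'"
    using If_le.IH[OF _ m1(2) at(3)] If_le.prems(1,4) by auto
  have j: "ram_run P (Suc 0) (pc + length test, m1) = Some (pc1, m1)"
    using ram_step_jump[OF at(2)] m1(3) by simp
  have "ram_run P (length test + Suc 0 + k) (pc, m) = Some (pc1 + clen c1, m')"
    using ram_run_trans[OF ram_run_trans[OF ram_run_effects[OF at(1) m1(1)] j] k(2)] .
  moreover have "length test + Suc 0 \<le> L" using If_le.prems(4) by (simp add: test_def)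
  moreover have "pc1 + clen c1 = pc + clen (If a b c1 c2)" by (simp add: pc1_def test_def)
  ultimately show ?case using k(1,3)
    by (intro exI[of _ "length test + Suc 0 + k"] exI[of _ m']) simp
next
  case (If_gt s a b c2 t s' c1)
  define test where "test = rcomp a 32 @ rcomp b 33"
  define pc2 where "pc2 = pc + length test + 1"
  define pc1 where "pc1 = pc2 + clen c2 + 1"
  from If_gt obtain m1 where m1: "effects test m = Some m1" "represents s m1" "\<not> m1 32 \<le> m1 33"
    using real_test_correct[of s m a b] by (auto simp: test_def)
  have at: "code_at P pc test" "code_at P (pc + length test) [JmpLe 32 33 pc1]"
     "code_at P pc2 (ccomp c2 pc2)" "code_at P (pc2 + clen c2) [JmpLe 32 32 (pc1 + clen c1)]"
    using If_gt.prems(3) unfolding pc1_def pc2_def test_def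
    by (simp_all add: Let_def code_at_append code_at_Cons[of _ _ _ "_ @ _"]
        code_at_Cons[of _ _ _ "ccomp _ _"] add_ac)
  obtain k m' where k: "k \<le> t * L" "ram_run P k (pc2, m1) = Some (pc2 + clen c2, m')" "represents s' m'"
    using If_gt.IH[OF _ m1(2) at(3)] If_gt.prems(1,4) by auto
  have j: "ram_run P (Suc 0) (pc + length test, m1) = Some (pc2, m1)"
    using ram_step_jump[OF at(2)] m1(3) by (simp add: pc2_def)
  have j2: "ram_run P (Suc 0) (pc2 + clen c2, m') = Some (pc1 + clen c1, m')"
    using ram_step_jump[OF at(4)] by simp
  have "ram_run P (length test + Suc 0 + k + Suc 0) (pc, m) = Some (pc1 + clen c1, m')"
    using ram_run_trans[OF ram_run_trans[OF ram_run_trans[OF ram_run_effects[OF at(1) m1(1)] j] k(2)] j2] .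
  moreover have "length test + Suc 0 + Suc 0 \<le> L" using If_gt.prems(4) by (simp add: test_def)
  moreover have "pc1 + clen c1 = pc + clen (If a b c1 c2)" by (simp add: pc1_def pc2_def test_def)
  ultimately show ?case using k(1,3)
    by (intro exI[of _ "length test + Suc 0 + k + Suc 0"] exI[of _ m']) simp
next
  case (While_end iv a b c rv h)
  define test where "test = ncomp a 32 @ ncomp b 33"
  define pc1 where "pc1 = pc + length test + 2"
  from While_end obtain m1 where m1: "effects test m = Some m1" "represents (iv, rv, h) m1" "\<not> m1 32 \<le> m1 33"
    using nat_test_correct[of iv rv h m a b] by (auto simp: test_def)
  have at: "code_at P pc test" "code_at P (pc + length test) [JmpLe 32 33 pc1]"
     "code_at P (Suc (pc + length test)) [JmpLe 32 32 (pc1 + clen c + 1)]"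
    using While_end.prems(3) unfolding pc1_def test_def
    by (simp_all add: Let_def code_at_append code_at_Cons[of _ _ _ "_ @ _"]
        code_at_Cons[of _ _ _ "_ # _"] add_ac)
  have j: "ram_run P (Suc 0) (pc + length test, m1) = Some (Suc (pc + length test), m1)"
    using ram_step_jump[OF at(2)] m1(3) by simp
  have j2: "ram_run P (Suc 0) (Suc (pc + length test), m1) = Some (pc1 + clen c + 1, m1)"
    using ram_step_jump[OF at(3)] by simp
  have "ram_run P (length test + Suc 0 + Suc 0) (pc, m) = Some (pc1 + clen c + 1, m1)"
    using ram_run_trans[OF ram_run_trans[OF ram_run_effects[OF at(1) m1(1)] j] j2] .
  moreover have "length test + Suc 0 + Suc 0 \<le> L" using While_end.prems(4) by (simp add: test_def)
  moreover have "pc1 + clen c + 1 = pc + clen (While a b c)" by (simp add: pc1_def test_def)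
  ultimately show ?case using m1(2)
    by (intro exI[of _ "length test + Suc 0 + Suc 0"] exI[of _ m1]) simp
next
  case (While_step iv a b c rv h t1 s1 t2 s2)
  define test where "test = ncomp a 32 @ ncomp b 33"
  define pc1 where "pc1 = pc + length test + 2"
  from While_step obtain m1 where m1: "effects test m = Some m1" "represents (iv, rv, h) m1" "m1 32 \<le> m1 33"
    using nat_test_correct[of iv rv h m a b] by (auto simp: test_def)
  have at: "code_at P pc test" "code_at P (pc + length test) [JmpLe 32 33 pc1]"
     "code_at P pc1 (ccomp c pc1)" "code_at P (pc1 + clen c) [JmpLe 32 32 pc]"
    using While_step.prems(3) unfolding pc1_def test_def
    by (simp_all add: Let_def code_at_append code_at_Cons[of _ _ _ "_ @ _"]
        code_at_Cons[of _ _ _ "_ # _"] add_ac)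
  have j: "ram_run P (Suc 0) (pc + length test, m1) = Some (pc1, m1)"
    using ram_step_jump[OF at(2)] m1(3) by simp
  obtain k m2 where k: "k \<le> t1 * L" "ram_run P k (pc1, m1) = Some (pc1 + clen c, m2)" "represents s1 m2"
    using While_step.IH(1)[OF _ m1(2) at(3)] While_step.prems(1,4) by auto
  have j2: "ram_run P (Suc 0) (pc1 + clen c, m2) = Some (pc, m2)"
    using ram_step_jump[OF at(4)] by simp
  obtain k' m3 where k': "k' \<le> t2 * L" "ram_run P k' (pc, m2) = Some (pc + clen (While a b c), m3)" "represents s2 m3"
    using While_step.IH(2)[OF While_step.prems(1) k(3) While_step.prems(3,4)] by auto
  have "ram_run P (length test + Suc 0 + k + Suc 0 + k') (pc, m) = Some (pc + clen (While a b c), m3)"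
    using ram_run_trans[OF ram_run_trans[OF ram_run_trans[OF ram_run_trans[OF ram_run_effects[OF at(1) m1(1)] j] k(2)] j2] k'(2)] .
  moreover have "length test + Suc 0 + Suc 0 \<le> L" using While_step.prems(4) by (simp add: test_def)
  ultimately show ?case using k(1) k'(1,3)
    by (intro exI[of _ "length test + Suc 0 + k + Suc 0 + k'"] exI[of _ m3]) (simp add: algebra_simps)
qed

section \<open>Total correctness with cost bounds\<close>

definition wp :: "com \<Rightarrow> nat \<Rightarrow> (st \<Rightarrow> bool) \<Rightarrow> st \<Rightarrow> bool" where
  "wp c T Q s \<longleftrightarrow> (\<exists>t s'. exec c s t s' \<and> t \<le> T \<and> Q s')"

lemma wp_Do: "assigns_ok bs s \<Longrightarrow> Q (assigns bs s) \<Longrightarrow> wp (Do bs) 1 Q s"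
  unfolding wp_def using exec.Do by blast

lemma wp_Seq:
  assumes "wp c1 T1 R s" "\<And>s'. R s' \<Longrightarrow> wp c2 T2 Q s'"
  shows "wp (c1 ;; c2) (T1 + T2) Q s"
proof -
  obtain t1 s1 where 1: "exec c1 s t1 s1" "t1 \<le> T1" "R s1" using assms(1) by (auto simp: wp_def)
  obtain t2 s2 where 2: "exec c2 s1 t2 s2" "t2 \<le> T2" "Q s2" using assms(2)[OF 1(3)] by (auto simp: wp_def)
  show ?thesis unfolding wp_def using exec.Seq[OF 1(1) 2(1)] 1(2) 2(2,3) add_mono by blast
qed

lemma wp_weaken: "wp c T R s \<Longrightarrow> (\<And>s'. R s' \<Longrightarrow> Q s') \<Longrightarrow> T \<le> T' \<Longrightarrow> wp c T' Q s"
  unfolding wp_def using le_trans by blast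

lemma wp_If:
  assumes "rok s a" "rok s b" "rval s a \<le> rval s b \<Longrightarrow> wp c1 T Q s"
    "\<not> rval s a \<le> rval s b \<Longrightarrow> wp c2 T Q s"
  shows "wp (If a b c1 c2) (Suc T) Q s"
proof (cases "rval s a \<le> rval s b")
  case True
  then obtain t s' where "exec c1 s t s'" "t \<le> T" "Q s'" using assms(3) by (auto simp: wp_def)
  then show ?thesis unfolding wp_def using exec.If_le[OF assms(1,2) True] Suc_le_mono by blast
next
  case False
  then obtain t s' where "exec c2 s t s'" "t \<le> T" "Q s'" using assms(4) by (auto simp: wp_def)
  then show ?thesis unfolding wp_def using exec.If_gt[OF assms(1,2) False] Suc_le_mono by blast
qed

text \<open>The invariant is indexed by the iteration counter and the final index is known
  beforehand, so termination needs no separate measure. Each round costs \<open>T\<close> plus its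
  test; the last 1 is the failing test.\<close>

lemma wp_While:
  assumes "I i s" "i \<le> K"
    and step: "\<And>k iv rv h. i \<le> k \<Longrightarrow> k < K \<Longrightarrow> I k (iv, rv, h) \<Longrightarrow>
      nok iv a \<and> nok iv b \<and> nval iv a \<le> nval iv b \<and> wp c T (I (Suc k)) (iv, rv, h)"
    and last: "\<And>iv rv h. I K (iv, rv, h) \<Longrightarrow> nok iv a \<and> nok iv b \<and> \<not> nval iv a \<le> nval iv b"
  shows "wp (While a b c) ((K - i) * Suc T + 1) (I K) s"
  using assms(2,1) step
proof (induction i arbitrary: s rule: inc_induct)
  case base
  obtain iv rv h where s: "s = (iv, rv, h)" by (cases s)
  show ?case unfolding wp_def using exec.While_end[of iv a b c rv h] last[of iv rv h] base(1) s by auto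
next
  case (step i)
  obtain iv rv h where s: "s = (iv, rv, h)" by (cases s)
  have *: "nok iv a" "nok iv b" "nval iv a \<le> nval iv b" "wp c T (I (Suc i)) (iv, rv, h)"
    using step.prems(2)[of i iv rv h] step.prems(1) step.hyps s by auto
  then obtain t1 s1 where 1: "exec c (iv, rv, h) t1 s1" "t1 \<le> T" "I (Suc i) s1" by (auto simp: wp_def)
  have "wp (While a b c) ((K - Suc i) * Suc T + 1) (I K) s1"
    by (rule step.IH[OF 1(3)], rule step.prems(2)) auto
  then obtain t2 s2 where 2: "exec (While a b c) s1 t2 s2" "t2 \<le> (K - Suc i) * Suc T + 1" "I K s2"
    by (auto simp: wp_def)
  have "K - i = Suc (K - Suc i)" using step.hyps by simp
  then have "Suc (t1 + t2) \<le> (K - i) * Suc T + 1" using 1(2) 2(2) by simp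
  then show ?case unfolding wp_def s using exec.While_step[OF *(1-3) 1(1) 2(1)] 2(3) by blast
qed

text \<open>Initially all low cells may hold input, so there is no free register except that \<open>n\<close> in
  cell 0 can be recovered after it has been doubled.  Doubling it six times yields a free address
  \<open>64 n\<close> to which cell 1 is saved; a constant in cell 1 then allows saving cells 2 to 63 behind it.\<close>

definition prologue :: "instr list" where
  "prologue = replicate 6 (Add 0 0 0) @ [Store 0 1, Const 1 1]
     @ concat (map (\<lambda>k. [Add 0 0 1, Store 0 k]) [2..<2 + 62])
     @ map (\<lambda>v. Const v 0) [16..<16 + 16]
     @ [Const 32 62, Sub 0 0 32, Const 32 64, Div 16 0 32]"

lemma effects_save:
  assumes "m 0 = real d" "m 1 = 1" "d \<ge> 64" "j \<le> 62"
  shows "effects (concat (map (\<lambda>k. [Add 0 0 1, Store 0 k]) [2..<2 + j])) m =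
    Some (\<lambda>a. if a = 0 then real (d + j) else if d < a \<and> a \<le> d + j then m (a - d + 1) else m a)"
  using assms(4)
proof (induction j)
  case 0
  then show ?case using assms(1) by auto
next
  case (Suc j)
  define m1 where "m1 = (\<lambda>a. if a = 0 then real (d + j) else if d < a \<and> a \<le> d + j then m (a - d + 1) else m a)"
  have 1: "m1 0 = real (d + j)" "m1 (Suc 0) = 1" "m1 (2 + j) = m (2 + j)"
    using assms(2,3) Suc.prems by (auto simp: m1_def)
  have "effects [Add 0 0 1, Store 0 (2 + j)] m1 = Some (m1(0 := real (Suc (d + j)), Suc (d + j) := m (2 + j)))"
  proof -
    have "effect (Add 0 0 1) m1 = Some (m1(0 := real (Suc (d + j))))" using 1 by (simp add: add.commute)
    moreover have "effect (Store 0 (2 + j)) (m1(0 := real (Suc (d + j))))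
        = Some (m1(0 := real (Suc (d + j)), Suc (d + j) := m (2 + j)))"
    proof -
      have "nat \<lfloor>real (Suc (d + j))\<rfloor> = Suc (d + j)" by (metis floor_of_nat nat_int)
      moreover have "real (Suc (d + j)) \<in> \<nat>" by (rule of_nat_in_Nats)
      ultimately show ?thesis using 1(3) by (simp del: of_nat_Suc)
    qed
    ultimately show ?thesis by simp
  qed
  moreover have "m1(0 := real (Suc (d + j)), Suc (d + j) := m (2 + j))
     = (\<lambda>a. if a = 0 then real (d + Suc j) else if d < a \<and> a \<le> d + Suc j then m (a - d + 1) else m a)"
    using assms(3) by (auto simp: m1_def fun_eq_iff le_Suc_eq)
  ultimately show ?case using Suc by (simp add: effects_append m1_def[symmetric])
qed

lemma effects_zero:
  "effects (map (\<lambda>v. Const v 0) [16..<16 + j]) m = Some (\<lambda>a. if 16 \<le> a \<and> a < 16 + j then 0 else m a)"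
proof (induction j)
  case (Suc j)
  have "[16..<16 + Suc j] = [16..<16 + j] @ [16 + j]" by (simp only: add_Suc_right upt_Suc) simp
  with Suc show ?case by (auto simp: effects_append fun_eq_iff simp del: upt_Suc)
qed (auto simp: fun_eq_iff)

lemma effects_appendI:
  "effects xs m = Some m1 \<Longrightarrow> effects ys m1 = Some m2 \<Longrightarrow> effects (xs @ ys) m = Some m2"
  by (simp add: effects_append)

text \<open>Cells 1 to 63 make room for registers and scratch and reappear from
  \<open>64 * n\<close> on; other cells keep their place. No input is overwritten, as it ends at
  \<open>2 * n\<close>.\<close>

definition start_heap :: "nat \<Rightarrow> (nat \<Rightarrow> real) \<Rightarrow> nat \<Rightarrow> real" where
  "start_heap n inp a = (if 64 * n \<le> a \<and> a < 64 * n + 63 then inp (a - 64 * n + 1) else inp a)"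

lemma prologue_correct:
  assumes "inp 0 = real n" "n \<ge> 1"
  shows "\<exists>m rv. effects prologue inp = Some m \<and> represents ((\<lambda>_. 0)(0 := n), rv, start_heap n inp) m"
proof -
  define m1 where "m1 = inp(0 := real (64 * n), 64 * n := inp 1, 1 := 1)"
  have 1: "effects (replicate 6 (Add 0 0 0)) inp = Some (inp(0 := real (64 * n)))"
    using assms(1) by (simp add: numeral_eq_Suc)
  have 2: "effects [Store 0 1, Const 1 1] (inp(0 := real (64 * n))) = Some m1"
  proof -
    have "nat \<lfloor>real (64 * n)\<rfloor> = 64 * n" by (metis floor_of_nat nat_int)
    moreover have "real (64 * n) \<in> \<nat>" by (rule of_nat_in_Nats)
    ultimately show ?thesis by (simp add: m1_def del: of_nat_mult)
  qed
  have 3: "effects (concat (map (\<lambda>k. [Add 0 0 1, Store 0 k]) [2..<2 + 62])) m1 =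
    Some (\<lambda>a. if a = 0 then real (64 * n + 62) else if 64 * n < a \<and> a \<le> 64 * n + 62 then m1 (a - 64 * n + 1) else m1 a)"
    (is "_ = Some ?m2")
    using assms(2) by (intro effects_save) (auto simp: m1_def)
  have 4: "effects (map (\<lambda>v. Const v 0) [16..<16 + 16]) ?m2 = Some (\<lambda>a. if 16 \<le> a \<and> a < 16 + 16 then 0 else ?m2 a)"
    (is "_ = Some ?m3") by (rule effects_zero)
  \<comment> \<open>After the last save cell 0 holds \<open>64 * n + 62\<close>; subtracting 62 and
    dividing by 64 recovers \<open>n\<close>.\<close>
  have 5: "effects [Const 32 62, Sub 0 0 32, Const 32 64, Div 16 0 32] ?m3
     = Some (?m3(0 := real (64 * n), 32 := 64, 16 := real n))"
    by (simp add: fun_upd_twist)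
  have "effects prologue inp = Some (?m3(0 := real (64 * n), 32 := 64, 16 := real n))"
    unfolding prologue_def by (rule effects_appendI[OF 1] effects_appendI[OF 2] effects_appendI[OF 3]
      effects_appendI[OF 4] 5)+
  moreover have "represents ((\<lambda>_. 0)(0 := n), ?m3(0 := real (64 * n)), start_heap n inp)
    (?m3(0 := real (64 * n), 32 := 64, 16 := real n))"
    using assms(2) by (auto simp: represents_def start_heap_def m1_def)
  ultimately show ?thesis by blast
qed

text \<open>\<open>rv\<close> is arbitrary because the prologue zeroes only the natural variables
  and leaves residual values in the real registers.\<close>

lemma compiled_program_correct:
  assumes inp: "inp 0 = real n" "n \<ge> 1" and "cwf c"
    and wp: "\<And>rv. wp c T Q ((\<lambda>_. 0)(0 := n), rv, start_heap n inp)"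
  shows "\<exists>m s. ram_halts_within (prologue @ ccomp c (length prologue) @ [Halt]) inp
      (length prologue + T * clen c) m \<and> represents s m \<and> Q s"
proof -
  let ?P = "prologue @ ccomp c (length prologue) @ [Halt]"
  obtain m rv where m: "effects prologue inp = Some m"
    "represents ((\<lambda>_. 0)(0 := n), rv, start_heap n inp) m"
    using prologue_correct[of inp n] inp by blast
  obtain t s where t: "exec c ((\<lambda>_. 0)(0 := n), rv, start_heap n inp) t s" "t \<le> T" "Q s"
    using wp[of rv] by (auto simp: wp_def)
  have at: "code_at ?P 0 prologue" "code_at ?P (length prologue) (ccomp c (length prologue))"
    unfolding code_at_def by force+
  obtain k m' where k: "k \<le> t * clen c" "represents s m'"
    "ram_run ?P k (length prologue, m) = Some (length prologue + clen c, m')"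
    using ccomp_correct[OF t(1) assms(3) m(2) at(2) order_refl] by blast
  have "ram_run ?P (length prologue) (0, inp) = Some (length prologue, m)"
    using ram_run_effects[OF at(1) m(1)] by simp
  then have "ram_run ?P (length prologue + k) (0, inp) = Some (length prologue + clen c, m')"
    using k(3) by (rule ram_run_trans)
  moreover have "k \<le> T * clen c" using k(1) t(2) by (meson mult_le_mono1 order_trans)
  ultimately have "ram_halts_within ?P inp (length prologue + T * clen c) m'"
    unfolding ram_halts_within_def
    by (intro exI[of _ "length prologue + k"] exI[of _ "length prologue + clen c"])
       (auto simp: ram_halted_def nth_append)
  with k(2) t(3) show ?thesis by blast
qed

lemma wp_loop:
  assumes "assigns_ok bs s" "I i (assigns bs s)" "i \<le> K"
    and "\<And>k iv rv h. i \<le> k \<Longrightarrow> k < K \<Longrightarrow> I k (iv, rv, h) \<Longrightarrow>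
      nok iv a \<and> nok iv b \<and> nval iv a \<le> nval iv b \<and> wp c T (I (Suc k)) (iv, rv, h)"
    and "\<And>iv rv h. I K (iv, rv, h) \<Longrightarrow> nok iv a \<and> nok iv b \<and> \<not> nval iv a \<le> nval iv b"
  shows "wp (Do bs ;; While a b c) ((K - i) * Suc T + 2) (I K) s"
proof -
  have "wp (Do bs ;; While a b c) (1 + ((K - i) * Suc T + 1)) (I K) s"
  proof (rule wp_Seq)
    show "wp (Do bs) 1 (I i) s" using assms(1,2) by (rule wp_Do)
    show "wp (While a b c) ((K - i) * Suc T + 1) (I K) s'" if "I i s'" for s'
      by (rule wp_While[of I i, OF that assms(3)]) (use assms(4,5) in auto)
  qed
  then show ?thesis by simp
qed

section \<open>The algorithm\<close>

text \<open>Natural variables: 0 number of beads, 1 address of the copied input, 2 a quarter \<open>q\<close> of the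
  transform length, 3 base address of the current level, 4 loop counter, 5 source array,
  6 number of blocks.  A level occupies \<open>16 q\<close> cells: the two polynomials at offsets 0 and \<open>4 q\<close>, the
  parameters \<open>a\<close> of the moduli at \<open>8 q\<close>, and the product at \<open>12 q\<close>.
  Real variables 0 to 2 are the output cells, 3 to 6 hold the sums of \<open>x\<close>, \<open>x^2\<close>, \<open>y\<close> and the
  sum of squares of the current window of the unrolled \<open>y\<close>.\<close>

abbreviation (input) "nN \<equiv> NV 0"
abbreviation (input) "nA \<equiv> NV 1"
abbreviation (input) "nQ \<equiv> NV 2"
abbreviation (input) "nG \<equiv> NV 3"
abbreviation (input) "nJ \<equiv> NV 4"
abbreviation (input) "nS \<equiv> NV 5"
abbreviation (input) "nB \<equiv> NV 6"

definition agree_off :: "nat \<Rightarrow> nat \<Rightarrow> (nat \<Rightarrow> real) \<Rightarrow> (nat \<Rightarrow> real) \<Rightarrow> bool" where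
  "agree_off lo hi h h' \<longleftrightarrow> (\<forall>a. a < lo \<or> hi \<le> a \<longrightarrow> h' a = h a)"

lemma agree_off_refl [simp]: "agree_off lo hi h h"
  by (simp add: agree_off_def)

lemma agree_off_upd [simp]:
  "agree_off lo hi h h' \<Longrightarrow> lo \<le> a \<Longrightarrow> a < hi \<Longrightarrow> agree_off lo hi h (h'(a := v))"
  by (simp add: agree_off_def)

lemma agree_off_trans:
  "agree_off lo hi h h' \<Longrightarrow> agree_off lo' hi' h' h'' \<Longrightarrow> l \<le> lo \<Longrightarrow> l \<le> lo' \<Longrightarrow> hi \<le> u \<Longrightarrow> hi' \<le> u
    \<Longrightarrow> agree_off l u h h''"
  by (simp add: agree_off_def)

lemma agree_offD: "agree_off lo hi h h' \<Longrightarrow> a < lo \<or> hi \<le> a \<Longrightarrow> h' a = h a"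
  by (auto simp: agree_off_def)

text \<open>Residues go to the same slot one level further, \<open>16 q\<close> cells on;
  \<open>18 q\<close> reaches the upper half of that slot. Real variable 12 holds the part common to
  both upper residues.\<close>

definition split_loop :: com where
  "split_loop =
     Do [NAss 4 (NC 0)] ;;
     While (nJ +\<^sub>n NC 1) nQ (Do [
       RAss 7 (Hp (nS +\<^sub>n nJ)),
       RAss 8 (Hp (nS +\<^sub>n nJ +\<^sub>n nQ)),
       RAss 9 (Hp (nS +\<^sub>n nJ +\<^sub>n NC 2 *\<^sub>n nQ)),
       RAss 10 (Hp (nS +\<^sub>n nJ +\<^sub>n NC 3 *\<^sub>n nQ)),
       RAss 11 (RSqrt (RC 2 +\<^sub>r Hp (nG +\<^sub>n NC 8 *\<^sub>n nQ +\<^sub>n nJ))),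
       RAss 12 (RV 8 +\<^sub>r (RV 11 *\<^sub>r RV 11 -\<^sub>r RC 1) *\<^sub>r RV 10),
       HAss (nS +\<^sub>n NC 16 *\<^sub>n nQ +\<^sub>n NC 2 *\<^sub>n nJ) (RV 7 -\<^sub>r RV 9 -\<^sub>r RV 11 *\<^sub>r RV 10),
       HAss (nS +\<^sub>n NC 16 *\<^sub>n nQ +\<^sub>n NC 2 *\<^sub>n nJ +\<^sub>n NC 1) (RV 7 -\<^sub>r RV 9 +\<^sub>r RV 11 *\<^sub>r RV 10),
       HAss (nS +\<^sub>n NC 18 *\<^sub>n nQ +\<^sub>n NC 2 *\<^sub>n nJ) (RV 12 +\<^sub>r RV 11 *\<^sub>r RV 9),
       HAss (nS +\<^sub>n NC 18 *\<^sub>n nQ +\<^sub>n NC 2 *\<^sub>n nJ +\<^sub>n NC 1) (RV 12 -\<^sub>r RV 11 *\<^sub>r RV 9),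
       NAss 4 (nJ +\<^sub>n NC 1)])"

lemma split_loop_correct:
  assumes iv: "iv 2 = q" "iv 3 = g" "iv 5 = S" and S: "64 \<le> g" "g \<le> S"
    and al: "\<And>j. j < q \<Longrightarrow> - 2 \<le> h (g + 8 * q + j)"
  shows "wp split_loop (2 * q + 2) (\<lambda>(iv', rv', h'). iv' = iv(4 := q) \<and>
     agree_off (S + 16 * q) (S + 20 * q) h h' \<and>
     split_step q (\<lambda>j. sqrt (2 + h (g + 8 * q + j))) (\<lambda>i. h (S + i)) (\<lambda>i. h' (S + 16 * q + i))) (iv, rv, h)"
proof -
  define I :: "nat \<Rightarrow> st \<Rightarrow> bool" where "I k = (\<lambda>(iv', rv', h'). iv' = iv(4 := k) \<and>
     agree_off (S + 16 * q) (S + 20 * q) h h' \<and>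
     (\<forall>j<k. let r = sqrt (2 + h (g + 8 * q + j)) in
     h' (S + 16 * q + 2 * j) = h (S + j) - h (S + j + 2 * q) - r * h (S + j + 3 * q) \<and>
     h' (S + 16 * q + 2 * j + 1) = h (S + j) - h (S + j + 2 * q) + r * h (S + j + 3 * q) \<and>
     h' (S + 18 * q + 2 * j) = h (S + j + q) + r * h (S + j + 2 * q) + (r\<^sup>2 - 1) * h (S + j + 3 * q) \<and>
     h' (S + 18 * q + 2 * j + 1) = h (S + j + q) - r * h (S + j + 2 * q) + (r\<^sup>2 - 1) * h (S + j + 3 * q)))"
    for k
  have "wp split_loop ((q - 0) * Suc 1 + 2) (I q) (iv, rv, h)"
    unfolding split_loop_def
  proof (rule wp_loop, goal_cases)
    case (4 k iv' rv' h')
    then have iv': "iv' = iv(4 := k)" and agree: "agree_off (S + 16 * q) (S + 20 * q) h h'"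
      by (auto simp: I_def)
    have reads: "h' (S + k) = h (S + k)" "h' (S + k + q) = h (S + k + q)"
       "h' (S + k + 2 * q) = h (S + k + 2 * q)"
       "h' (S + k + 3 * q) = h (S + k + 3 * q)" "h' (g + 8 * q + k) = h (g + 8 * q + k)"
      using 4(2) S by (auto intro!: agree_offD[OF agree])
    have ok: "0 \<le> 2 + h (g + 8 * q + k)" using al[of k] 4(2) by simp
    show ?case
      using 4(2,3) S reads ok unfolding iv' I_def by (intro conjI wp_Do) (simp_all add: iv)
  qed (simp_all add: I_def iv)
  then show ?thesis
    by (rule wp_weaken) (auto simp: I_def split_step_def Let_def add.assoc)
qed

definition param_loop :: com where
  "param_loop =
     Do [NAss 4 (NC 0)] ;;
     While (nJ +\<^sub>n NC 1) nQ (Do [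
       RAss 7 (RSqrt (RC 2 +\<^sub>r Hp (nG +\<^sub>n NC 8 *\<^sub>n nQ +\<^sub>n nJ))),
       HAss (nG +\<^sub>n NC 24 *\<^sub>n nQ +\<^sub>n NC 2 *\<^sub>n nJ) (RV 7),
       HAss (nG +\<^sub>n NC 24 *\<^sub>n nQ +\<^sub>n NC 2 *\<^sub>n nJ +\<^sub>n NC 1) (RC 0 -\<^sub>r RV 7),
       NAss 4 (nJ +\<^sub>n NC 1)])"

lemma param_loop_correct:
  assumes iv: "iv 2 = q" "iv 3 = g" and g: "64 \<le> g"
    and al: "\<And>j. j < q \<Longrightarrow> - 2 \<le> h (g + 8 * q + j)"
  shows "wp param_loop (2 * q + 2) (\<lambda>(iv', rv', h'). iv' = iv(4 := q) \<and>
     agree_off (g + 24 * q) (g + 26 * q) h h' \<and>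
     params_step q (\<lambda>i. h (g + 8 * q + i)) (\<lambda>i. h' (g + 24 * q + i))) (iv, rv, h)"
proof -
  define I :: "nat \<Rightarrow> st \<Rightarrow> bool" where "I k = (\<lambda>(iv', rv', h'). iv' = iv(4 := k) \<and>
     agree_off (g + 24 * q) (g + 26 * q) h h' \<and>
     (\<forall>j<k. h' (g + 24 * q + 2 * j) = sqrt (2 + h (g + 8 * q + j)) \<and>
       h' (g + 24 * q + 2 * j + 1) = - sqrt (2 + h (g + 8 * q + j))))" for k
  have "wp param_loop ((q - 0) * Suc 1 + 2) (I q) (iv, rv, h)"
    unfolding param_loop_def
  proof (rule wp_loop, goal_cases)
    case (4 k iv' rv' h')
    then have iv': "iv' = iv(4 := k)" and agree: "agree_off (g + 24 * q) (g + 26 * q) h h'"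
      by (auto simp: I_def)
    have reads: "h' (g + 8 * q + k) = h (g + 8 * q + k)"
      using 4(2) by (auto intro!: agree_offD[OF agree])
    have ok: "0 \<le> 2 + h (g + 8 * q + k)" using al[of k] 4(2) by simp
    show ?case
      using 4(2,3) g ok reads unfolding iv' I_def by (intro conjI wp_Do) (simp_all add: iv)
  qed (simp_all add: I_def iv)
  then show ?thesis
    by (rule wp_weaken) (auto simp: I_def params_step_def add.assoc)
qed

text \<open>At the deepest level the \<open>4 q\<close> coefficients form \<open>2 q\<close> blocks
  of length two.\<close>

definition leaf_loop :: com where
  "leaf_loop =
     Do [NAss 4 (NC 0)] ;;
     While (nJ +\<^sub>n NC 1) (NC 2 *\<^sub>n nQ) (Do [
       RAss 7 (Hp (nG +\<^sub>n nJ)),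
       RAss 8 (Hp (nG +\<^sub>n NC 2 *\<^sub>n nQ +\<^sub>n nJ)),
       RAss 9 (Hp (nG +\<^sub>n NC 4 *\<^sub>n nQ +\<^sub>n nJ)),
       RAss 10 (Hp (nG +\<^sub>n NC 6 *\<^sub>n nQ +\<^sub>n nJ)),
       RAss 11 (Hp (nG +\<^sub>n NC 8 *\<^sub>n nQ +\<^sub>n nJ)),
       HAss (nG +\<^sub>n NC 12 *\<^sub>n nQ +\<^sub>n nJ) (RV 7 *\<^sub>r RV 9 -\<^sub>r RV 8 *\<^sub>r RV 10),
       HAss (nG +\<^sub>n NC 14 *\<^sub>n nQ +\<^sub>n nJ)
         (RV 7 *\<^sub>r RV 10 +\<^sub>r RV 8 *\<^sub>r RV 9 +\<^sub>r RV 11 *\<^sub>r (RV 8 *\<^sub>r RV 10)),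
       NAss 4 (nJ +\<^sub>n NC 1)])"

lemma leaf_loop_correct:
  assumes iv: "iv 2 = q" "iv 3 = g" and g: "64 \<le> g"
  shows "wp leaf_loop (4 * q + 2) (\<lambda>(iv', rv', h'). iv' = iv(4 := 2 * q) \<and>
     agree_off (g + 12 * q) (g + 16 * q) h h' \<and>
     leaf_product (2 * q) (\<lambda>i. h (g + 8 * q + i)) (\<lambda>i. h (g + i)) (\<lambda>i. h (g + 4 * q + i))
       (\<lambda>i. h' (g + 12 * q + i))) (iv, rv, h)"
proof -
  define I :: "nat \<Rightarrow> st \<Rightarrow> bool" where "I k = (\<lambda>(iv', rv', h'). iv' = iv(4 := k) \<and>
     agree_off (g + 12 * q) (g + 16 * q) h h' \<and>
     (\<forall>j<k. h' (g + 12 * q + j) = h (g + j) * h (g + 4 * q + j) - h (g + 2 * q + j) * h (g + 6 * q + j) \<and>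
       h' (g + 14 * q + j) = h (g + j) * h (g + 6 * q + j) + h (g + 2 * q + j) * h (g + 4 * q + j)
         + h (g + 8 * q + j) * (h (g + 2 * q + j) * h (g + 6 * q + j))))" for k
  have "wp leaf_loop ((2 * q - 0) * Suc 1 + 2) (I (2 * q)) (iv, rv, h)"
    unfolding leaf_loop_def
  proof (rule wp_loop, goal_cases)
    case (4 k iv' rv' h')
    then have iv': "iv' = iv(4 := k)" and agree: "agree_off (g + 12 * q) (g + 16 * q) h h'"
      by (auto simp: I_def)
    have reads: "h' (g + k) = h (g + k)" "h' (g + 2 * q + k) = h (g + 2 * q + k)"
        "h' (g + 4 * q + k) = h (g + 4 * q + k)" "h' (g + 6 * q + k) = h (g + 6 * q + k)"
        "h' (g + 8 * q + k) = h (g + 8 * q + k)"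
      using 4(2) by (auto intro!: agree_offD[OF agree])
    show ?case
      using 4(2,3) g reads unfolding iv' I_def by (intro conjI wp_Do) (simp_all add: iv less_Suc_eq)
  qed (simp_all add: I_def iv)
  then show ?thesis
  proof (rule wp_weaken)
    fix s assume "I (2 * q) s"
    then show "case s of (iv', rv', h') \<Rightarrow> iv' = iv(4 := 2 * q) \<and> agree_off (g + 12 * q) (g + 16 * q) h h' \<and>
     leaf_product (2 * q) (\<lambda>i. h (g + 8 * q + i)) (\<lambda>i. h (g + i)) (\<lambda>i. h (g + 4 * q + i))
       (\<lambda>i. h' (g + 12 * q + i))"
      by (cases s) (simp add: I_def leaf_product_def add_ac)
  qed simp
qed

text \<open>\<open>28 q = 16 q + 12 q\<close> addresses the product one level further.\<close>

definition merge_loop :: com where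
  "merge_loop =
     Do [NAss 4 (NC 0)] ;;
     While (nJ +\<^sub>n NC 1) nQ (Do [
       RAss 11 (RSqrt (RC 2 +\<^sub>r Hp (nG +\<^sub>n NC 8 *\<^sub>n nQ +\<^sub>n nJ))),
       RAss 7 (Hp (nG +\<^sub>n NC 28 *\<^sub>n nQ +\<^sub>n NC 2 *\<^sub>n nJ)),
       RAss 8 (Hp (nG +\<^sub>n NC 28 *\<^sub>n nQ +\<^sub>n NC 2 *\<^sub>n nJ +\<^sub>n NC 1)),
       RAss 9 (Hp (nG +\<^sub>n NC 30 *\<^sub>n nQ +\<^sub>n NC 2 *\<^sub>n nJ)),
       RAss 10 (Hp (nG +\<^sub>n NC 30 *\<^sub>n nQ +\<^sub>n NC 2 *\<^sub>n nJ +\<^sub>n NC 1)),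
       RAss 12 ((RV 8 -\<^sub>r RV 7) /\<^sub>r (RC 2 *\<^sub>r RV 11)),
       RAss 13 ((RV 9 -\<^sub>r RV 10) /\<^sub>r (RC 2 *\<^sub>r RV 11)),
       HAss (nG +\<^sub>n NC 12 *\<^sub>n nQ +\<^sub>n nJ) ((RV 7 +\<^sub>r RV 8) /\<^sub>r RC 2 +\<^sub>r RV 13),
       HAss (nG +\<^sub>n NC 13 *\<^sub>n nQ +\<^sub>n nJ)
         ((RV 9 +\<^sub>r RV 10) /\<^sub>r RC 2 -\<^sub>r (RV 11 *\<^sub>r RV 11 -\<^sub>r RC 1) *\<^sub>r RV 12),
       HAss (nG +\<^sub>n NC 14 *\<^sub>n nQ +\<^sub>n nJ) (RV 13),
       HAss (nG +\<^sub>n NC 15 *\<^sub>n nQ +\<^sub>n nJ) (RV 12),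
       NAss 4 (nJ +\<^sub>n NC 1)])"

lemma merge_loop_correct:
  assumes iv: "iv 2 = q" "iv 3 = g" and g: "64 \<le> g"
    and al: "\<And>j. j < q \<Longrightarrow> - 2 < h (g + 8 * q + j)"
  shows "wp merge_loop (2 * q + 2) (\<lambda>(iv', rv', h'). iv' = iv(4 := q) \<and>
     agree_off (g + 12 * q) (g + 16 * q) h h' \<and>
     merge_step q (\<lambda>j. sqrt (2 + h (g + 8 * q + j))) (\<lambda>i. h (g + 28 * q + i))
       (\<lambda>i. h' (g + 12 * q + i))) (iv, rv, h)"
proof -
  define I :: "nat \<Rightarrow> st \<Rightarrow> bool" where "I k = (\<lambda>(iv', rv', h'). iv' = iv(4 := k) \<and>
     agree_off (g + 12 * q) (g + 16 * q) h h' \<and>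
     (\<forall>j<k. let r = sqrt (2 + h (g + 8 * q + j)) in
       h' (g + 15 * q + j) = (h (g + 28 * q + 2 * j + 1) - h (g + 28 * q + 2 * j)) / (2 * r) \<and>
       h' (g + 14 * q + j) = (h (g + 30 * q + 2 * j) - h (g + 30 * q + 2 * j + 1)) / (2 * r) \<and>
       h' (g + 12 * q + j) = (h (g + 28 * q + 2 * j) + h (g + 28 * q + 2 * j + 1)) / 2 + h' (g + 14 * q + j) \<and>
       h' (g + 13 * q + j) = (h (g + 30 * q + 2 * j) + h (g + 30 * q + 2 * j + 1)) / 2
         - (r\<^sup>2 - 1) * h' (g + 15 * q + j)))" for k
  have "wp merge_loop ((q - 0) * Suc 1 + 2) (I q) (iv, rv, h)"
    unfolding merge_loop_def
  proof (rule wp_loop, goal_cases)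
    case (4 k iv' rv' h')
    then have iv': "iv' = iv(4 := k)" and agree: "agree_off (g + 12 * q) (g + 16 * q) h h'"
      by (auto simp: I_def)
    have reads: "h' (g + 8 * q + k) = h (g + 8 * q + k)"
        "h' (g + 28 * q + 2 * k) = h (g + 28 * q + 2 * k)"
        "h' (Suc (g + 28 * q + 2 * k)) = h (Suc (g + 28 * q + 2 * k))"
        "h' (g + 30 * q + 2 * k) = h (g + 30 * q + 2 * k)"
        "h' (Suc (g + 30 * q + 2 * k)) = h (Suc (g + 30 * q + 2 * k))"
      using 4(2) by (auto intro!: agree_offD[OF agree])
    have ok: "0 < 2 + h (g + 8 * q + k)" using al[of k] 4(2) by simp
    show ?case
      using 4(2,3) g reads ok unfolding iv' I_def
      by (intro conjI wp_Do) (simp_all add: iv less_Suc_eq Let_def)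
  qed (simp_all add: I_def iv)
  then show ?thesis
  proof (rule wp_weaken)
    fix s assume "I q s"
    then show "case s of (iv', rv', h') \<Rightarrow> iv' = iv(4 := q) \<and> agree_off (g + 12 * q) (g + 16 * q) h h' \<and>
       merge_step q (\<lambda>j. sqrt (2 + h (g + 8 * q + j))) (\<lambda>i. h (g + 28 * q + i)) (\<lambda>i. h' (g + 12 * q + i))"
      by (cases s) (simp add: I_def merge_step_def add_ac Let_def)
  qed simp
qed

text \<open>Relates a level to its successor. Later phases leave these slots intact, so the relation
  is still available to the backward pass.\<close>

definition level_ok :: "nat \<Rightarrow> (nat \<Rightarrow> real) \<Rightarrow> nat \<Rightarrow> bool" where
  "level_ok q h g \<longleftrightarrow>
     split_step q (\<lambda>j. sqrt (2 + h (g + 8 * q + j))) (\<lambda>i. h (g + i)) (\<lambda>i. h (g + 16 * q + i)) \<and>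
     split_step q (\<lambda>j. sqrt (2 + h (g + 8 * q + j))) (\<lambda>i. h (g + 4 * q + i)) (\<lambda>i. h (g + 20 * q + i)) \<and>
     params_step q (\<lambda>i. h (g + 8 * q + i)) (\<lambda>i. h (g + 24 * q + i))"

lemma split_step_cong:
  assumes "split_step q r1 f1 f1'" "\<And>j. j < q \<Longrightarrow> r1 j = r2 j"
    "\<And>i. i < 4 * q \<Longrightarrow> f1 i = f2 i" "\<And>i. i < 4 * q \<Longrightarrow> f1' i = f2' i"
  shows "split_step q r2 f2 f2'"
  using assms unfolding split_step_def by simp

text \<open>The last cells read are the \<open>2 q\<close> parameters of the successor, at
  \<open>g + 24 * q\<close>.\<close>

lemma level_ok_cong:
  assumes "\<And>a. a < g + 26 * q \<Longrightarrow> h' a = h a"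
  shows "level_ok q h' g = level_ok q h g"
  unfolding level_ok_def split_step_def params_step_def by (simp add: assms cong: conj_cong)

definition forward_body :: com where
  "forward_body =
       Do [NAss 5 nG] ;; split_loop ;;
       Do [NAss 5 (nG +\<^sub>n NC 4 *\<^sub>n nQ)] ;; split_loop ;;
       param_loop ;;
       Do [NAss 3 (nG +\<^sub>n NC 16 *\<^sub>n nQ), NAss 6 (nB +\<^sub>n nB)]"

text \<open>The test admits block counts \<open>1, 2, 4, ..., q\<close>, so \<open>q = 2 ^ K\<close>
  gives \<open>K + 1\<close> splits and ends with blocks of length two. Levels start at
  \<open>128 * n\<close>, beyond the copied input.\<close>

definition forward_loop :: com where
  "forward_loop =
     Do [NAss 3 (NC 128 *\<^sub>n nN), NAss 6 (NC 1)] ;;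
     While nB nQ forward_body"

lemma forward_body_correct:
  assumes iv: "iv 2 = q" "iv 3 = g" and g: "64 \<le> g" and al: "\<And>j. j < q \<Longrightarrow> - 2 \<le> h (g + 8 * q + j)"
  shows "wp forward_body (6 * q + 9)
     (\<lambda>(iv', rv', h'). (\<forall>v\<le>2. iv' v = iv v) \<and> iv' 3 = g + 16 * q \<and> iv' 6 = 2 * iv 6 \<and>
        (\<forall>a<g + 16 * q. h' a = h a) \<and> level_ok q h' g) (iv, rv, h)"
proof -
  let ?r = "\<lambda>j. sqrt (2 + h (g + 8 * q + j))"
  define R1 :: "st \<Rightarrow> bool" where "R1 = (\<lambda>(iv', rv', h'). iv' = iv(5 := g) \<and> h' = h)"
  define R2 :: "st \<Rightarrow> bool" where "R2 = (\<lambda>(iv', rv', h'). (\<forall>v\<le>3. iv' v = iv v) \<and> iv' 6 = iv 6 \<and>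
     agree_off (g + 16 * q) (g + 20 * q) h h' \<and> split_step q ?r (\<lambda>i. h (g + i)) (\<lambda>i. h' (g + 16 * q + i)))"
  define R3 :: "st \<Rightarrow> bool" where "R3 = (\<lambda>(iv', rv', h'). R2 (iv', rv', h') \<and> iv' 5 = g + 4 * q)"
  define R4 :: "st \<Rightarrow> bool" where "R4 = (\<lambda>(iv', rv', h'). (\<forall>v\<le>3. iv' v = iv v) \<and> iv' 6 = iv 6 \<and>
     agree_off (g + 16 * q) (g + 24 * q) h h' \<and> split_step q ?r (\<lambda>i. h (g + i)) (\<lambda>i. h' (g + 16 * q + i)) \<and>
     split_step q ?r (\<lambda>i. h (g + 4 * q + i)) (\<lambda>i. h' (g + 20 * q + i)))"
  define R5 :: "st \<Rightarrow> bool" where "R5 = (\<lambda>(iv', rv', h'). (\<forall>v\<le>3. iv' v = iv v) \<and> iv' 6 = iv 6 \<and>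
     agree_off (g + 16 * q) (g + 26 * q) h h' \<and> level_ok q h' g)"
  have "wp forward_body
     (1 + ((2 * q + 2) + (1 + ((2 * q + 2) + ((2 * q + 2) + 1)))))
     (\<lambda>(iv', rv', h'). (\<forall>v\<le>2. iv' v = iv v) \<and> iv' 3 = g + 16 * q \<and> iv' 6 = 2 * iv 6 \<and>
        (\<forall>a<g + 16 * q. h' a = h a) \<and> level_ok q h' g) (iv, rv, h)"
    unfolding forward_body_def
  proof (intro wp_Seq)
    show "wp (Do [NAss 5 nG]) 1 R1 (iv, rv, h)" by (rule wp_Do) (simp_all add: R1_def iv)
    show "wp split_loop (2 * q + 2) R2 s" if "R1 s" for s
    proof -
      obtain rv' where s: "s = (iv(5 := g), rv', h)" using \<open>R1 s\<close> by (cases s) (auto simp: R1_def)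
      show ?thesis unfolding s
        by (rule wp_weaken[OF split_loop_correct[where q = q and g = g and S = g]]) (use iv g al in \<open>auto simp: R2_def\<close>)
    qed
    show "wp (Do [NAss 5 (nG +\<^sub>n NC 4 *\<^sub>n nQ)]) 1 R3 s" if "R2 s" for s
      using that by (cases s, intro wp_Do) (simp_all add: R2_def R3_def iv)
    show "wp split_loop (2 * q + 2) R4 s" if "R3 s" for s
    proof -
      obtain iv1 rv1 h1 where s: "s = (iv1, rv1, h1)" by (cases s)
      have iv1: "\<And>v. v \<le> 3 \<Longrightarrow> iv1 v = iv v" "iv1 6 = iv 6" "iv1 5 = g + 4 * q"
        and h1: "agree_off (g + 16 * q) (g + 20 * q) h h1"
          "split_step q ?r (\<lambda>i. h (g + i)) (\<lambda>i. h1 (g + 16 * q + i))"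
        using \<open>R3 s\<close> by (auto simp: R3_def R2_def s)
      have al1: "h1 (g + 8 * q + j) = h (g + 8 * q + j)" if "j < q" for j
        using that by (intro agree_offD[OF h1(1)]) simp
      show ?thesis unfolding s
      proof (rule wp_weaken[OF split_loop_correct[where q = q and g = g and S = "g + 4 * q"]], goal_cases)
        case (7 s')
        obtain iv2 rv2 h2 where s': "s' = (iv2, rv2, h2)" by (cases s')
        have iv2: "iv2 = iv1(4 := q)" and h2: "agree_off (g + 4 * q + 16 * q) (g + 4 * q + 20 * q) h1 h2"
          "split_step q (\<lambda>j. sqrt (2 + h1 (g + 8 * q + j))) (\<lambda>i. h1 (g + 4 * q + i)) (\<lambda>i. h2 (g + 4 * q + 16 * q + i))"
          using 7 by (auto simp: s')
        have "agree_off (g + 16 * q) (g + 24 * q) h h2"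
          using agree_off_trans[OF h1(1) h2(1), of "g + 16 * q" "g + 24 * q"] by simp
        moreover have "split_step q ?r (\<lambda>i. h (g + i)) (\<lambda>i. h2 (g + 16 * q + i))"
          by (rule split_step_cong[OF h1(2)]) (auto intro!: agree_offD[OF h2(1), symmetric])
        moreover have "split_step q ?r (\<lambda>i. h (g + 4 * q + i)) (\<lambda>i. h2 (g + 20 * q + i))"
          by (rule split_step_cong[OF h2(2)]) (auto simp: al1 add.assoc intro!: agree_offD[OF h1(1)])
        ultimately show ?case using iv1 by (simp add: R4_def s' iv2)
      qed (use iv iv1 g al al1 in simp_all)
    qed
    show "wp param_loop (2 * q + 2) R5 s" if "R4 s" for s
    proof -
      obtain iv1 rv1 h1 where s: "s = (iv1, rv1, h1)" by (cases s)
      have iv1: "\<And>v. v \<le> 3 \<Longrightarrow> iv1 v = iv v" "iv1 6 = iv 6"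
        and h1: "agree_off (g + 16 * q) (g + 24 * q) h h1"
          "split_step q ?r (\<lambda>i. h (g + i)) (\<lambda>i. h1 (g + 16 * q + i))"
          "split_step q ?r (\<lambda>i. h (g + 4 * q + i)) (\<lambda>i. h1 (g + 20 * q + i))"
        using \<open>R4 s\<close> by (auto simp: R4_def s)
      have al1: "h1 (g + 8 * q + j) = h (g + 8 * q + j)" if "j < q" for j
        using that by (intro agree_offD[OF h1(1)]) simp
      show ?thesis unfolding s
      proof (rule wp_weaken[OF param_loop_correct[where q = q and g = g]], goal_cases)
        case (5 s')
        obtain iv2 rv2 h2 where s': "s' = (iv2, rv2, h2)" by (cases s')
        have iv2: "iv2 = iv1(4 := q)" and h2: "agree_off (g + 24 * q) (g + 26 * q) h1 h2"
          "params_step q (\<lambda>i. h1 (g + 8 * q + i)) (\<lambda>i. h2 (g + 24 * q + i))"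
          using 5 by (auto simp: s')
        have agree: "agree_off (g + 16 * q) (g + 26 * q) h h2"
          using agree_off_trans[OF h1(1) h2(1), of "g + 16 * q" "g + 26 * q"] by simp
        have lo: "h2 (g + i) = h (g + i)" "h2 (g + 4 * q + i) = h (g + 4 * q + i)"
           "h2 (g + 8 * q + i) = h (g + 8 * q + i)" if "i < 4 * q" for i
          using that by (auto intro!: agree_offD[OF agree])
        have hi: "h2 (g + 16 * q + i) = h1 (g + 16 * q + i)" "h2 (g + 20 * q + i) = h1 (g + 20 * q + i)" if "i < 4 * q" for i
          using that by (auto intro!: agree_offD[OF h2(1)])
        have "level_ok q h2 g"
          unfolding level_ok_def
        proof (intro conjI)
          show "params_step q (\<lambda>i. h2 (g + 8 * q + i)) (\<lambda>i. h2 (g + 24 * q + i))"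
            using h2(2) unfolding params_step_def by (simp add: lo al1)
        qed (rule split_step_cong[OF h1(2)] split_step_cong[OF h1(3)], simp_all add: lo hi)+
        then show ?case using agree iv1 by (simp add: R5_def s' iv2)
      qed (use iv iv1 g al al1 in simp_all)
    qed
    show "wp (Do [NAss 3 (nG +\<^sub>n NC 16 *\<^sub>n nQ), NAss 6 (nB +\<^sub>n nB)]) 1
       (\<lambda>(iv', rv', h'). (\<forall>v\<le>2. iv' v = iv v) \<and> iv' 3 = g + 16 * q \<and> iv' 6 = 2 * iv 6 \<and>
        (\<forall>a<g + 16 * q. h' a = h a) \<and> level_ok q h' g) s" if "R5 s" for s
      using that by (cases s, intro wp_Do) (auto simp: R5_def iv agree_off_def)
  qed
  then show ?thesis by (rule wp_weaken) auto
qed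

lemma forward_loop_correct:
  assumes iv: "iv 0 = n" "iv 2 = q" and n: "n \<ge> 1" and q: "q = 2 ^ K"
    and al: "\<And>j. j < 2 * q \<Longrightarrow> h (128 * n + 8 * q + j) = 0"
  shows "wp forward_loop (Suc K * (6 * q + 10) + 2) (\<lambda>(iv', rv', h'). (\<forall>v\<le>2. iv' v = iv v) \<and>
     iv' 3 = 128 * n + 16 * q * Suc K \<and> (\<forall>a<128 * n + 16 * q. h' a = h a) \<and>
     (\<forall>l<Suc K. level_ok q h' (128 * n + 16 * q * l)) \<and>
     (\<forall>l\<le>Suc K. params_ok (2 ^ l) (2 ^ (Suc K - l)) (\<lambda>i. h' (128 * n + 16 * q * l + 8 * q + i)))) (iv, rv, h)"
proof -
  define g where "g l = 128 * n + 16 * q * l" for l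
  define I :: "nat \<Rightarrow> st \<Rightarrow> bool" where "I k = (\<lambda>(iv', rv', h'). (\<forall>v\<le>2. iv' v = iv v) \<and> iv' 6 = 2 ^ k \<and>
     iv' 3 = g k \<and> (\<forall>a<128 * n + 16 * q. h' a = h a) \<and>
     (\<forall>l<k. level_ok q h' (g l)) \<and>
     (\<forall>l\<le>k. params_ok (2 ^ l) (2 ^ (Suc K - l)) (\<lambda>i. h' (g l + 8 * q + i))))" for k
  have params_cong: "params_ok B k f'" if "params_ok B k f" "\<And>i. i < k * B \<Longrightarrow> f' i = f i" for B k f f'
    unfolding params_ok_def
  proof (intro allI impI)
    fix b i assume "b < B" "i < k"
    then have "i * B + b < k * B" "b < k * B" using index_less[of i k b B] index_less[of 0 k b B] by auto
    then show "\<bar>f' (i * B + b)\<bar> < 2 \<and> f' (i * B + b) = f' b"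
      using that \<open>b < B\<close> \<open>i < k\<close> unfolding params_ok_def by metis
  qed
  have "wp forward_loop ((Suc K - 0) * Suc (6 * q + 9) + 2) (I (Suc K)) (iv, rv, h)"
    unfolding forward_loop_def
  proof (rule wp_loop, goal_cases)
    case 2
    \<comment> \<open>The cleared parameter slot means \<open>a = 0\<close> at the root: the modulus
      is \<open>t^4q + 1\<close>.\<close>
    have "params_ok 1 (2 * q) (\<lambda>i. h (128 * n + 8 * q + i))"
      using al al[of 0] q unfolding params_ok_def by simp
    then show ?case by (simp add: I_def g_def iv q mult.commute)
  next
    case (4 k iv' rv' h')
    then have iv': "\<And>v. v \<le> 2 \<Longrightarrow> iv' v = iv v" "iv' 6 = 2 ^ k" "iv' 3 = g k"
      and h': "\<And>a. a < 128 * n + 16 * q \<Longrightarrow> h' a = h a" "\<And>l. l < k \<Longrightarrow> level_ok q h' (g l)"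
        "\<And>l. l \<le> k \<Longrightarrow> params_ok (2 ^ l) (2 ^ (Suc K - l)) (\<lambda>i. h' (g l + 8 * q + i))"
      by (auto simp: I_def)
    \<comment> \<open>With \<open>B = 2 ^ k\<close> and \<open>h = 2 ^ (K - k)\<close> the product
      \<open>h * B\<close> is \<open>q\<close> at every level, so the loop bounds never
      change.\<close>
    have k: "2 * 2 ^ (K - k) = (2::nat) ^ (Suc K - k)" "2 ^ (K - k) * 2 ^ k = q"
      using 4(2) by (simp_all add: q Suc_diff_le flip: power_add)
    have ok: "params_ok (2 ^ k) (2 * 2 ^ (K - k)) (\<lambda>i. h' (g k + 8 * q + i))"
      using h'(3)[of k] by (simp only: k order_refl)
    have bound: "\<bar>h' (g k + 8 * q + j)\<bar> < 2" if "j < 2 * q" for j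
      using params_ok_bounds[OF ok, of j] that k(2) by simp
    have "wp forward_body (6 * q + 9) (I (Suc k)) (iv', rv', h')"
    proof (rule wp_weaken[OF forward_body_correct[where q = q and g = "g k"]], goal_cases)
      case (4 j)
      then show ?case using bound[of j] by simp
    next
      case (5 s)
      obtain iv2 rv2 h2 where s: "s = (iv2, rv2, h2)" by (cases s)
      have iv2: "\<And>v. v \<le> 2 \<Longrightarrow> iv2 v = iv' v" "iv2 3 = g k + 16 * q" "iv2 6 = 2 * iv' 6"
        and h2: "\<And>a. a < g k + 16 * q \<Longrightarrow> h2 a = h' a" "level_ok q h2 (g k)"
        using 5 by (auto simp: s)
      have le: "g l \<le> g k" if "l \<le> k" for l using that by (simp add: g_def)
      have less: "g l + 16 * q \<le> g k" if "l < k" for l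
      proof -
        have "16 * q * Suc l \<le> 16 * q * k" using that by (intro mult_left_mono) auto
        then show ?thesis by (simp add: g_def)
      qed
      have "level_ok q h2 (g l)" if "l < Suc k" for l
      proof (cases "l = k")
        case False
        with that have "l < k" by simp
        with h'(2) show ?thesis using less[of l] by (subst level_ok_cong[where h = h']) (auto intro!: h2(1))
      qed (simp add: h2(2))
      moreover have "params_ok (2 ^ l) (2 ^ (Suc K - l)) (\<lambda>i. h2 (g l + 8 * q + i))" if "l \<le> Suc k" for l
      proof (cases "l \<le> k")
        case True
        then have "2 ^ (Suc K - l) * 2 ^ l = 2 * q" using \<open>k < Suc K\<close> by (simp add: q flip: power_add power_Suc)
        with True show ?thesis using le[of l]
          by (intro params_cong[OF h'(3)]) (auto intro!: h2(1))
      next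
        case False
        with that have l: "l = Suc k" by simp
        have "params_step q (\<lambda>i. h' (g k + 8 * q + i)) (\<lambda>i. h2 (g k + 24 * q + i))"
          using h2(2) unfolding level_ok_def params_step_def by (simp add: h2(1))
        then have "params_ok (2 * 2 ^ k) (2 ^ (K - k)) (\<lambda>i. h2 (g k + 24 * q + i))"
          using params_ok_step[OF ok] by (simp only: k(2))
        then show ?thesis by (simp add: l g_def algebra_simps)
      qed
      moreover have "128 * n + 16 * q \<le> g k + 16 * q" by (simp add: g_def)
      ultimately show ?case using iv2 iv' h2(1) h'(1) by (simp add: I_def s g_def)
    qed (use iv' iv n in \<open>simp_all add: g_def\<close>)
    then show ?case using 4(2) by (simp add: iv' iv q)
  next
    case (5 iv' rv' h')
    then show ?case by (simp add: I_def iv q)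
  qed simp_all
  then show ?thesis
  proof (rule wp_weaken)
    fix s assume "I (Suc K) s"
    then show "case s of (iv', rv', h') \<Rightarrow> (\<forall>v\<le>2. iv' v = iv v) \<and>
     iv' 3 = 128 * n + 16 * q * Suc K \<and> (\<forall>a<128 * n + 16 * q. h' a = h a) \<and>
     (\<forall>l<Suc K. level_ok q h' (128 * n + 16 * q * l)) \<and>
     (\<forall>l\<le>Suc K. params_ok (2 ^ l) (2 ^ (Suc K - l)) (\<lambda>i. h' (128 * n + 16 * q * l + 8 * q + i)))"
      unfolding I_def g_def by (cases s) blast
  qed simp
qed

definition backward_loop :: com where
  "backward_loop = leaf_loop ;;
     While (NC 128 *\<^sub>n nN +\<^sub>n NC 1) nG (Do [NAss 3 (nG -\<^sub>n NC 16 *\<^sub>n nQ)] ;; merge_loop)"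

lemma backward_loop_correct:
  assumes iv: "iv 0 = n" "iv 2 = q" "iv 3 = 128 * n + 16 * q * Suc K" and n: "n \<ge> 1" and q: "q = 2 ^ K"
    and level: "\<And>l. l < Suc K \<Longrightarrow> level_ok q h (128 * n + 16 * q * l)"
    and params: "\<And>l. l \<le> Suc K \<Longrightarrow>
      params_ok (2 ^ l) (2 ^ (Suc K - l)) (\<lambda>i. h (128 * n + 16 * q * l + 8 * q + i))"
  shows "wp backward_loop (4 * q + 3 + Suc K * (2 * q + 4)) (\<lambda>(iv', rv', h'). (\<forall>v\<le>2. iv' v = iv v) \<and>
     iv' 3 = 128 * n \<and> (\<forall>a<128 * n + 12 * q. h' a = h a) \<and>
     product_ok 1 (2 * q) (\<lambda>i. h (128 * n + 8 * q + i)) (\<lambda>i. h (128 * n + i)) (\<lambda>i. h (128 * n + 4 * q + i))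
       (\<lambda>i. h' (128 * n + 12 * q + i))) (iv, rv, h)"
proof -
  define g where "g l = 128 * n + 16 * q * l" for l
  define ok where "ok l h' \<longleftrightarrow> product_ok (2 ^ l) (2 ^ (Suc K - l)) (\<lambda>i. h (g l + 8 * q + i))
    (\<lambda>i. h (g l + i)) (\<lambda>i. h (g l + 4 * q + i)) (\<lambda>i. h' (g l + 12 * q + i))" for l h'
  \<comment> \<open>After \<open>k\<close> rounds level \<open>Suc K - k\<close> carries its
    finished product. Memory below that product slot is unchanged, so \<open>level_ok\<close> and
    the parameters can be quoted for the original heap \<open>h\<close>.\<close>
  define I :: "nat \<Rightarrow> st \<Rightarrow> bool" where "I k = (\<lambda>(iv', rv', h'). (\<forall>v\<le>2. iv' v = iv v) \<and>
     iv' 3 = g (Suc K - k) \<and> (\<forall>a<g (Suc K - k) + 12 * q. h' a = h a) \<and> ok (Suc K - k) h')" for k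
  have "wp backward_loop ((4 * q + 2) + ((Suc K - 0) * Suc (1 + (2 * q + 2)) + 1)) (I (Suc K)) (iv, rv, h)"
    unfolding backward_loop_def
  proof (rule wp_Seq)
    show "wp leaf_loop (4 * q + 2) (I 0) (iv, rv, h)"
    proof (rule wp_weaken[OF leaf_loop_correct[where q = q and g = "g (Suc K)"]], goal_cases)
      case (4 s)
      obtain iv2 rv2 h2 where s: "s = (iv2, rv2, h2)" by (cases s)
      have iv2: "iv2 = iv(4 := 2 * q)" and h2: "agree_off (g (Suc K) + 12 * q) (g (Suc K) + 16 * q) h h2"
        "leaf_product (2 * q) (\<lambda>i. h (g (Suc K) + 8 * q + i)) (\<lambda>i. h (g (Suc K) + i))
          (\<lambda>i. h (g (Suc K) + 4 * q + i)) (\<lambda>i. h2 (g (Suc K) + 12 * q + i))"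
        using 4 by (auto simp: s)
      have "ok (Suc K) h2" using leaf_product_ok[OF h2(2)] by (simp add: ok_def q)
      then show ?case using h2(1) iv by (auto simp: I_def s iv2 agree_off_def g_def)
    qed (use iv n in \<open>simp_all add: g_def\<close>)
    show "wp (While (NC 128 *\<^sub>n nN +\<^sub>n NC 1) nG (Do [NAss 3 (nG -\<^sub>n NC 16 *\<^sub>n nQ)] ;; merge_loop))
      ((Suc K - 0) * Suc (1 + (2 * q + 2)) + 1) (I (Suc K)) s" if "I 0 s" for s
    proof (rule wp_While[of I 0, OF that], goal_cases)
      case (2 k iv' rv' h')
      define l where "l = K - k"
      have l: "Suc K - k = Suc l" "Suc K - Suc k = l" "l < Suc K" using 2(2) by (auto simp: l_def)
      have gl: "g (Suc l) = g l + 16 * q" by (simp add: g_def)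
      have iv': "\<And>v. v \<le> 2 \<Longrightarrow> iv' v = iv v" "iv' 3 = g l + 16 * q"
        and h': "\<And>a. a < g l + 28 * q \<Longrightarrow> h' a = h a" "ok (Suc l) h'"
        using 2(3) by (auto simp: I_def l gl)
      have p: "2 * 2 ^ (K - l) = (2::nat) ^ (Suc K - l)" "2 ^ (K - l) * 2 ^ l = q"
        using l(3) by (simp_all add: q Suc_diff_le flip: power_add)
      have pok: "params_ok (2 ^ l) (2 * 2 ^ (K - l)) (\<lambda>i. h (g l + 8 * q + i))"
        using params[of l] l(3) by (simp add: p g_def)
      have bound: "\<bar>h (g l + 8 * q + j)\<bar> < 2" if "j < 2 * q" for j
        using params_ok_bounds[OF pok, of j] that p(2) by simp
      have "wp (Do [NAss 3 (nG -\<^sub>n NC 16 *\<^sub>n nQ)] ;; merge_loop) (1 + (2 * q + 2)) (I (Suc k)) (iv', rv', h')"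
      proof (rule wp_Seq)
        show "wp (Do [NAss 3 (nG -\<^sub>n NC 16 *\<^sub>n nQ)]) 1 (\<lambda>(iv2, rv2, h2). iv2 = iv'(3 := g l) \<and> h2 = h') (iv', rv', h')"
          by (rule wp_Do) (simp_all add: iv' iv)
        show "wp merge_loop (2 * q + 2) (I (Suc k)) s"
          if *: "case s of (iv2, rv2, h2) \<Rightarrow> iv2 = iv'(3 := g l) \<and> h2 = h'" for s
        proof -
          obtain rv2 where s: "s = (iv'(3 := g l), rv2, h')" using * by (cases s) auto
          show ?thesis unfolding s
          proof (rule wp_weaken[OF merge_loop_correct[where q = q and g = "g l"]], goal_cases)
            case (4 j)
            then show ?case using bound[of j] h'(1)[of "g l + 8 * q + j"] by simp
          next
            case (5 s2)
            obtain iv3 rv3 h3 where s2: "s2 = (iv3, rv3, h3)" by (cases s2)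
            have iv3: "iv3 = iv'(3 := g l, 4 := q)" and h3: "agree_off (g l + 12 * q) (g l + 16 * q) h' h3"
              "merge_step q (\<lambda>j. sqrt (2 + h' (g l + 8 * q + j))) (\<lambda>i. h' (g l + 28 * q + i)) (\<lambda>i. h3 (g l + 12 * q + i))"
              using 5 by (auto simp: s2)
            have "merge_step q (\<lambda>j. sqrt (2 + h (g l + 8 * q + j))) (\<lambda>i. h' (g l + 28 * q + i)) (\<lambda>i. h3 (g l + 12 * q + i))"
              using h3(2) unfolding merge_step_def by (simp add: h'(1))
            \<comment> \<open>Merging inverts the split because \<open>r\<close> is nonzero, which
              follows from the strict parameter bound.\<close>
            then have e: "split_step q (\<lambda>j. sqrt (2 + h (g l + 8 * q + j))) (\<lambda>i. h3 (g l + 12 * q + i)) (\<lambda>i. h' (g l + 28 * q + i))"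
            proof (rule split_step_of_merge_step)
              show "sqrt (2 + h (g l + 8 * q + j)) \<noteq> 0" if "j < q" for j using bound[of j] that by auto
            qed
            have lev: "level_ok q h (g l)" using level[OF l(3)] by (simp add: g_def)
            have "product_ok (2 ^ l) (2 * 2 ^ (K - l)) (\<lambda>i. h (g l + 8 * q + i))
               (\<lambda>i. h (g l + i)) (\<lambda>i. h (g l + 4 * q + i)) (\<lambda>i. h3 (g l + 12 * q + i))"
            proof (rule product_ok_step[OF _ pok])
              show "product_ok (2 * 2 ^ l) (2 ^ (K - l)) (\<lambda>i. h (g l + 24 * q + i)) (\<lambda>i. h (g l + 16 * q + i))
                 (\<lambda>i. h (g l + 20 * q + i)) (\<lambda>i. h' (g l + 28 * q + i))"
                using h'(2) unfolding ok_def gl by (simp add: add.assoc add.left_commute)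
            qed (use e lev in \<open>simp_all add: p level_ok_def\<close>)
            then have "ok l h3" by (simp add: ok_def p)
            then show ?case using h3(1) h'(1) iv' by (auto simp: I_def s2 iv3 agree_off_def simp flip: l_def)
          qed (use iv' iv n in \<open>simp_all add: g_def\<close>)
        qed
      qed
      moreover have "0 < q" using q by simp
      then have "128 * n + 1 \<le> iv' 3" unfolding iv'(2) g_def by simp
      ultimately show ?case using iv' iv by simp
    next
      case (3 iv' rv' h')
      then show ?case by (simp add: I_def iv g_def)
    qed simp
  qed
  then show ?thesis
  proof (rule wp_weaken)
    fix s assume "I (Suc K) s"
    then show "case s of (iv', rv', h') \<Rightarrow> (\<forall>v\<le>2. iv' v = iv v) \<and>
     iv' 3 = 128 * n \<and> (\<forall>a<128 * n + 12 * q. h' a = h a) \<and>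
     product_ok 1 (2 * q) (\<lambda>i. h (128 * n + 8 * q + i)) (\<lambda>i. h (128 * n + i)) (\<lambda>i. h (128 * n + 4 * q + i))
       (\<lambda>i. h' (128 * n + 12 * q + i))"
      by (cases s) (simp add: I_def g_def ok_def q)
  qed (simp add: algebra_simps)
qed

section \<open>Preparing the operands of the transform\<close>

text \<open>The prologue has placed the first 63 cells of the copy, so the counter starts at 63; the
  sources, from cell 64 on, are still intact.\<close>

definition copy_loop :: com where
  "copy_loop =
     Do [NAss 1 (NC 64 *\<^sub>n nN), NAss 4 (NC 63)] ;;
     While (nJ +\<^sub>n NC 1) (nN +\<^sub>n nN) (Do [
       HAss (nA +\<^sub>n nJ) (Hp (nJ +\<^sub>n NC 1)),
       NAss 4 (nJ +\<^sub>n NC 1)])"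

lemma copy_loop_correct:
  assumes iv: "iv 0 = n" and n: "n \<ge> 1"
  shows "wp copy_loop (4 * n + 2) (\<lambda>(iv', rv', h'). iv' 0 = n \<and> iv' 1 = 64 * n \<and>
     (\<forall>i<2 * n. h' (64 * n + i) = inp (i + 1))) (iv, rv, start_heap n inp)"
proof -
  define I :: "nat \<Rightarrow> st \<Rightarrow> bool" where "I k = (\<lambda>(iv', rv', h'). iv' 0 = n \<and> iv' 1 = 64 * n \<and> iv' 4 = k \<and>
     (\<forall>i<k. h' (64 * n + i) = inp (i + 1)) \<and> (\<forall>a<64 * n. h' a = inp a))" for k
  \<comment> \<open>For \<open>2 * n \<le> 63\<close> the body never runs, hence the
    maximum.\<close>
  have "wp copy_loop ((max 63 (2 * n) - 63) * Suc 1 + 2) (I (max 63 (2 * n))) (iv, rv, start_heap n inp)"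
    unfolding copy_loop_def
  proof (rule wp_loop, goal_cases)
    case (4 k iv' rv' h')
    then show ?case using n
      unfolding I_def by (intro conjI wp_Do) (simp_all add: less_Suc_eq)
  qed (use n in \<open>simp_all add: I_def iv start_heap_def\<close>)
  then show ?thesis
    by (rule wp_weaken) (auto simp: I_def)
qed

text \<open>The factors have degree below \<open>n\<close> and \<open>2 n\<close>, so \<open>3 n \<le> 4 q\<close> rules out wrap-around.\<close>

definition size_loop :: com where
  "size_loop =
     Do [NAss 2 (NC 1)] ;;
     While (NC 4 *\<^sub>n nQ +\<^sub>n NC 1) (NC 3 *\<^sub>n nN) (Do [NAss 2 (nQ +\<^sub>n nQ)])"

lemma size_loop_correct:
  assumes iv: "iv 0 = n" and K: "\<And>k. k < K \<Longrightarrow> 4 * 2 ^ k < 3 * n" "3 * n \<le> 4 * 2 ^ K"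
  shows "wp size_loop (2 * K + 2) (\<lambda>(iv', rv', h'). iv' = iv(2 := 2 ^ K) \<and> h' = h) (iv, rv, h)"
proof -
  define I :: "nat \<Rightarrow> st \<Rightarrow> bool" where "I k = (\<lambda>(iv', rv', h'). iv' = iv(2 := 2 ^ k) \<and> h' = h)" for k
  have "wp size_loop ((K - 0) * Suc 1 + 2) (I K) (iv, rv, h)"
    unfolding size_loop_def
  proof (rule wp_loop, goal_cases)
    case (4 k iv' rv' h')
    then show ?case using K(1)[of k]
      unfolding I_def by (intro conjI wp_Do) (simp_all add: iv flip: mult_2)
  qed (use K(2) in \<open>simp_all add: I_def iv\<close>)
  then show ?thesis by (rule wp_weaken) (auto simp: I_def)
qed

text \<open>Zeros pad both polynomials and, in the third slot, supply the parameter of the root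
  modulus.\<close>

definition clear_loop :: com where
  "clear_loop =
     Do [NAss 3 (NC 128 *\<^sub>n nN), NAss 4 (NC 0)] ;;
     While (nJ +\<^sub>n NC 1) (NC 12 *\<^sub>n nQ) (Do [
       HAss (nG +\<^sub>n nJ) (RC 0),
       NAss 4 (nJ +\<^sub>n NC 1)])"

lemma clear_loop_correct:
  assumes iv: "iv 0 = n" "iv 2 = q" and n: "n \<ge> 1"
  shows "wp clear_loop (24 * q + 2) (\<lambda>(iv', rv', h'). (\<forall>v\<le>2. iv' v = iv v) \<and> iv' 3 = 128 * n \<and>
     (\<forall>a<128 * n. h' a = h a) \<and> (\<forall>i<12 * q. h' (128 * n + i) = 0)) (iv, rv, h)"
proof -
  define I :: "nat \<Rightarrow> st \<Rightarrow> bool" where "I k = (\<lambda>(iv', rv', h'). (\<forall>v\<le>2. iv' v = iv v) \<and> iv' 3 = 128 * n \<and>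
     iv' 4 = k \<and> (\<forall>a<128 * n. h' a = h a) \<and> (\<forall>i<k. h' (128 * n + i) = 0))" for k
  have "wp clear_loop ((12 * q - 0) * Suc 1 + 2) (I (12 * q)) (iv, rv, h)"
    unfolding clear_loop_def
  proof (rule wp_loop, goal_cases)
    case (4 k iv' rv' h')
    then show ?case using n
      unfolding I_def by (intro conjI wp_Do) (simp_all add: iv less_Suc_eq)
  qed (simp_all add: I_def iv)
  then show ?thesis by (rule wp_weaken) (auto simp: I_def)
qed

text \<open>\<open>x\<close> is stored backwards, which turns correlation into convolution, and
  \<open>y\<close> over two periods, which covers every shift below \<open>n\<close>.\<close>

definition fill_body :: "assn list" where
  "fill_body = [
       HAss (nG +\<^sub>n (nN -\<^sub>n (nJ +\<^sub>n NC 1))) (Hp (nA +\<^sub>n nJ)),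
       RAss 7 (Hp (nA +\<^sub>n nN +\<^sub>n nJ)),
       HAss (nG +\<^sub>n NC 4 *\<^sub>n nQ +\<^sub>n nJ) (RV 7),
       HAss (nG +\<^sub>n NC 4 *\<^sub>n nQ +\<^sub>n nN +\<^sub>n nJ) (RV 7 +\<^sub>r RC 1),
       NAss 4 (nJ +\<^sub>n NC 1)]"

definition fill_loop :: com where
  "fill_loop =
     Do [NAss 4 (NC 0)] ;;
     While (nJ +\<^sub>n NC 1) nN (Do fill_body)"

lemma fill_loop_correct:
  assumes iv: "iv 0 = n" "iv 1 = 64 * n" "iv 2 = q" "iv 3 = 128 * n" and n: "n \<ge> 1" "3 * n \<le> 4 * q"
    and x: "\<And>i. i < n \<Longrightarrow> h (64 * n + i) = x i" and y: "\<And>i. i < n \<Longrightarrow> h (64 * n + n + i) = y i"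
    and zero: "\<And>i. i < 12 * q \<Longrightarrow> h (128 * n + i) = 0"
  shows "wp fill_loop (2 * n + 2) (\<lambda>(iv', rv', h'). (\<forall>v\<le>3. iv' v = iv v) \<and> (\<forall>a<128 * n. h' a = h a) \<and>
     (\<forall>i<4 * q. h' (128 * n + i) = (if i < n then x (n - Suc i) else 0)) \<and>
     (\<forall>i<4 * q. h' (128 * n + 4 * q + i) = (if i < 2 * n then unroll2 n y i else 0)) \<and>
     (\<forall>i<4 * q. h' (128 * n + 8 * q + i) = 0)) (iv, rv, h)"
proof -
  define I :: "nat \<Rightarrow> st \<Rightarrow> bool" where "I k = (\<lambda>(iv', rv', h'). (\<forall>v\<le>3. iv' v = iv v) \<and> iv' 4 = k \<and>
     (\<forall>a<128 * n. h' a = h a) \<and>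
     (\<forall>i<4 * q. h' (128 * n + i) = (if i < n \<and> n \<le> i + k then x (n - Suc i) else 0)) \<and>
     (\<forall>i<4 * q. h' (128 * n + 4 * q + i) =
        (if i < k then y i else if n \<le> i \<and> i < n + k then y (i - n) + 1 else 0)) \<and>
     (\<forall>i<4 * q. h' (128 * n + 8 * q + i) = 0))" for k
  have "wp fill_loop ((n - 0) * Suc 1 + 2) (I n) (iv, rv, h)"
    unfolding fill_loop_def
  proof (rule wp_loop, goal_cases)
    case (4 k iv' rv' h')
    then have r: "h' (64 * n + k) = x k" "h' (64 * n + n + k) = y k" using x[of k] y[of k] by (simp_all add: I_def)
    have I: "\<And>v. v \<le> 3 \<Longrightarrow> iv' v = iv v" "iv' 4 = k" "\<And>a. a < 128 * n \<Longrightarrow> h' a = h a"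
      "\<And>i. i < 4 * q \<Longrightarrow> h' (128 * n + i) = (if i < n \<and> n \<le> i + k then x (n - Suc i) else 0)"
      "\<And>i. i < 4 * q \<Longrightarrow> h' (128 * n + 4 * q + i) =
        (if i < k then y i else if n \<le> i \<and> i < n + k then y (i - n) + 1 else 0)"
      "\<And>i. i < 4 * q \<Longrightarrow> h' (128 * n + 8 * q + i) = 0"
      using 4(3) by (auto simp: I_def)
    \<comment> \<open>The heap after one round; \<open>3 * n \<le> 4 * q\<close> keeps the three
      writes within their own slots and distinct.\<close>
    define h2 where "h2 = h'(128 * n + (n - (k + 1)) := x k, 128 * n + 4 * q + k := y k,
       128 * n + 4 * q + n + k := y k + 1)"
    have k: "k < n" using 4(2) by simp
    have P: "h2 (128 * n + i) = (if i < n \<and> n \<le> i + Suc k then x (n - Suc i) else 0)" if i: "i < 4 * q" for i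
    proof (cases "i = n - (k + 1)")
      case True
      then have "n - Suc i = k" "i < n" "n \<le> i + Suc k" using k by auto
      moreover have "128 * n + (n - (k + 1)) \<noteq> 128 * n + 4 * q + k"
        "128 * n + (n - (k + 1)) \<noteq> 128 * n + 4 * q + n + k" using k n(2) by linarith+
      ultimately show ?thesis using True by (simp add: h2_def)
    next
      case False
      then have "n \<le> i + Suc k \<longleftrightarrow> n \<le> i + k" using k by auto
      moreover have "128 * n + i \<noteq> 128 * n + (n - (k + 1))" using False by simp
      then have "h2 (128 * n + i) = h' (128 * n + i)" using k n(2) i unfolding h2_def by simp
      ultimately show ?thesis using I(4)[OF i] by simp
    qed
    have Q: "h2 (128 * n + 4 * q + i) =
        (if i < Suc k then y i else if n \<le> i \<and> i < n + Suc k then y (i - n) + 1 else 0)" if i: "i < 4 * q" for i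
    proof -
      have "128 * n + 4 * q + i \<noteq> 128 * n + (n - (k + 1))" using k n(2) by linarith
      then have "h2 (128 * n + 4 * q + i) = (if i = n + k then y k + 1 else if i = k then y k else h' (128 * n + 4 * q + i))"
        using k n(2) by (simp add: h2_def add.assoc)
      then show ?thesis using k I(5)[OF i] by (simp add: less_Suc_eq)
    qed
    have Z: "h2 (128 * n + 8 * q + i) = 0" if i: "i < 4 * q" for i
      using k n(2) i I(6)[OF i] by (simp add: h2_def)
    have lo: "h2 a = h a" if "a < 128 * n" for a using that I(3)[OF that] by (simp add: h2_def)
    have iv': "iv' 0 = n" "iv' (Suc 0) = 64 * n" "iv' 2 = q" "iv' 3 = 128 * n" using I(1) iv by auto
    have ne: "64 * n + n + k \<noteq> 128 * n + (n - (k + 1))" using k by linarith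
    have run: "assigns fill_body (iv', rv', h') = (iv'(4 := Suc k), rv'(7 := y k), h2)"
      using ne r by (simp add: fill_body_def iv' I(2) h2_def)
    show ?case
    proof (intro conjI wp_Do)
      show "I (Suc k) (assigns fill_body (iv', rv', h'))"
        unfolding run by (simp add: I_def I(1) P Q Z lo)
    qed (use k n in \<open>simp_all add: fill_body_def iv' I(2)\<close>)
  qed (use n zero[of "_"] zero[of "4 * q + _"] zero[of "8 * q + _"] in \<open>simp_all add: I_def iv add.assoc\<close>)
  then show ?thesis
    by (rule wp_weaken) (auto simp: I_def unroll2_def)
qed

section \<open>Scanning all shifts\<close>

definition sum_loop :: com where
  "sum_loop =
     Do [NAss 4 (NC 0), RAss 3 (RC 0), RAss 4 (RC 0), RAss 5 (RC 0), RAss 6 (RC 0)] ;;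
     While (nJ +\<^sub>n NC 1) nN (Do [
       RAss 7 (Hp (nA +\<^sub>n nJ)),
       RAss 8 (Hp (nA +\<^sub>n nN +\<^sub>n nJ)),
       RAss 3 (RV 3 +\<^sub>r RV 7),
       RAss 4 (RV 4 +\<^sub>r RV 7 *\<^sub>r RV 7),
       RAss 5 (RV 5 +\<^sub>r RV 8),
       RAss 6 (RV 6 +\<^sub>r RV 8 *\<^sub>r RV 8),
       NAss 4 (nJ +\<^sub>n NC 1)])"

lemma sum_loop_correct:
  assumes iv: "iv 0 = n" "iv 1 = 64 * n" and n: "n \<ge> 1"
    and x: "\<And>i. i < n \<Longrightarrow> h (64 * n + i) = x i" and y: "\<And>i. i < n \<Longrightarrow> h (64 * n + n + i) = y i"
  shows "wp sum_loop (2 * n + 2) (\<lambda>(iv', rv', h'). (\<forall>v\<le>3. iv' v = iv v) \<and> h' = h \<and>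
     rv' 3 = (\<Sum>i<n. x i) \<and> rv' 4 = (\<Sum>i<n. (x i)\<^sup>2) \<and> rv' 5 = (\<Sum>i<n. y i) \<and> rv' 6 = (\<Sum>i<n. (y i)\<^sup>2))
     (iv, rv, h)"
proof -
  define I :: "nat \<Rightarrow> st \<Rightarrow> bool" where "I k = (\<lambda>(iv', rv', h'). (\<forall>v\<le>3. iv' v = iv v) \<and> iv' 4 = k \<and> h' = h \<and>
     rv' 3 = (\<Sum>i<k. x i) \<and> rv' 4 = (\<Sum>i<k. (x i)\<^sup>2) \<and> rv' 5 = (\<Sum>i<k. y i) \<and> rv' 6 = (\<Sum>i<k. (y i)\<^sup>2))" for k
  have "wp sum_loop ((n - 0) * Suc 1 + 2) (I n) (iv, rv, h)"
    unfolding sum_loop_def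
  proof (rule wp_loop, goal_cases)
    case (4 k iv' rv' h')
    then show ?case using n x[of k] y[of k]
      unfolding I_def by (intro conjI wp_Do) (simp_all add: iv iv(2)[unfolded One_nat_def] power2_eq_square)
  qed (simp_all add: I_def iv)
  then show ?thesis by (rule wp_weaken) (auto simp: I_def)
qed

text \<open>Real variable 8 is \<open>n\<close> times the optimal offset, real variable 7 the value
  of \<open>shift_opt\<close>. The correlation for shift \<open>s\<close> is the product coefficient
  \<open>n + s - 1\<close> because \<open>x\<close> was reversed.\<close>

definition score :: "assn list" where
  "score = [
     RAss 8 (RV 5 -\<^sub>r RV 3 +\<^sub>r RN nJ),
     RAss 7 (RV 4 +\<^sub>r RV 6 -\<^sub>r RC 2 *\<^sub>r Hp (nG +\<^sub>n NC 12 *\<^sub>n nQ +\<^sub>n (nN +\<^sub>n nJ -\<^sub>n NC 1))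
       -\<^sub>r RV 8 *\<^sub>r RV 8 /\<^sub>r RN nN)]"

definition save :: "assn list" where
  "save = [RAss 0 (RV 7), RAss 1 (RV 8 /\<^sub>r RN nN), RAss 2 (RN nJ)]"

text \<open>Moving the window replaces \<open>y s\<close> by \<open>y s + 1\<close>, so its sum of
  squares grows by \<open>2 * y s + 1\<close>; the counter still holds \<open>s\<close> at that
  moment.\<close>

definition advance :: "assn list" where
  "advance = [RAss 6 (RV 6 +\<^sub>r RC 2 *\<^sub>r Hp (nA +\<^sub>n nN +\<^sub>n nJ) +\<^sub>r RC 1), NAss 4 (nJ +\<^sub>n NC 1)] @ score"

text \<open>Shift 0 is scored before the loop; the constant 2 in the test lets a round start only if
  the next shift is still below \<open>n\<close>.\<close>

definition scan_loop :: com where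
  "scan_loop =
     Do (NAss 4 (NC 0) # score @ save) ;;
     While (nJ +\<^sub>n NC 2) nN (
       Do advance ;;
       If (RV 7) (RV 0) (Do save) (Do []))"

lemma scan_loop_correct:
  fixes E c W :: "nat \<Rightarrow> real"
  assumes iv: "iv 0 = n" "iv 1 = 64 * n" "iv 2 = q" "iv 3 = 128 * n" and n: "n \<ge> 1"
    and y: "\<And>i. i < n \<Longrightarrow> h (64 * n + n + i) = y i"
    and W: "rv 6 = W 0" "\<And>s. s < n \<Longrightarrow> W (Suc s) = W s + 2 * y s + 1"
    and c: "\<And>s. c s = (rv 5 - rv 3 + real s) / real n"
    and E: "\<And>s. s < n \<Longrightarrow> E s = rv 4 + W s - 2 * h (128 * n + 12 * q + (n + s - 1))
       - (rv 5 - rv 3 + real s) * (rv 5 - rv 3 + real s) / real n"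
  shows "wp scan_loop (4 * n + 2) (\<lambda>(iv', rv', h'). \<exists>s<n. rv' 2 = real s \<and> rv' 0 = E s \<and> rv' 1 = c s \<and>
     (\<forall>s'<n. E s \<le> E s')) (iv, rv, h)"
proof -
  define I :: "nat \<Rightarrow> st \<Rightarrow> bool" where "I k = (\<lambda>(iv', rv', h'). (\<forall>v\<le>3. iv' v = iv v) \<and> iv' 4 = k \<and> h' = h \<and>
     rv' 3 = rv 3 \<and> rv' 4 = rv 4 \<and> rv' 5 = rv 5 \<and> rv' 6 = W k \<and>
     (\<exists>s\<le>k. rv' 2 = real s \<and> rv' 0 = E s \<and> rv' 1 = c s \<and> (\<forall>s'\<le>k. E s \<le> E s')))" for k
  have "wp scan_loop ((n - 1 - 0) * Suc (1 + Suc 1) + 2) (I (n - 1)) (iv, rv, h)"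
    unfolding scan_loop_def
  proof (rule wp_loop, goal_cases)
    case 1
    then show ?case using n by (simp add: score_def save_def iv)
  next
    case 2
    then show ?case using n E[of 0] W(1) c[of 0] by (simp add: score_def save_def iv I_def)
  next
    case (4 k iv' rv' h')
    then have I: "\<And>v. v \<le> 3 \<Longrightarrow> iv' v = iv v" "iv' 4 = k" "h' = h" "rv' 3 = rv 3" "rv' 4 = rv 4" "rv' 5 = rv 5" "rv' 6 = W k"
      by (auto simp: I_def)
    from 4(3) obtain s where s: "s \<le> k" "rv' 2 = real s" "rv' 0 = E s" "rv' 1 = c s" "\<And>s'. s' \<le> k \<Longrightarrow> E s \<le> E s'"
      by (auto simp: I_def)
    have k: "Suc k < n" using 4(2) by simp
    define R :: "st \<Rightarrow> bool" where "R = (\<lambda>(iv2, rv2, h2). (\<forall>v\<le>3. iv2 v = iv v) \<and> iv2 4 = Suc k \<and> h2 = h \<and>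
       rv2 3 = rv 3 \<and> rv2 4 = rv 4 \<and> rv2 5 = rv 5 \<and> rv2 6 = W (Suc k) \<and>
       rv2 2 = real s \<and> rv2 0 = E s \<and> rv2 1 = c s \<and> rv2 7 = E (Suc k) \<and> rv2 8 / real n = c (Suc k))"
    have "wp (Do advance ;;
       If (RV 7) (RV 0) (Do save) (Do [])) (1 + Suc 1) (I (Suc k)) (iv', rv', h')"
    proof (rule wp_Seq)
      show "wp (Do advance) 1
         R (iv', rv', h')"
        using k n y[of k] I s(2-4) W(2)[of k] E[of "Suc k"] c[of "Suc k"]
        by (intro wp_Do) (simp_all add: advance_def score_def iv iv(2)[unfolded One_nat_def] R_def)
      fix s2 assume "R s2"
      then obtain iv2 rv2 where s2: "s2 = (iv2, rv2, h)" and R: "R (iv2, rv2, h)"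
        by (cases s2) (auto simp: R_def)
      show "wp (If (RV 7) (RV 0) (Do save) (Do [])) (Suc 1) (I (Suc k)) s2"
        unfolding s2
      proof (rule wp_If)
        assume "rval (iv2, rv2, h) (RV 7) \<le> rval (iv2, rv2, h) (RV 0)"
        then have "E (Suc k) \<le> E s" using R by (simp add: R_def)
        then have "\<forall>s'\<le>Suc k. E (Suc k) \<le> E s'" using s(5) by (auto simp: le_Suc_eq intro: order_trans)
        then show "wp (Do save) 1 (I (Suc k)) (iv2, rv2, h)"
          using R n by (intro wp_Do) (auto simp: save_def R_def I_def iv intro!: exI[of _ "Suc k"])
      next
        assume "\<not> rval (iv2, rv2, h) (RV 7) \<le> rval (iv2, rv2, h) (RV 0)"
        then have "E s \<le> E (Suc k)" using R by (simp add: R_def)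
        then have "\<forall>s'\<le>Suc k. E s \<le> E s'" using s(5) by (auto simp: le_Suc_eq)
        moreover have "s \<le> Suc k" using s(1) by simp
        ultimately show "wp (Do []) 1 (I (Suc k)) (iv2, rv2, h)"
          using R by (intro wp_Do) (auto simp: R_def I_def)
      qed simp_all
    qed
    then show ?case using k by (simp add: I iv)
  next
    case (5 iv' rv' h')
    then show ?case using n by (simp add: I_def iv)
  qed simp
  then show ?thesis
  proof (rule wp_weaken)
    fix s assume "I (n - 1) s"
    moreover have "i \<le> n - 1 \<longleftrightarrow> i < n" for i using n by auto
    ultimately show "case s of (iv', rv', h') \<Rightarrow> \<exists>s<n. rv' 2 = real s \<and> rv' 0 = E s \<and> rv' 1 = c s \<and> (\<forall>s'<n. E s \<le> E s')"
      by (cases s) (simp add: I_def)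
  qed (use n in simp)
qed

text \<open>The optimal offset is the difference of two means of numbers in \<open>[0, 1)\<close>,
  plus \<open>s / n\<close>. It lies strictly between -1 and 2, so two comparisons do the work of a
  floor.\<close>

definition normalize_offset :: com where
  "normalize_offset =
     If (RC 0) (RV 1) (Do []) (Do [RAss 1 (RV 1 +\<^sub>r RC 1)]) ;;
     If (RC 1) (RV 1) (Do [RAss 1 (RV 1 -\<^sub>r RC 1)]) (Do [])"

lemma normalize_offset_correct:
  assumes c: "- 1 < rv 1" "rv 1 < 2"
  shows "wp normalize_offset 4 (\<lambda>(iv', rv', h'). rv' = rv(1 := frac (rv 1))) (iv, rv, h)"
proof -
  define c where "c = (if 0 \<le> rv 1 then rv 1 else rv 1 + 1)"
  have c': "0 \<le> c" "c < 2" "frac c = frac (rv 1)"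
    using assms by (simp_all add: c_def frac_1_eq del: frac_eq)
  have f: "frac (rv 1) = (if 1 \<le> c then c - 1 else c)"
  proof (cases "1 \<le> c")
    case True
    then have "frac (c - 1) = c - 1" using c' by (simp add: frac_eq)
    then show ?thesis using True c'(3) by (metis frac_1_eq diff_add_cancel)
  next
    case False
    then show ?thesis using c' by (metis frac_eq not_le)
  qed
  have "wp normalize_offset (Suc 1 + Suc 1) (\<lambda>(iv', rv', h'). rv' = rv(1 := frac (rv 1))) (iv, rv, h)"
    unfolding normalize_offset_def
  proof (rule wp_Seq[where R = "\<lambda>(iv', rv', h'). rv' = rv(1 := c)"])
    show "wp (If (RC 0) (RV 1) (Do []) (Do [RAss 1 (RV 1 +\<^sub>r RC 1)])) (Suc 1) (\<lambda>(iv', rv', h'). rv' = rv(1 := c)) (iv, rv, h)"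
      by (intro wp_If wp_Do) (auto simp: c_def)
    fix s :: st assume "case s of (iv', rv', h') \<Rightarrow> rv' = rv(1 := c)"
    then obtain iv' h' where s: "s = (iv', rv(1 := c), h')" by (cases s) auto
    show "wp (If (RC 1) (RV 1) (Do [RAss 1 (RV 1 -\<^sub>r RC 1)]) (Do [])) (Suc 1) (\<lambda>(iv', rv', h'). rv' = rv(1 := frac (rv 1))) s"
      unfolding s f by (intro wp_If wp_Do) auto
  qed
  then show ?thesis by (rule wp_weaken) auto
qed

section \<open>From stored sums and coefficients to the optimum\<close>

text \<open>The window of \<open>n\<close> beads loses \<open>y s\<close> and gains the same bead
  one period later, \<open>y s + 1\<close>.\<close>

lemma sum_unroll2_shift:
  fixes f :: "real \<Rightarrow> real"
  assumes "s < n"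
  shows "(\<Sum>i<n. f (unroll2 n y (i + Suc s))) = (\<Sum>i<n. f (unroll2 n y (i + s))) + f (y s + 1) - f (y s)"
proof -
  have "(\<Sum>i<n. f (unroll2 n y (i + Suc s))) + f (unroll2 n y s) = (\<Sum>i<Suc n. f (unroll2 n y (i + s)))"
    by (subst sum.lessThan_Suc_shift) simp
  then show ?thesis using assms by (simp add: unroll2_def add.commute)
qed

lemma sum_unroll2:
  assumes "s \<le> n"
  shows "(\<Sum>i<n. unroll2 n y (i + s)) = (\<Sum>i<n. y i) + real s"
  using assms
proof (induction s)
  case (Suc s)
  then show ?case using sum_unroll2_shift[of s n "\<lambda>r. r" y] by simp
qed (simp add: unroll2_def)

text \<open>Substituting \<open>j = n - 1 - i\<close>, the second index \<open>n + s - 1 - i\<close>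
  becomes \<open>j + s\<close>; terms with \<open>i\<close> at least \<open>n\<close> vanish by the
  padding.\<close>

lemma convolution_eq_correlation:
  assumes n: "n \<ge> 1" "3 * n \<le> N" and s: "s < n"
    and P: "\<And>i. i < N \<Longrightarrow> P i = (if i < n then x (n - Suc i) else 0)"
    and Q: "\<And>i. i < N \<Longrightarrow> Q i = (if i < 2 * n then unroll2 n y i else 0)"
  shows "(\<Sum>i\<le>n + s - 1. P i * Q (n + s - 1 - i)) = (\<Sum>i<n. x i * unroll2 n y (i + s))"
proof -
  have "(\<Sum>i\<le>n + s - 1. P i * Q (n + s - 1 - i)) = (\<Sum>i<n. P i * Q (n + s - 1 - i))"
    using n s by (intro sum.mono_neutral_right) (auto simp: P)
  also have "\<dots> = (\<Sum>i<n. x (n - Suc i) * unroll2 n y (n - Suc i + s))"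
    using n s by (intro sum.cong) (auto simp: P Q)
  also have "\<dots> = (\<Sum>i<n. x i * unroll2 n y (i + s))"
    by (rule sum.nat_diff_reindex)
  finally show ?thesis .
qed

text \<open>The form that \<open>score\<close> evaluates: apart from the correlation, each
  ingredient is a fixed sum or updated in constant time per shift.\<close>

lemma shift_opt_expand:
  assumes "s < n"
  shows "shift_opt n x y s = (\<Sum>i<n. (x i)\<^sup>2) + (\<Sum>i<n. (unroll2 n y (i + s))\<^sup>2)
    - 2 * (\<Sum>i<n. x i * unroll2 n y (i + s))
    - ((\<Sum>i<n. y i) - (\<Sum>i<n. x i) + real s) * ((\<Sum>i<n. y i) - (\<Sum>i<n. x i) + real s) / real n"
proof -
  have "(\<Sum>i<n. x i - unroll2 n y (i + s)) = - ((\<Sum>i<n. y i) - (\<Sum>i<n. x i) + real s)"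
    using assms by (simp add: sum_subtractf sum_unroll2)
  moreover have "(\<Sum>i<n. (x i - unroll2 n y (i + s))\<^sup>2) = (\<Sum>i<n. (x i)\<^sup>2)
      + (\<Sum>i<n. (unroll2 n y (i + s))\<^sup>2) - 2 * (\<Sum>i<n. x i * unroll2 n y (i + s))"
    by (simp add: power2_diff sum.distrib sum_subtractf sum_distrib_left mult.assoc)
  ultimately show ?thesis by (simp only: shift_opt_def power2_minus) (simp only: power2_eq_square)
qed

definition program :: com where
  "program = copy_loop ;; size_loop ;; clear_loop ;; fill_loop ;; forward_loop ;; backward_loop ;;
     sum_loop ;; scan_loop ;; normalize_offset"

lemma program_correct:
  assumes n: "n \<ge> 1" and x: "valid_necklace n x" and y: "valid_necklace n y"
    and K: "\<And>k. k < K \<Longrightarrow> 4 * 2 ^ k < 3 * n" "3 * n \<le> 4 * 2 ^ K"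
    and T: "T = 12 * n + 2 * K + 28 * 2 ^ K + Suc K * (8 * 2 ^ K + 14) + 21"
  shows "wp program T (\<lambda>(iv, rv, h). \<exists>s<n. rv 2 = real s \<and> rv 0 = shift_opt n x y s \<and>
     rv 1 = frac (- (\<Sum>i<n. x i - unroll2 n y (i + s)) / real n) \<and>
     (\<forall>s'<n. shift_opt n x y s \<le> shift_opt n x y s'))
     ((\<lambda>_. 0)(0 := n), rv, start_heap n (neck_input n x y))"
proof -
  define q :: nat where "q = 2 ^ K"
  have q: "3 * n \<le> 4 * q" "0 < q" using K(2) by (auto simp: q_def)
  define input_ok where "input_ok = (\<lambda>h. \<forall>i<n. h (64 * n + i) = x i \<and> h (64 * n + n + i) = y i)"
  define R1 :: "st \<Rightarrow> bool" where "R1 = (\<lambda>(iv, rv, h). iv 0 = n \<and> iv 1 = 64 * n \<and> input_ok h)"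
  define R2 :: "st \<Rightarrow> bool" where "R2 = (\<lambda>(iv, rv, h). iv 0 = n \<and> iv 1 = 64 * n \<and> iv 2 = q \<and> input_ok h)"
  define R3 :: "st \<Rightarrow> bool" where "R3 = (\<lambda>(iv, rv, h). R2 (iv, rv, h) \<and> iv 3 = 128 * n \<and>
     (\<forall>i<12 * q. h (128 * n + i) = 0))"
  define filled where "filled = (\<lambda>h.
     (\<forall>i<4 * q. h (128 * n + i) = (if i < n then x (n - Suc i) else 0)) \<and>
     (\<forall>i<4 * q. h (128 * n + 4 * q + i) = (if i < 2 * n then unroll2 n y i else 0)) \<and>
     (\<forall>i<4 * q. h (128 * n + 8 * q + i) = (0::real)))"
  define R4 :: "st \<Rightarrow> bool" where "R4 = (\<lambda>(iv, rv, h). R2 (iv, rv, h) \<and> filled h)"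
  define R5 :: "st \<Rightarrow> bool" where "R5 = (\<lambda>(iv, rv, h). R4 (iv, rv, h) \<and> iv 3 = 128 * n + 16 * q * Suc K \<and>
     (\<forall>l<Suc K. level_ok q h (128 * n + 16 * q * l)) \<and>
     (\<forall>l\<le>Suc K. params_ok (2 ^ l) (2 ^ (Suc K - l)) (\<lambda>i. h (128 * n + 16 * q * l + 8 * q + i))))"
  define R6 :: "st \<Rightarrow> bool" where "R6 = (\<lambda>(iv, rv, h). R2 (iv, rv, h) \<and> iv 3 = 128 * n \<and>
     (\<forall>s<n. h (128 * n + 12 * q + (n + s - 1)) = (\<Sum>i<n. x i * unroll2 n y (i + s))))"
  define R7 :: "st \<Rightarrow> bool" where "R7 = (\<lambda>(iv, rv, h). R6 (iv, rv, h) \<and> rv 3 = (\<Sum>i<n. x i) \<and>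
     rv 4 = (\<Sum>i<n. (x i)\<^sup>2) \<and> rv 5 = (\<Sum>i<n. y i) \<and> rv 6 = (\<Sum>i<n. (y i)\<^sup>2))"
  define c where "c s = ((\<Sum>i<n. y i) - (\<Sum>i<n. x i) + real s) / real n" for s
  define R8 :: "st \<Rightarrow> bool" where "R8 = (\<lambda>(iv, rv, h). \<exists>s<n. rv 2 = real s \<and> rv 0 = shift_opt n x y s \<and>
     rv 1 = c s \<and> (\<forall>s'<n. shift_opt n x y s \<le> shift_opt n x y s'))"
  have c_eq: "- (\<Sum>i<n. x i - unroll2 n y (i + s)) / real n = c s" if "s < n" for s
    using that by (simp add: c_def sum_subtractf sum_unroll2)
  have c_bounds: "- 1 < c s \<and> c s < 2" if "s < n" for s
  proof -
    have "0 \<le> (\<Sum>i<n. z i) \<and> (\<Sum>i<n. z i) < real n" if "valid_necklace n z" for z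
    proof
      show "0 \<le> (\<Sum>i<n. z i)" using that unfolding valid_necklace_def by (intro sum_nonneg) auto
      have "(\<Sum>i<n. z i) < (\<Sum>i<n. 1)"
        using that n unfolding valid_necklace_def by (intro sum_strict_mono) (auto simp: lessThan_empty_iff)
      then show "(\<Sum>i<n. z i) < real n" by simp
    qed
    from this[OF x] this[OF y] show ?thesis using n that by (simp add: c_def field_simps)
  qed
  \<comment> \<open>One summand per phase of \<open>program\<close>; their total is
    \<open>T\<close>.\<close>
  have "wp program ((4 * n + 2) + ((2 * K + 2) + ((24 * q + 2) + ((2 * n + 2) + ((Suc K * (6 * q + 10) + 2)
     + ((4 * q + 3 + Suc K * (2 * q + 4)) + ((2 * n + 2) + ((4 * n + 2) + 4))))))))
     (\<lambda>(iv, rv, h). \<exists>s<n. rv 2 = real s \<and> rv 0 = shift_opt n x y s \<and>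
       rv 1 = frac (- (\<Sum>i<n. x i - unroll2 n y (i + s)) / real n) \<and>
       (\<forall>s'<n. shift_opt n x y s \<le> shift_opt n x y s'))
     ((\<lambda>_. 0)(0 := n), rv, start_heap n (neck_input n x y))"
    unfolding program_def
  proof (intro wp_Seq)
    show "wp copy_loop (4 * n + 2) R1 ((\<lambda>_. 0)(0 := n), rv, start_heap n (neck_input n x y))"
    proof (rule wp_weaken[OF copy_loop_correct[where n = n]], goal_cases)
      case (3 s)
      obtain iv' rv' h' where s: "s = (iv', rv', h')" by (cases s)
      have h': "h' (64 * n + i) = neck_input n x y (i + 1)" if "i < 2 * n" for i using 3 that by (simp add: s)
      have "input_ok h'"
        unfolding input_ok_def using h' h'[of "n + _"] by (auto simp: neck_input_def add.assoc)
      then show ?case using 3 by (simp add: s R1_def)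
    qed (use n in simp_all)
  next
    fix s assume "R1 s"
    then show "wp size_loop (2 * K + 2) R2 s"
    proof (cases s)
      case (fields iv rv h)
      with \<open>R1 s\<close> show ?thesis unfolding fields
        by (intro wp_weaken[OF size_loop_correct[OF _ K]]) (auto simp: R1_def R2_def q_def)
    qed
  next
    fix s assume "R2 s"
    then show "wp clear_loop (24 * q + 2) R3 s"
    proof (cases s)
      case (fields iv rv h)
      with \<open>R2 s\<close> n show ?thesis unfolding fields
        by (intro wp_weaken[OF clear_loop_correct[where n = n and q = q]]) (auto simp: R2_def R3_def input_ok_def)
    qed
  next
    fix s assume R3: "R3 s"
    obtain iv rv h where s: "s = (iv, rv, h)" by (cases s)
    show "wp fill_loop (2 * n + 2) R4 s"
      unfolding s
      by (rule wp_weaken[OF fill_loop_correct[where n = n and q = q and x = x and y = y]])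
        (use R3 n q in \<open>auto simp: s R2_def R3_def R4_def input_ok_def filled_def\<close>)
  next
    fix s assume R4: "R4 s"
    obtain iv rv h where s: "s = (iv, rv, h)" by (cases s)
    show "wp forward_loop (Suc K * (6 * q + 10) + 2) R5 s"
      unfolding s
    proof (rule wp_weaken[OF forward_loop_correct[where n = n and q = q and K = K]], goal_cases)
      case (6 s')
      obtain iv' rv' h' where s': "s' = (iv', rv', h')" by (cases s')
      have "h' a = h a" if "a < 128 * n + 16 * q" for a using 6 that by (simp add: s')
      then have "filled h'" "input_ok h'" using R4 by (simp_all add: s R4_def R2_def filled_def input_ok_def)
      then show ?case using 6 R4 by (simp add: s s' R4_def R2_def R5_def)
    qed (use R4 n q in \<open>auto simp: s R2_def R4_def filled_def q_def\<close>)
  next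
    fix s assume R5: "R5 s"
    obtain iv rv h where s: "s = (iv, rv, h)" by (cases s)
    show "wp backward_loop (4 * q + 3 + Suc K * (2 * q + 4)) R6 s"
      unfolding s
    proof (rule wp_weaken[OF backward_loop_correct[where n = n and q = q and K = K]], goal_cases)
      case (8 s')
      obtain iv' rv' h' where s': "s' = (iv', rv', h')" by (cases s')
      have h': "h' a = h a" if "a < 128 * n + 12 * q" for a using 8 that by (simp add: s')
      have filled: "filled h" using R5 by (simp add: s R5_def R4_def)
      have "\<forall>i<4 * q. h (128 * n + 8 * q + i) = 0" using filled by (simp add: filled_def)
      from this[rule_format, of 0] have filled0: "h (128 * n + 8 * q) = 0" using q(2) by simp
      have ok: "product_ok 1 (2 * q) (\<lambda>i. h (128 * n + 8 * q + i)) (\<lambda>i. h (128 * n + i)) (\<lambda>i. h (128 * n + 4 * q + i))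
       (\<lambda>i. h' (128 * n + 12 * q + i))" using 8 by (simp add: s')
      have "h' (128 * n + 12 * q + (n + t - 1)) = (\<Sum>i<n. x i * unroll2 n y (i + t))" if t: "t < n" for t
      proof -
        have "h' (128 * n + 12 * q + (n + t - 1)) =
           (\<Sum>i\<le>n + t - 1. h (128 * n + i) * h (128 * n + 4 * q + (n + t - 1 - i)))"
          by (rule convolution_of_product_ok[OF ok, where a = n and b = "2 * n"])
            (use filled filled0 q t in \<open>auto simp: filled_def\<close>)
        also have "\<dots> = (\<Sum>i<n. x i * unroll2 n y (i + t))"
          by (rule convolution_eq_correlation[OF n q(1) t]) (use filled in \<open>simp_all add: filled_def\<close>)
        finally show ?thesis .
      qed
      then show ?case using 8 R5 h' by (simp add: s s' R4_def R2_def R5_def R6_def input_ok_def)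
    qed (use R5 n q in \<open>auto simp: s R2_def R4_def R5_def q_def\<close>)
  next
    fix s assume R6: "R6 s"
    obtain iv rv h where s: "s = (iv, rv, h)" by (cases s)
    show "wp sum_loop (2 * n + 2) R7 s"
      unfolding s
      by (rule wp_weaken[OF sum_loop_correct[where n = n and x = x and y = y]])
        (use R6 n in \<open>auto simp: s R2_def R6_def R7_def input_ok_def\<close>)
  next
    fix s assume R7: "R7 s"
    obtain iv rv h where s: "s = (iv, rv, h)" by (cases s)
    show "wp scan_loop (4 * n + 2) R8 s"
      unfolding s
    proof (rule wp_weaken[OF scan_loop_correct[where n = n and q = q and y = y and c = c
          and E = "shift_opt n x y" and W = "\<lambda>s. \<Sum>i<n. (unroll2 n y (i + s))\<^sup>2"]], goal_cases)
      case (8 t)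
      then show ?case using sum_unroll2_shift[of t n "\<lambda>r. r\<^sup>2" y] by (simp add: power2_sum)
    next
      case (10 t)
      then show ?case using R7 by (simp add: s R7_def R6_def shift_opt_expand)
    next
      case (11 s')
      then show ?case by (cases s') (simp add: R8_def)
    qed (use R7 n in \<open>auto simp: s R2_def R6_def R7_def input_ok_def c_def unroll2_def\<close>)
  next
    fix s assume R8: "R8 s"
    obtain iv rv h where s: "s = (iv, rv, h)" by (cases s)
    obtain t where t: "t < n" "rv 2 = real t" "rv 0 = shift_opt n x y t" "rv 1 = c t"
      "\<forall>s'<n. shift_opt n x y t \<le> shift_opt n x y s'"
      using R8 by (auto simp: s R8_def)
    show "wp normalize_offset 4 (\<lambda>(iv, rv, h). \<exists>s<n. rv 2 = real s \<and> rv 0 = shift_opt n x y s \<and>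
       rv 1 = frac (- (\<Sum>i<n. x i - unroll2 n y (i + s)) / real n) \<and>
       (\<forall>s'<n. shift_opt n x y s \<le> shift_opt n x y s')) s"
      unfolding s
    proof (rule wp_weaken[OF normalize_offset_correct], goal_cases)
      case (3 s')
      then show ?case using t c_eq[OF t(1)] by (cases s') (auto intro!: exI[of _ t])
    qed (use t c_bounds[OF t(1)] in auto)
  qed
  then show ?thesis
    by (rule wp_weaken) (auto simp: T q_def algebra_simps)
qed

lemma cwf_program: "cwf program"
  by (simp add: program_def copy_loop_def size_loop_def clear_loop_def fill_loop_def fill_body_def
    forward_loop_def forward_body_def
    split_loop_def param_loop_def backward_loop_def leaf_loop_def merge_loop_def sum_loop_def
    scan_loop_def score_def save_def advance_def normalize_offset_def)

text \<open>Minimality of \<open>K\<close> bounds its predecessor power by \<open>3 * n / 4\<close>,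
  which keeps the transform length linear in \<open>n\<close>.\<close>

lemma exists_size:
  fixes n :: nat
  assumes "n \<ge> 1"
  obtains K :: nat where "\<And>k. k < K \<Longrightarrow> 4 * 2 ^ k < 3 * n" "3 * n \<le> 4 * 2 ^ K" "2 ^ K \<le> 2 * n"
proof -
  define K where "K = (LEAST k. 3 * n \<le> 4 * 2 ^ k)"
  have "3 * n \<le> 4 * 2 ^ n" using less_exp[of n] by linarith
  then have K: "3 * n \<le> 4 * 2 ^ K" unfolding K_def by (rule LeastI)
  have less: "4 * 2 ^ k < 3 * n" if "k < K" for k using not_less_Least[of k] that unfolding K_def by fastforce
  have "2 ^ K \<le> 2 * n"
  proof (cases K)
    case (Suc k)
    then show ?thesis using less[of k] by simp
  qed (use assms in simp)
  with K less show thesis using that by blast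
qed

lemma time_bound:
  assumes n: "n \<ge> 1" and K: "2 ^ K \<le> 2 * n"
  shows "real (12 * n + 2 * K + 28 * 2 ^ K + Suc K * (8 * 2 ^ K + 14) + 21) \<le> 200 * (real n * log 2 (real n)) + 200"
proof -
  define L where "L = log 2 (real n)"
  have "real K = log 2 (2 ^ K)" by simp
  also have "(2::real) ^ K \<le> 2 * real n" using of_nat_mono[OF K, where 'a = real] by simp
  then have "log 2 (2 ^ K) \<le> log 2 (2 * real n)" using n by (subst log_le_cancel_iff) auto
  also have "\<dots> = 1 + L" using n by (simp add: L_def log_mult)
  finally have KL: "real K \<le> 1 + L" .
  have q: "(2::real) ^ K \<le> 2 * real n" using of_nat_mono[OF K, where 'a = real] by simp
  have L0: "0 \<le> L" using n by (simp add: L_def)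
  have prod_le: "(real K + 1) * (8 * 2 ^ K + 14) \<le> (2 + L) * (16 * real n + 14)"
    using KL q L0 by (intro mult_mono) auto
  then have le: "real (12 * n + 2 * K + 28 * 2 ^ K + Suc K * (8 * 2 ^ K + 14) + 21)
     \<le> 12 * real n + 2 * (1 + L) + 56 * real n + (2 + L) * (16 * real n + 14) + 21"
  proof -
    have eq: "real (12 * n + 2 * K + 28 * 2 ^ K + Suc K * (8 * 2 ^ K + 14) + 21)
      = 12 * real n + 2 * real K + 28 * 2 ^ K + (real K + 1) * (8 * 2 ^ K + 14) + 21"
      by (simp add: algebra_simps)
    have "28 * 2 ^ K \<le> 56 * real n" "2 * real K \<le> 2 * (1 + L)" using KL q by simp_all
    with prod_le show ?thesis unfolding eq by (intro add_mono) simp_all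
  qed
  show ?thesis
  \<comment> \<open>For \<open>n = 1\<close> the logarithm is 0 and the additive constant carries
    everything. From \<open>n = 2\<close> on it is at least 1, so linear terms are absorbed by
    \<open>n * log 2 n\<close>.\<close>
  proof (cases "n = 1")
    case True
    then show ?thesis using le by (simp add: L_def)
  next
    case False
    with n have n2: "2 \<le> real n" by simp
    then have "log 2 2 \<le> L" unfolding L_def by (subst log_le_cancel_iff) auto
    then have "1 \<le> L" by simp
    then have "real n * 1 \<le> real n * L" "L * 1 \<le> L * real n" "1 * 1 \<le> real n * L"
      using n2 by (intro mult_left_mono mult_mono; simp)+
    then show ?thesis using le unfolding L_def[symmetric] by (simp add: algebra_simps)
  qed
qed

theorem theorem1:
  shows "\<exists>(P::instr list) (C::real). C > 0 \<and>
    (\<forall>n x y. n \<ge> 1 \<longrightarrow> valid_necklace n x \<longrightarrow> valid_necklace n y \<longrightarrow>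
       (\<exists>T m. real T \<le> C * real n * log 2 (real n) + C \<and>
              ram_halts_within P (neck_input n x y) T m \<and>
              solves_l2_necklace n x y m))"
proof (rule exI, rule exI, intro conjI allI impI)
  let ?P = "prologue @ ccomp program (length prologue) @ [Halt]"
  \<comment> \<open>Both lengths belong to one fixed program, 200 comes from
    \<open>time_bound\<close>, and the 1 makes positivity immediate.\<close>
  define C where "C = real (length prologue) + 200 * real (clen program) + 1"
  show "0 < C" by (simp add: C_def)
  fix n x y
  assume n: "n \<ge> 1" and x: "valid_necklace n x" and y: "valid_necklace n y"
  obtain K where K: "\<And>k. k < K \<Longrightarrow> 4 * 2 ^ k < 3 * n" "3 * n \<le> 4 * 2 ^ K" "2 ^ K \<le> 2 * n"
    using exists_size[OF n] by blast
  define T where "T = 12 * n + 2 * K + 28 * 2 ^ K + Suc K * (8 * 2 ^ K + 14) + 21"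
  have "neck_input n x y 0 = real n" by (simp add: neck_input_def)
  from compiled_program_correct[of "neck_input n x y" n, OF this n cwf_program program_correct[OF n x y K(1,2) T_def]]
  obtain m s where halts: "ram_halts_within ?P (neck_input n x y) (length prologue + T * clen program) m"
    and rep: "represents s m" and s: "case s of (iv, rv, h) \<Rightarrow> \<exists>s<n. rv 2 = real s \<and> rv 0 = shift_opt n x y s \<and>
     rv 1 = frac (- (\<Sum>i<n. x i - unroll2 n y (i + s)) / real n) \<and>
     (\<forall>s'<n. shift_opt n x y s \<le> shift_opt n x y s')" by blast
  obtain iv rv h where s_eq: "s = (iv, rv, h)" by (cases s)
  have m: "m 0 = rv 0" "m 1 = rv 1" "m 2 = rv 2" using rep by (simp_all add: represents_def s_eq)
  obtain t where t: "t < n" "rv 2 = real t" "rv 0 = shift_opt n x y t"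
    "rv 1 = frac (- (\<Sum>i<n. x i - unroll2 n y (i + t)) / real n)"
    "\<And>s'. s' < n \<Longrightarrow> shift_opt n x y t \<le> shift_opt n x y s'"
    using s by (auto simp: s_eq)
  have solves: "solves_l2_necklace n x y m"
    unfolding solves_l2_necklace_def m using t neck_cost2_minimum[OF n x y t(1,5)]
    by (intro exI[of _ t]) (auto simp: frac_lt_1)
  define M where "M = real n * log 2 (real n)"
  have M: "0 \<le> M" using n by (simp add: M_def)
  have "real T \<le> 200 * M + 200"
    unfolding T_def M_def by (rule time_bound[OF n K(3)])
  then have "real T * real (clen program) \<le> (200 * M + 200) * real (clen program)"
    by (rule mult_right_mono) simp
  moreover have "0 \<le> real (length prologue) * M" using M by simp
  moreover have "C * M + C = real (length prologue) * M + (200 * M + 200) * real (clen program)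
      + M + real (length prologue) + 1"
    by (simp add: C_def algebra_simps)
  ultimately have "real (length prologue + T * clen program) \<le> C * M + C"
    using M unfolding of_nat_add of_nat_mult by linarith
  then have bound: "real (length prologue + T * clen program) \<le> C * real n * log 2 (real n) + C"
    by (simp add: M_def mult.assoc)
  show "\<exists>T m. real T \<le> C * real n * log 2 (real n) + C \<and>
              ram_halts_within ?P (neck_input n x y) T m \<and>
              solves_l2_necklace n x y m"
    using bound halts solves by blast
qed

end
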